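(* Let $\alpha\in(1/2,1)$ and let $X,X_1,X_2,\ldots$ be i.i.d. nonnegative integer valued random variables with span $1$ and distribution function $F$, and let $S_k=X_1+\dots+X_k$, $S_0=0$. Let $c,(k_n),\ell_1,A,\ell,\delta,M_R,\gamma,g_\lambda$ be as in the context, and assume that for all sufficiently large $x$ $$1-F(x)=\frac{\ell(x)}{x^{\alpha}}\,[M_R(\delta(x))+h_R(x)],$$ where $h_R$ is right-continuous and $\lim_{n\to\infty}h_R(A_{k_n}x)=0$ for every continuity point $x>0$ of $M_R$. Put $u_n=\sum_{k=0}^\infty \mathbb P(S_k=n)$ and $B(x)=x^\alpha\ell(x)^{-1}$. Then $$\lim_{n\to\infty}\left| n^{1-\alpha}\ell(n)\,u_n-\alpha\int_0^\infty g_{\gamma(B(n)x^{-\alpha})}(x)\,x^{-\alpha}\,\mathrm dx\right|=0 .$$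
   Context: Span: a random variable is lattice if it is concentrated on $a+h\mathbb Z$ for some $a\in\mathbb R$, $h>0$; the largest possible such $h$ is its span. Setting: $c>1$; $(k_n)_{n\ge1}$ is a strictly increasing sequence of positive integers with $k_{n+1}/k_n\to c$. $\ell_1:[1,\infty)\to(0,\infty)$ is slowly varying at infinity, $A(x)=A_x=x^{1/\alpha}\ell_1(x)$, and for large $x$ the slowly varying function $\ell$ is defined by $x^{-\alpha}\ell(x)=\sup\{t\in(0,1]: t^{-1/\alpha}\ell_1(1/t)>x\}$. (Then $A$ and $B(y)=y^\alpha/\ell(y)$ are asymptotic inverses of each other.) For all large $x$ there is a unique $k_n$ with $A_{k_n}\le x<A_{k_{n+1}}$, and $\delta(x)=x/A_{k_n}$. $M_R:(0,\infty)\to(0,\infty)$ is bounded, bounded away from $0$, right-continuous, not constant, satisfies $M_R(c^{1/\alpha}x)=M_R(x)$ for all $x>0$, and $x\mapsto M_R(x)x^{-\alpha}$ is nonincreasing. Position parameter: $\gamma(x)=\gamma_x=x/k_n$ where $k_{n-1}<x\le k_n$ (with the convention $k_0=0$). For $\lambda>0$ let $\Lambda_\lambda$ be the measure on $(0,\infty)$ with $\Lambda_\lambda((x,\infty))=x^{-\alpha}M_R(\lambda^{1/\alpha}x)$, $x>0$, and let $V_\lambda$ be the (nonnegative, semistable) random variable with characteristic function $\mathbb E e^{\mathrm itV_\lambda}=\exp\{\int_0^\infty(e^{\mathrm itx}-1)\Lambda_\lambda(\mathrm dx)\}$ (no centering is used when $\alpha<1$). $G_\lambda$ denotes its distribution function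 and $g_\lambda$ its (smooth) density. Note $G_{c\lambda}=G_\lambda$. *)

theory Defs
  imports "HOL-Probability.Probability"
begin

text \<open>Measurability near infinity is part of the notion of slow variation (Karamata's convention).\<close>

definition slowly_varying :: "(real \<Rightarrow> real) \<Rightarrow> bool" where
  "slowly_varying f \<longleftrightarrow>
     (\<exists>a. set_borel_measurable borel {a..} f \<and> (\<forall>x\<ge>a. 0 < f x)) \<and>
     (\<forall>t>0. ((\<lambda>x. f (t * x) / f x) \<longlongrightarrow> 1) at_top)"

definition concentrated_on_lattice :: "'a measure \<Rightarrow> ('a \<Rightarrow> real) \<Rightarrow> real \<Rightarrow> real \<Rightarrow> bool" where
  "concentrated_on_lattice P Y a h \<longleftrightarrow> (AE \<omega> in P. \<exists>j::int. Y \<omega> = a + h * of_int j)"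

definition has_span :: "'a measure \<Rightarrow> ('a \<Rightarrow> real) \<Rightarrow> real \<Rightarrow> bool" where
  "has_span P Y h \<longleftrightarrow> 0 < h \<and> (\<exists>a. concentrated_on_lattice P Y a h) \<and>
     (\<forall>h'>0. (\<exists>a. concentrated_on_lattice P Y a h') \<longrightarrow> h' \<le> h)"

definition partial_sum :: "(nat \<Rightarrow> 'a \<Rightarrow> nat) \<Rightarrow> nat \<Rightarrow> 'a \<Rightarrow> nat" where
  "partial_sum X m \<omega> = (\<Sum>i<m. X i \<omega>)"

definition renewal_mass :: "'a measure \<Rightarrow> (nat \<Rightarrow> 'a \<Rightarrow> nat) \<Rightarrow> nat \<Rightarrow> real" where
  "renewal_mass P X n = (\<Sum>m. measure P {\<omega> \<in> space P. partial_sum X m \<omega> = n})"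

definition norming :: "real \<Rightarrow> (real \<Rightarrow> real) \<Rightarrow> real \<Rightarrow> real" where
  "norming \<alpha> l1 x = x powr (1 / \<alpha>) * l1 x"

text \<open>The set below is bounded by 1 and, for large \<open>x\<close>, nonempty; only large \<open>x\<close> matter.\<close>

definition ell :: "real \<Rightarrow> (real \<Rightarrow> real) \<Rightarrow> real \<Rightarrow> real" where
  "ell \<alpha> l1 x = x powr \<alpha> * Sup {t. 0 < t \<and> t \<le> 1 \<and> t powr (- 1 / \<alpha>) * l1 (1 / t) > x}"

definition inverse_norming :: "real \<Rightarrow> (real \<Rightarrow> real) \<Rightarrow> real \<Rightarrow> real" where
  "inverse_norming \<alpha> l1 x = x powr \<alpha> / ell \<alpha> l1 x"

text \<open>
  A sequence \<open>(k\<^sub>n)\<close> with \<open>n \<ge> 1\<close> is represented by \<open>k :: nat \<Rightarrow> nat\<close>; the value \<open>k 0\<close> is the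
  convention \<open>k\<^sub>0 = 0\<close>. The index in \<open>delta\<close> is unique for large \<open>x\<close>; the index in
  \<open>position\<close> is unique for every \<open>x > 0\<close>.
\<close>

definition delta :: "real \<Rightarrow> (real \<Rightarrow> real) \<Rightarrow> (nat \<Rightarrow> nat) \<Rightarrow> real \<Rightarrow> real" where
  "delta \<alpha> l1 k x =
     x / norming \<alpha> l1 (real (k (THE n. 1 \<le> n \<and> norming \<alpha> l1 (real (k n)) \<le> x \<and>
                                      x < norming \<alpha> l1 (real (k (n + 1))))))"

definition position :: "(nat \<Rightarrow> nat) \<Rightarrow> real \<Rightarrow> real" where
  "position k x = x / real (k (THE n. 1 \<le> n \<and> real (k (n - 1)) < x \<and> x \<le> real (k n)))"

text \<open>A measure on \<open>(0, \<infinity>)\<close> is represented as a Borel measure on the reals that is null on the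
  complement.\<close>

definition levy_measure :: "real \<Rightarrow> (real \<Rightarrow> real) \<Rightarrow> real \<Rightarrow> real measure" where
  "levy_measure \<alpha> M\<^sub>R lam = (THE N. sets N = sets borel \<and> emeasure N {..0} = 0 \<and>
     (\<forall>x>0. emeasure N {x<..} = ennreal (x powr (- \<alpha>) * M\<^sub>R (lam powr (1 / \<alpha>) * x))))"

definition semistable_law :: "real \<Rightarrow> (real \<Rightarrow> real) \<Rightarrow> real \<Rightarrow> real measure" where
  "semistable_law \<alpha> M\<^sub>R lam = (THE \<mu>. real_distribution \<mu> \<and>
     (\<forall>t. char \<mu> t = exp (CLINT x:{0<..}|levy_measure \<alpha> M\<^sub>R lam. iexp (t * x) - 1)))"

text \<open>
  The pointwise values of the density matter, because it is evaluated at \<open>x\<close> with a parameter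
  depending on \<open>x\<close>. A nonnegative continuous density is unique, so the following selects
  the smooth version.
\<close>

definition semistable_density :: "real \<Rightarrow> (real \<Rightarrow> real) \<Rightarrow> real \<Rightarrow> real \<Rightarrow> real" where
  "semistable_density \<alpha> M\<^sub>R lam = (THE g. continuous_on UNIV g \<and> (\<forall>x. 0 \<le> g x) \<and>
     semistable_law \<alpha> M\<^sub>R lam = density lborel (\<lambda>x. ennreal (g x)))"

end

theory Submission
  imports Defs
begin

text \<open>
  Since \<open>n\<^sup>1\<^sup>-\<^sup>\<alpha> \<ell>(n) = n / B(n)\<close>, the renewal mass is an integral:
  \<open>n\<^sup>1\<^sup>-\<^sup>\<alpha> \<ell>(n) u\<^sub>n = \<integral>\<^sub>0\<^sup>\<infinity> n P(S\<^bsub>\<lfloor>B(n) y\<rfloor>\<^esub> = n) dy\<close>. The substitution \<open>y = x\<^sup>-\<^sup>\<alpha>\<close> turns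
  the limiting integral into \<open>\<integral>\<^sub>0\<^sup>\<infinity> x g\<^bsub>\<gamma>(B(n) y)\<^esub>(x) dy\<close> with \<open>x = y\<^sup>-\<^sup>1\<^sup>/\<^sup>\<alpha>\<close>, and the two integrands are compared by
  dominated convergence.

  Pointwise convergence is Fourier inversion together with \<open>\<phi>(t/L)\<^sup>m \<rightarrow> exp (\<Psi>\<^sub>\<lambda>(t))\<close>. As \<open>\<gamma>(B(n) y)\<close>
  does not converge, one passes to subsequences along which it does.

  For the domination, Potter bounds for \<open>B\<close> give \<open>\<bar>\<phi>(s/n)\<bar> \<le> exp (- C \<kappa>(s) / B(n))\<close>, hence
  \<open>n P(S\<^sub>m = n) \<le> K W(m / B(n))\<close> with \<open>W(y) \<approx> y\<^sup>-\<^sup>1\<^sup>/\<^sup>\<alpha>\<close>, which is integrable at infinity only. Near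
  \<open>0\<close> one gains a factor \<open>m / B(n)\<close> by averaging the inversion integral with its translate by \<open>\<pi> / n\<close>
  (which changes the sign of \<open>exp (- i n t)\<close>) and using \<open>\<bar>\<phi>(t + \<pi>/n) - \<phi>(t)\<bar> \<le> C / B(n)\<close>. The result
  \<open>y\<^sup>1\<^sup>-\<^sup>1\<^sup>/\<^sup>\<alpha>\<close> is integrable at \<open>0\<close> exactly because \<open>\<alpha> > 1/2\<close>.
\<close>

section \<open>Slow variation\<close>

text \<open>The hypothesis on \<open>h\<close> speaks only of the points \<open>A (k n) * x\<close>
  with \<open>x\<close> a continuity point of \<open>M\<close>. Density of these points and
  monotonicity of \<open>F\<close> extend the tail limits to convergent arguments and give two-sided
  bounds of order \<open>1 / B x\<close> at every large \<open>x\<close>. Slowly varying factors are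
  absorbed by fixed exponents \<open>b1 < \<alpha> < b2\<close>, placed inside the interval from 1/2
  to 1 so that every integrability condition stays strict. As \<alpha> < 1, the tail of the Levy
  measure is integrable at 0 but not at infinity. Exponents are therefore compared after truncation
  at a level \<open>R\<close>, with an error of twice the tail at \<open>R\<close>. Law and density
  of the limit are given by descriptions, so their existence has to be proved. The law is obtained
  as a weak limit of \<open>S m / L\<close>, and the bounds for its characteristic function and its
  density are inherited in the limit from those for \<phi> and for the point probabilities. The
  interval \<open>{-4..4}\<close> contains \<open>{-pi..pi}\<close> and its translate by
  \<open>pi / n\<close> for \<open>n \<ge> 4\<close>, while 4 < 2 pi lets span 1 exclude modulus 1
  on it away from 0.\<close>

lemma eventually_gt_filterlim:
  fixes f :: "'b \<Rightarrow> real"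
  shows "filterlim f at_top F \<Longrightarrow> \<forall>\<^sub>F x in F. c < f x"
  by (simp add: filterlim_at_top_dense)

lemma eventually_ge_filterlim:
  fixes f :: "'b \<Rightarrow> 'c::linorder"
  shows "filterlim f at_top F \<Longrightarrow> \<forall>\<^sub>F x in F. c \<le> f x"
  by (simp add: filterlim_at_top)

text \<open>The uniform convergence theorem in additive form. If it failed along \<open>u n\<close>,
  \<open>v n\<close>, the averages over \<open>w\<close> of the truncated increments from
  \<open>u n\<close> and from \<open>u n + v n\<close> would still tend to 0 by dominated
  convergence, which is where measurability enters. The triangle inequality through the point
  \<open>u n + v n + w\<close> bounds their sum below by \<open>min 1 e\<close>.\<close>

lemma uniform_increments:
  fixes g :: "real \<Rightarrow> real"
  assumes meas [measurable]: "g \<in> borel_measurable borel"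
    and lim: "\<And>v. ((\<lambda>u. g (u + v) - g u) \<longlongrightarrow> 0) at_top"
    and e: "0 < e"
  shows "\<exists>U. \<forall>u\<ge>U. \<forall>v\<in>{0..1}. \<bar>g (u + v) - g u\<bar> \<le> e"
proof (rule ccontr)
  assume "\<not> ?thesis"
  then have "\<forall>n::nat. \<exists>u v. u \<ge> real n \<and> v \<in> {0..1} \<and> \<bar>g (u + v) - g u\<bar> > e"
    by (metis not_le)
  then obtain u v where u: "\<And>n::nat. u n \<ge> real n" and v: "\<And>n. v n \<in> {0..1}"
    and big: "\<And>n. \<bar>g (u n + v n) - g (u n)\<bar> > e" by metis
  have u_top: "filterlim u at_top sequentially"
    by (rule filterlim_at_top_mono[OF filterlim_real_sequentially]) (simp add: u)
  have uv_top: "filterlim (\<lambda>n. u n + v n) at_top sequentially"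
    by (rule filterlim_at_top_mono[OF u_top]) (use v in auto)
  have zero: "(\<lambda>n. LBINT w. indicator {0..b} w * min 1 \<bar>g (x n + w) - g (x n)\<bar>) \<longlonglongrightarrow> (LBINT w::real. 0)"
    if x: "filterlim x at_top sequentially" for x :: "nat \<Rightarrow> real" and b :: real
  proof (rule integral_dominated_convergence[where w="\<lambda>w. indicator {0..b} w"])
    show "AE w in lborel. (\<lambda>n. indicator {0..b} w * min 1 \<bar>g (x n + w) - g (x n)\<bar>) \<longlonglongrightarrow> 0"
    proof (rule AE_I2)
      fix w
      have "(\<lambda>n. g (x n + w) - g (x n)) \<longlonglongrightarrow> 0"
        using filterlim_compose[OF lim x] by simp
      then have "(\<lambda>n. indicator {0..b} w * min 1 \<bar>g (x n + w) - g (x n)\<bar>) \<longlonglongrightarrow> indicator {0..b} w * min 1 \<bar>0\<bar>"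
        by (intro tendsto_intros)
      then show "(\<lambda>n. indicator {0..b} w * min 1 \<bar>g (x n + w) - g (x n)\<bar>) \<longlonglongrightarrow> 0" by simp
    qed
    show "integrable lborel (\<lambda>w. indicator {0..b} w :: real)"
      by (simp add: emeasure_lborel_Icc_eq)
  qed (auto split: split_indicator)
  let ?P = "\<lambda>n w. min 1 \<bar>g (u n + w) - g (u n)\<bar>"
  let ?Q = "\<lambda>n w. min 1 \<bar>g (u n + v n + w) - g (u n + v n)\<bar>"
  have int: "integrable lborel (\<lambda>w. indicator {a..b} w * min 1 \<bar>g (x + w) - y\<bar>)" for a b x y :: real
    by (rule Bochner_Integration.integrable_bound[where f="\<lambda>w. indicator {a..b} w :: real"])
       (auto simp: emeasure_lborel_Icc_eq split: split_indicator)
  have le: "min 1 e \<le> (LBINT w. indicator {0..2} w * ?P n w) + (LBINT w. indicator {0..1} w * ?Q n w)" for n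
  proof -
    have "min 1 e = (LBINT w::real. indicator {0..1} w * min 1 e)" by simp
    also have "\<dots> \<le> (LBINT w. indicator {0..1} w * ?P n (v n + w) + indicator {0..1} w * ?Q n w)"
    proof (rule integral_mono)
      have "integrable lborel (\<lambda>w. indicator {0..1} w * min 1 \<bar>g ((u n + v n) + w) - g (u n)\<bar>)"
        by (rule int)
      then show "integrable lborel (\<lambda>w. indicator {0..1} w * ?P n (v n + w) + indicator {0..1} w * ?Q n w)"
        by (intro Bochner_Integration.integrable_add int) (simp add: add.assoc)
      fix w :: real
      show "indicator {0..1} w * min 1 e \<le> indicator {0..1} w * ?P n (v n + w) + indicator {0..1} w * ?Q n w"
        using big[of n] by (auto split: split_indicator simp: min_def add.assoc)
    qed simp
    also have "\<dots> = (LBINT w. indicator {0..1} w * ?P n (v n + w)) + (LBINT w. indicator {0..1} w * ?Q n w)"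
      using int[of 0 1 "u n + v n" "g (u n)"]
      by (intro Bochner_Integration.integral_add int) (simp add: add.assoc)
    also have "(LBINT w. indicator {0..1} w * ?P n (v n + w)) = (LBINT w. indicator {v n..v n + 1} w * ?P n w)"
      by (subst (2) lborel_integral_real_affine[where c=1 and t="v n"])
         (auto intro!: Bochner_Integration.integral_cong split: split_indicator)
    \<comment> \<open>The moving window is enlarged to a fixed one, to which \<open>zero\<close>
      applies.\<close>
    also have "\<dots> \<le> (LBINT w. indicator {0..2} w * ?P n w)"
      by (rule integral_mono[OF int int]) (use v[of n] in \<open>auto split: split_indicator\<close>)
    finally show ?thesis by simp
  qed
  have "(\<lambda>n. (LBINT w. indicator {0..2} w * ?P n w) + (LBINT w. indicator {0..1} w * ?Q n w)) \<longlonglongrightarrow> 0 + 0"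
    using zero[OF u_top, of 2] zero[OF uv_top, of 1] by (intro tendsto_add) simp_all
  then have "min 1 e \<le> 0 + 0"
    by (rule tendsto_lowerbound) (use le in auto)
  with e show False by simp
qed

text \<open>A distance \<open>d\<close> is covered by at most \<open>d + 1\<close> steps of length
  at most 1, each costing \<open>e\<close>.\<close>

lemma linear_growth_increments:
  fixes g :: "real \<Rightarrow> real"
  assumes loc: "\<And>u v. U \<le> u \<Longrightarrow> v \<in> {0..1} \<Longrightarrow> \<bar>g (u + v) - g u\<bar> \<le> e"
    and u: "U \<le> u" "U \<le> w" and e: "0 \<le> e"
  shows "\<bar>g u - g w\<bar> \<le> e * (1 + \<bar>u - w\<bar>)"
proof -
  have step: "\<bar>g y - g x\<bar> \<le> e * (real n + 1)" if "U \<le> x" "x + real n \<le> y" "y \<le> x + real n + 1" for x y n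
    using that
  proof (induction n arbitrary: x)
    case 0
    then show ?case using loc[of x "y - x"] by simp
  next
    case (Suc n)
    have "\<bar>g y - g (x + 1)\<bar> \<le> e * (real n + 1)" by (rule Suc.IH) (use Suc.prems in auto)
    moreover have "\<bar>g (x + 1) - g x\<bar> \<le> e" using loc[of x 1] Suc.prems by simp
    ultimately show ?case by (simp add: algebra_simps)
  qed
  have main: "\<bar>g y - g x\<bar> \<le> e * (1 + (y - x))" if "U \<le> x" "x \<le> y" for x y
  proof -
    let ?n = "nat \<lfloor>y - x\<rfloor>"
    have n: "real ?n \<le> y - x" "y - x \<le> real ?n + 1" using that by linarith+
    have "\<bar>g y - g x\<bar> \<le> e * (real ?n + 1)" by (intro step) (use n that in linarith)+
    also have "\<dots> \<le> e * (1 + (y - x))" using n e by (intro mult_left_mono) auto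
    finally show ?thesis .
  qed
  show ?thesis using main[of u w] main[of w u] u by (cases "u \<le> w") (auto simp: abs_minus_commute)
qed

text \<open>Under \<open>x = exp u\<close> multiplicative increments of \<open>f\<close> become
  additive increments of \<open>g\<close>. The outcome is Potter's bound in logarithmic form: \<eta>
  also multiplies the distance, so slow variation costs no more than a small power of
  \<open>s / r\<close>.\<close>

lemma slowly_varying_log_increments:
  assumes sv: "slowly_varying f" and eta: "0 < \<eta>"
  shows "\<exists>x0. \<forall>s\<ge>x0. \<forall>r\<ge>x0. \<bar>ln (f s) - ln (f r)\<bar> \<le> \<eta> * (1 + \<bar>ln s - ln r\<bar>)"
proof -
  obtain a where meas: "set_borel_measurable borel {a..} f" and pos: "\<And>x. x \<ge> a \<Longrightarrow> 0 < f x"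
    and lim: "\<And>t. t > 0 \<Longrightarrow> ((\<lambda>x. f (t * x) / f x) \<longlongrightarrow> 1) at_top"
    using sv unfolding slowly_varying_def by metis
  \<comment> \<open>Measurability is given only on \<open>{a..}\<close>. The cut-off makes
    \<open>g\<close> Borel on the whole line and changes nothing near infinity.\<close>
  define F where "F x = indicator {a..} x *\<^sub>R f x" for x
  have [measurable]: "F \<in> borel_measurable borel"
    using meas unfolding set_borel_measurable_def F_def .
  define g where "g u = ln (F (exp u))" for u
  have gm: "g \<in> borel_measurable borel" unfolding g_def by measurable
  have glim: "((\<lambda>u. g (u + v) - g u) \<longlongrightarrow> 0) at_top" for v
  proof -
    have "((\<lambda>u. ln (f (exp v * exp u) / f (exp u))) \<longlongrightarrow> ln 1) at_top"
      by (rule filterlim_compose[OF tendsto_ln[OF lim] exp_at_top]) (auto simp: tendsto_ident_at)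
    moreover have "\<forall>\<^sub>F u in at_top. ln (f (exp v * exp u) / f (exp u)) = g (u + v) - g u"
    proof -
      have "\<forall>\<^sub>F u in at_top. exp u \<ge> a" "\<forall>\<^sub>F u in at_top. exp (v + u) \<ge> a"
        using exp_at_top filterlim_compose[OF exp_at_top filterlim_tendsto_add_at_top[OF tendsto_const filterlim_ident]]
        by (auto simp: filterlim_at_top)
      then show ?thesis
        by eventually_elim (simp add: g_def F_def exp_add add.commute ln_div mult.commute pos less_imp_neq[OF pos, symmetric])
    qed
    ultimately show ?thesis by (simp add: tendsto_cong)
  qed
  obtain U where U: "\<And>u v. u \<ge> U \<Longrightarrow> v \<in> {0..1} \<Longrightarrow> \<bar>g (u + v) - g u\<bar> \<le> \<eta>"
    using uniform_increments[OF gm glim eta] by blast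
  show ?thesis
  proof (intro exI[of _ "max (max a 1) (exp U)"] allI impI)
    fix s r assume s: "max (max a 1) (exp U) \<le> s" and r: "max (max a 1) (exp U) \<le> r"
    have "g (ln x) = ln (f x) \<and> U \<le> ln x" if "max (max a 1) (exp U) \<le> x" for x
      using that by (auto simp: g_def F_def ln_ge_iff)
    with linear_growth_increments[where U=U and g=g and e=\<eta> and u="ln s" and w="ln r"] U s r eta
    show "\<bar>ln (f s) - ln (f r)\<bar> \<le> \<eta> * (1 + \<bar>ln s - ln r\<bar>)" by simp
  qed
qed

section \<open>Regular variation of the norming and of its inverse\<close>

text \<open>Regular variation with index \<open>\<rho>\<close>, in the form of Potter's bounds.\<close>

definition log_regular :: "real \<Rightarrow> (real \<Rightarrow> real) \<Rightarrow> bool" where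
  "log_regular \<rho> g \<longleftrightarrow> (\<forall>\<eta>>0. \<exists>x0\<ge>1. (\<forall>s\<ge>x0. 0 < g s) \<and>
     (\<forall>s\<ge>x0. \<forall>r\<ge>x0. \<bar>ln (g s) - ln (g r) - \<rho> * (ln s - ln r)\<bar> \<le> \<eta> * (1 + \<bar>ln s - ln r\<bar>)))"

lemma log_regularE:
  assumes "log_regular \<rho> g" "0 < \<eta>"
  obtains x0 where "1 \<le> x0" "\<And>s. x0 \<le> s \<Longrightarrow> 0 < g s"
    "\<And>s r. x0 \<le> s \<Longrightarrow> x0 \<le> r \<Longrightarrow> \<bar>ln (g s) - ln (g r) - \<rho> * (ln s - ln r)\<bar> \<le> \<eta> * (1 + \<bar>ln s - ln r\<bar>)"
  using assms unfolding log_regular_def by metis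

lemma log_regular_at_top:
  assumes g: "log_regular \<rho> g" and "0 < \<rho>"
  shows "filterlim g at_top at_top"
proof -
  obtain x0 where x0: "1 \<le> x0" "\<And>s. x0 \<le> s \<Longrightarrow> 0 < g s"
    and P: "\<And>s r. x0 \<le> s \<Longrightarrow> x0 \<le> r \<Longrightarrow>
      \<bar>ln (g s) - ln (g r) - \<rho> * (ln s - ln r)\<bar> \<le> \<rho> / 2 * (1 + \<bar>ln s - ln r\<bar>)"
    using log_regularE[OF g, of "\<rho> / 2"] assms(2) by (metis half_gt_zero)
  have "filterlim (\<lambda>s. exp (ln (g x0) - \<rho> / 2 - \<rho> / 2 * ln x0 + \<rho> / 2 * ln s)) at_top at_top"
    by (intro filterlim_compose[OF exp_at_top] filterlim_tendsto_add_at_top[OF tendsto_const]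
      filterlim_tendsto_pos_mult_at_top[OF tendsto_const] ln_at_top) (use assms in auto)
  then show ?thesis
  proof (rule filterlim_at_top_mono)
    show "\<forall>\<^sub>F s in at_top. exp (ln (g x0) - \<rho> / 2 - \<rho> / 2 * ln x0 + \<rho> / 2 * ln s) \<le> g s"
      using eventually_ge_at_top[of x0]
    proof eventually_elim
      case (elim s)
      have "ln x0 \<le> ln s" using elim x0 by (subst ln_le_cancel_iff) auto
      then have "ln (g x0) - \<rho> / 2 - \<rho> / 2 * ln x0 + \<rho> / 2 * ln s \<le> ln (g s)"
      proof -
        have "\<bar>ln s - ln x0\<bar> = ln s - ln x0" using \<open>ln x0 \<le> ln s\<close> by simp
        then have "\<bar>ln (g s) - ln (g x0) - \<rho> * (ln s - ln x0)\<bar> \<le> \<rho> / 2 * (1 + (ln s - ln x0))"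
          using P[OF elim order.refl] by (simp only:)
        then have "- (\<rho> / 2 * (1 + (ln s - ln x0))) \<le> ln (g s) - ln (g x0) - \<rho> * (ln s - ln x0)"
          by linarith
        then show ?thesis by (simp add: algebra_simps add_divide_distrib)
      qed
      then show ?case using x0(2)[OF elim] by (simp add: ln_ge_iff)
    qed
  qed
qed

text \<open>Potter's bound is uniform in both arguments, so \<open>s i / r i\<close> need only
  converge to \<open>t\<close> instead of being equal to it. The logarithmic distance stays bounded,
  and \<eta> is arbitrary.\<close>

lemma log_regular_ratio:
  assumes g: "log_regular \<rho> g" and r: "filterlim r at_top F"
    and s: "((\<lambda>i. s i / r i) \<longlongrightarrow> t) F" and t: "0 < t"
  shows "((\<lambda>i. g (s i) / g (r i)) \<longlongrightarrow> t powr \<rho>) F"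
proof -
  have s_top: "filterlim s at_top F"
  proof -
    have "filterlim (\<lambda>i. s i / r i * r i) at_top F"
      by (rule filterlim_tendsto_pos_mult_at_top[OF s t r])
    moreover have "\<forall>\<^sub>F i in F. s i / r i * r i = s i"
      using eventually_gt_filterlim[OF r, where c=0] by eventually_elim auto
    ultimately show ?thesis by (simp add: filterlim_cong)
  qed
  have "((\<lambda>i. ln (g (s i)) - ln (g (r i)) - \<rho> * (ln (s i) - ln (r i))) \<longlongrightarrow> 0) F"
  proof (rule tendstoI)
    fix e :: real assume e: "0 < e"
    \<comment> \<open>\<open>L\<close> eventually bounds the logarithmic distance of
      \<open>s i\<close> and \<open>r i\<close>; \<eta> is then chosen to make
      \<open>\<eta> * (1 + L)\<close> smaller than \<open>e\<close>.\<close>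
    define L where "L = \<bar>ln t\<bar> + 1"
    have L: "0 < L" by (simp add: L_def)
    define q where "q = 1 + L"
    define \<eta> where "\<eta> = e / (2 * q)"
    have "0 < q" using L by (simp add: q_def)
    then have "0 < \<eta>" "\<eta> * q < e" using e by (simp_all add: \<eta>_def)
    then have eta: "0 < \<eta>" "\<eta> * (1 + L) < e" by (simp_all add: q_def)
    obtain x0 where x0: "1 \<le> x0"
      and P: "\<And>s r. x0 \<le> s \<Longrightarrow> x0 \<le> r \<Longrightarrow>
        \<bar>ln (g s) - ln (g r) - \<rho> * (ln s - ln r)\<bar> \<le> \<eta> * (1 + \<bar>ln s - ln r\<bar>)"
      using log_regularE[OF g eta(1)] by metis
    have "((\<lambda>i. \<bar>ln (s i / r i)\<bar>) \<longlongrightarrow> \<bar>ln t\<bar>) F" using s t by (intro tendsto_intros) auto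
    then have "\<forall>\<^sub>F i in F. \<bar>ln (s i / r i)\<bar> < L"
      by (rule order_tendstoD) (simp add: L_def)
    then show "\<forall>\<^sub>F i in F. dist (ln (g (s i)) - ln (g (r i)) - \<rho> * (ln (s i) - ln (r i))) 0 < e"
      using eventually_ge_filterlim[OF r, where c=x0]
        eventually_ge_filterlim[OF s_top, where c=x0]
    proof eventually_elim
      case (elim i)
      have "ln (s i / r i) = ln (s i) - ln (r i)" using elim x0 by (simp add: ln_div)
      then have "\<eta> * (1 + \<bar>ln (s i) - ln (r i)\<bar>) \<le> \<eta> * (1 + L)"
        using elim eta by (intro mult_left_mono) auto
      with P[of "s i" "r i"] elim eta show ?case unfolding dist_real_def diff_0_right by linarith
    qed
  qed
  then have "((\<lambda>i. exp (ln (g (s i)) - ln (g (r i)) - \<rho> * (ln (s i) - ln (r i)) + \<rho> * ln (s i / r i)))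
      \<longlongrightarrow> exp (0 + \<rho> * ln t)) F"
    using s t by (intro tendsto_intros) auto
  moreover obtain x0 where x0: "1 \<le> x0" "\<And>s. x0 \<le> s \<Longrightarrow> 0 < g s"
    using log_regularE[OF g, of 1] by (metis zero_less_one)
  have "\<forall>\<^sub>F i in F. exp (ln (g (s i)) - ln (g (r i)) - \<rho> * (ln (s i) - ln (r i)) + \<rho> * ln (s i / r i))
      = g (s i) / g (r i)"
      using eventually_ge_filterlim[OF r, where c=x0]
        eventually_ge_filterlim[OF s_top, where c=x0]
  proof eventually_elim
    case (elim i)
    have "ln (s i / r i) = ln (s i) - ln (r i)" using elim x0 by (simp add: ln_div)
    then show ?case using x0(2)[of "s i"] x0(2)[of "r i"] elim by (simp add: exp_diff)
  qed
  ultimately show ?thesis using t by (simp add: tendsto_cong powr_def)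
qed

text \<open>The analytic half of the setting: the law of the step is present only through its
  distribution function, so regular variation, tail estimates and Levy measures are developed
  without random variables.\<close>

locale semistable_tail =
  fixes F :: "real \<Rightarrow> real" and \<alpha> c :: real and k :: "nat \<Rightarrow> nat" and l1 M h :: "real \<Rightarrow> real"
  assumes alpha: "1 / 2 < \<alpha>" "\<alpha> < 1"
    and c: "1 < c"
    and k: "k 0 = 0" "strict_mono k" "(\<lambda>n. real (k (n + 1)) / real (k n)) \<longlonglongrightarrow> c"
    and l1: "\<And>x. 1 \<le> x \<Longrightarrow> 0 < l1 x" "slowly_varying l1"
    and M_pos: "\<And>x. 0 < x \<Longrightarrow> 0 < M x"
    and M_bounded: "\<exists>K. \<forall>x>0. M x \<le> K"
    and M_bounded_away: "\<exists>m>0. \<forall>x>0. m \<le> M x"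
    and M_right_cont: "\<And>x. 0 < x \<Longrightarrow> continuous (at_right x) M"
    and M_periodic: "\<And>x. 0 < x \<Longrightarrow> M (c powr (1 / \<alpha>) * x) = M x"
    and M_mono: "antimono_on {0<..} (\<lambda>x. M x * x powr (- \<alpha>))"
    and tail: "\<forall>\<^sub>F x in at_top. 1 - F x = ell \<alpha> l1 x / x powr \<alpha> * (M (delta \<alpha> l1 k x) + h x)"
    and h_lim: "\<And>x. 0 < x \<Longrightarrow> isCont M x \<Longrightarrow> (\<lambda>n. h (norming \<alpha> l1 (real (k n)) * x)) \<longlonglongrightarrow> 0"
    and F_mono: "mono F" and F_nonneg: "\<And>x. 0 \<le> F x" and F_lim: "(F \<longlongrightarrow> 1) at_top"
begin

abbreviation A :: "real \<Rightarrow> real" where "A \<equiv> norming \<alpha> l1"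
abbreviation B :: "real \<Rightarrow> real" where "B \<equiv> inverse_norming \<alpha> l1"

lemma alpha_pos: "0 < \<alpha>" using alpha by simp

lemma A_pos: "1 \<le> x \<Longrightarrow> 0 < A x"
  using l1(1) by (simp add: norming_def)

lemma A_regular: "log_regular (1 / \<alpha>) A"
  unfolding log_regular_def
proof (intro allI impI)
  fix \<eta> :: real assume "0 < \<eta>"
  from slowly_varying_log_increments[OF l1(2) this] obtain x0
    where x0: "\<And>s r. s\<ge>x0 \<Longrightarrow> r\<ge>x0 \<Longrightarrow> \<bar>ln (l1 s) - ln (l1 r)\<bar> \<le> \<eta> * (1 + \<bar>ln s - ln r\<bar>)" by blast
  have ln_A: "ln (A s) = ln s / \<alpha> + ln (l1 s)" if "1 \<le> s" for s
    using that l1(1)[OF that] by (simp add: norming_def ln_mult ln_powr)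
  show "\<exists>x0\<ge>1. (\<forall>s\<ge>x0. 0 < A s) \<and>
     (\<forall>s\<ge>x0. \<forall>r\<ge>x0. \<bar>ln (A s) - ln (A r) - 1 / \<alpha> * (ln s - ln r)\<bar> \<le> \<eta> * (1 + \<bar>ln s - ln r\<bar>))"
  proof (intro exI[of _ "max 1 x0"] conjI allI impI)
    fix s r assume "max 1 x0 \<le> s" "max 1 x0 \<le> r"
    then show "\<bar>ln (A s) - ln (A r) - 1 / \<alpha> * (ln s - ln r)\<bar> \<le> \<eta> * (1 + \<bar>ln s - ln r\<bar>)"
      using x0[of s r] ln_A[of s] ln_A[of r] by (simp add: diff_divide_distrib)
  qed (auto intro: A_pos)
qed

lemma A_at_top: "filterlim A at_top at_top"
  using log_regular_at_top[OF A_regular] alpha_pos by simp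

section \<open>Continuity points of \<open>M\<close> and the index behind
  \<open>delta\<close>\<close>

text \<open>\<open>M\<close> need not be monotone itself, but it is a monotone function times the
  continuous function \<open>x powr \<alpha>\<close>.\<close>

lemma countable_discont: "countable {z \<in> {0<..}. \<not> isCont M z}"
proof -
  have "countable {z \<in> {0<..}. \<not> isCont (\<lambda>x. - (M x * x powr (- \<alpha>))) z}"
    using M_mono by (intro mono_on_ctble_discont_open) (auto simp: monotone_on_def)
  moreover have *: "isCont M z" if z: "0 < z" and "isCont (\<lambda>x. - (M x * x powr (- \<alpha>))) z" for z
  proof -
    have "isCont (\<lambda>x. - (- (M x * x powr (- \<alpha>))) * x powr \<alpha>) z"
      by (rule isCont_mult[OF isCont_minus[OF that(2)]]) (use z in \<open>auto intro!: continuous_intros\<close>)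
    moreover have e: "\<forall>\<^sub>F x in nhds z. - (- (M x * x powr (- \<alpha>))) * x powr \<alpha> = M x"
    proof -
      have "\<forall>\<^sub>F x in nhds z. 0 < x" using eventually_nhds_in_open[of "{0<..}" z] z by simp
      then show ?thesis by eventually_elim (simp add: mult.assoc powr_add[symmetric])
    qed
    ultimately show ?thesis by (simp only: isCont_cong[OF e])
  qed
  have "{z \<in> {0<..}. \<not> isCont M z} \<subseteq> {z \<in> {0<..}. \<not> isCont (\<lambda>x. - (M x * x powr (- \<alpha>))) z}"
    using * by blast
  ultimately show ?thesis using countable_subset by blast
qed

lemma ex_cont_point:
  assumes "0 \<le> a" "a < b" obtains z where "a < z" "z < b" "isCont M z"
proof -
  obtain z where "z \<in> {a<..<b}" "z \<notin> {z \<in> {0<..}. \<not> isCont M z}"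
    using open_minus_countable[OF countable_discont, of "{a<..<b}"] assms by auto
  with that assms show thesis by auto
qed

lemma k_top: "filterlim (\<lambda>n. real (k n)) at_top sequentially"
  using filterlim_compose[OF filterlim_real_sequentially filterlim_subseq[OF k(2)]] .

lemma k_ge_1: "1 \<le> n \<Longrightarrow> 1 \<le> real (k n)"
  using strict_monoD[OF k(2), of 0 n] k(1) by simp

lemma A_k_pos: "1 \<le> n \<Longrightarrow> 0 < A (real (k n))"
  by (rule A_pos[OF k_ge_1])

lemma Ak_top: "filterlim (\<lambda>n. A (real (k n))) at_top sequentially"
  using filterlim_compose[OF A_at_top k_top] .

lemma Ak_Suc_ratio: "(\<lambda>n. A (real (k (Suc n))) / A (real (k n))) \<longlonglongrightarrow> c powr (1 / \<alpha>)"
  using log_regular_ratio[OF A_regular k_top] k(3) c by simp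

lemma c_powr_gt_1: "1 < c powr (1 / \<alpha>)"
  using c alpha_pos by (simp add: gr_one_powr)

text \<open>The condition under the \<open>THE\<close> in \<open>delta\<close>.\<close>

definition index_of :: "real \<Rightarrow> nat \<Rightarrow> bool" where
  "index_of x n \<longleftrightarrow> 1 \<le> n \<and> A (real (k n)) \<le> x \<and> x < A (real (k (n + 1)))"

text \<open>\<open>A\<close> need not be monotone, yet \<open>A (k j)\<close> increases strictly
  from some \<open>j1\<close> on, because consecutive ratios tend to
  \<open>c powr (1 / \<alpha>) > 1\<close>. For \<open>x\<close> above all earlier values only
  indices from \<open>j1\<close> on qualify; there the largest \<open>n\<close> with
  \<open>A (k n) \<le> x\<close> is the unique one.\<close>

lemma index_exists:
  "\<forall>\<^sub>F x in at_top. (\<exists>!n. index_of x n) \<and> (\<forall>n. index_of x n \<longrightarrow> J \<le> n)"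
proof -
  obtain j0 where j0: "\<And>j. j \<ge> j0 \<Longrightarrow> 1 < A (real (k (Suc j))) / A (real (k j))"
    using order_tendstoD(1)[OF Ak_Suc_ratio c_powr_gt_1] by (auto simp: eventually_sequentially)
  define j1 where "j1 = max (max j0 J) 1"
  have suc: "A (real (k j)) < A (real (k (Suc j)))" if "j1 \<le> j" for j
    using j0[of j] A_k_pos[of j] that by (simp add: j1_def)
  have less: "A (real (k i)) < A (real (k j))" if "j1 \<le> i" "i < j" for i j
    using that(2,1) by (induction rule: less_Suc_induct) (use suc in \<open>auto intro: less_trans\<close>)
  have le: "A (real (k i)) \<le> A (real (k j))" if "j1 \<le> i" "i \<le> j" for i j
    using less[of i j] that by (cases "i = j") auto
  \<comment> \<open>An index \<open>n < j1\<close> would need \<open>x < A (k (n + 1))\<close>,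
    which is impossible once \<open>x\<close> exceeds \<open>X0\<close>.\<close>
  define X0 where "X0 = Max ((\<lambda>j. A (real (k j))) ` {..j1})"
  have X0: "A (real (k j)) \<le> X0" if "j \<le> j1" for j
    using that by (auto simp: X0_def)
  have ge: "j1 \<le> n" if "X0 < x" "index_of x n" for x n
  proof (rule ccontr)
    assume "\<not> j1 \<le> n"
    then have "A (real (k (n + 1))) \<le> X0" by (intro X0) auto
    then show False using that by (auto simp: index_of_def)
  qed
  have "(\<exists>!n. index_of x n) \<and> (\<forall>n. index_of x n \<longrightarrow> J \<le> n)" if x: "X0 < x" for x
  proof (intro conjI ex_ex1I allI impI)
    show "J \<le> n" if "index_of x n" for n using ge[OF x that] by (simp add: j1_def)
    obtain N where N: "\<And>n. n \<ge> N \<Longrightarrow> x < A (real (k n))"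
      using eventually_gt_filterlim[OF Ak_top, where c=x]
      by (auto simp: eventually_sequentially)
    let ?S = "{n. j1 \<le> n \<and> A (real (k n)) \<le> x}"
    have fin: "finite ?S" 
    proof (rule finite_subset[of _ "{..N}"])
      show "?S \<subseteq> {..N}"
      proof
        fix n assume "n \<in> ?S"
        then show "n \<in> {..N}" using N[of n] by (cases "N \<le> n") auto
      qed
    qed simp
    have ne: "j1 \<in> ?S" using X0[of j1] x by auto
    define n where "n = Max ?S"
    have n: "n \<in> ?S" unfolding n_def using fin ne by (intro Max_in) auto
    have "n + 1 \<notin> ?S" using Max_ge[OF fin, of "n + 1"] n_def by auto
    then show "\<exists>n. index_of x n" using n by (auto simp: index_of_def j1_def intro!: exI[of _ n])
    show "n = m" if "index_of x n" "index_of x m" for n m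
    proof (rule ccontr)
      assume "n \<noteq> m"
      then consider "n + 1 \<le> m" | "m + 1 \<le> n" by linarith
      then show False
      proof cases
        case 1
        then show False using le[of "n + 1" m] ge[OF x that(1)] that by (auto simp: index_of_def)
      next
        case 2
        then show False using le[of "m + 1" n] ge[OF x that(2)] that by (auto simp: index_of_def)
      qed
    qed
  qed
  then show ?thesis by (intro eventually_mono[OF eventually_gt_at_top[of X0]])
qed

lemma delta_eq: "\<exists>!n. index_of x n \<Longrightarrow> index_of x n \<Longrightarrow> delta \<alpha> l1 k x = x / A (real (k n))"
  unfolding delta_def index_of_def by (subst the1_equality) auto

lemma F_le_1: "F x \<le> 1"
  by (rule tendsto_lowerbound[OF F_lim])
    (auto intro!: eventually_mono[OF eventually_ge_at_top[of x]] monoD[OF F_mono])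

section \<open>\<open>B\<close> as asymptotic inverse of \<open>A\<close>\<close>

text \<open>In terms of \<open>s = 1 / t\<close> this makes \<open>B x\<close> the infimum of all
  \<open>s \<ge> 1\<close> with \<open>A s > x\<close>, that is, a generalized inverse of
  \<open>A\<close>.\<close>

definition level_set :: "real \<Rightarrow> real set" where
  "level_set x = {t. 0 < t \<and> t \<le> 1 \<and> x < A (1 / t)}"

lemma B_eq: "0 < x \<Longrightarrow> B x = 1 / Sup (level_set x)"
proof -
  have "(1 / t) powr (1 / \<alpha>) = t powr (- 1 / \<alpha>)" if "0 < t" for t
    using that by (simp add: powr_divide powr_minus_divide)
  then have "level_set x = {t. 0 < t \<and> t \<le> 1 \<and> t powr (- 1 / \<alpha>) * l1 (1 / t) > x}"
    by (auto simp: level_set_def norming_def)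
  then show "0 < x \<Longrightarrow> ?thesis" by (simp add: inverse_norming_def ell_def)
qed

lemma level_set_nonempty: "level_set x \<noteq> {}"
proof -
  have "\<forall>\<^sub>F s in at_top. x < A s \<and> 1 \<le> s"
    using eventually_gt_filterlim[OF A_at_top, where c=x] eventually_ge_at_top[of 1]
    by eventually_elim auto
  then obtain s where s: "x < A s" "1 \<le> s" by (auto dest!: eventually_happens)
  then have "1 / s \<in> level_set x" by (auto simp: level_set_def)
  then show ?thesis by auto
qed

lemma level_set_bdd: "bdd_above (level_set x)"
  by (auto simp: level_set_def intro!: bdd_aboveI[of _ 1])

lemma Sup_level_set: "0 < Sup (level_set x)"
proof -
  obtain t where "t \<in> level_set x" using level_set_nonempty by auto
  then show ?thesis using cSup_upper[OF _ level_set_bdd, of t x] by (auto simp: level_set_def)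
qed

lemma tail_eq: "\<forall>\<^sub>F x in at_top. 1 - F x = (M (delta \<alpha> l1 k x) + h x) / B x"
  using tail by eventually_elim (simp add: inverse_norming_def)

lemma A_k_mult_top: "0 < z \<Longrightarrow> filterlim (\<lambda>j. A (real (k j)) * z) at_top sequentially"
  by (rule filterlim_at_top_mult_tendsto_pos[OF tendsto_const _ Ak_top])

text \<open>If \<open>A\<close> were unbounded on a bounded set, then \<open>B\<close> would be bounded; the tail assumption rules this
  out, since \<open>1 - F\<close> tends to \<open>0\<close> and \<open>M\<close> does not.\<close>

lemma B_at_top: "filterlim B at_top at_top"
proof -
  have key: "\<exists>x. \<forall>t\<in>level_set x. t \<le> 1 / K" if K: "0 < K" for K
  proof (rule ccontr)
    assume "\<not> ?thesis"
    \<comment> \<open>If every level set reached beyond \<open>1 / K\<close>, then \<open>B\<close>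
      would be at most \<open>K\<close> on the positive axis and the tail at
      \<open>A (k j) * z\<close> would stay above \<open>m / (2 * K)\<close>.\<close>
    then have ex: "\<exists>t\<in>level_set x. 1 / K < t" for x by (metis not_le)
    have Blt: "1 / K \<le> 1 / B x" if "0 < x" for x
    proof -
      obtain t where "t \<in> level_set x" "1 / K < t" using ex by auto
      then show ?thesis using cSup_upper[OF _ level_set_bdd, of t x] B_eq[OF that] by simp
    qed
    obtain m where m: "0 < m" "\<And>x. 0 < x \<Longrightarrow> m \<le> M x" using M_bounded_away by auto
    obtain z where z: "0 < z" "isCont M z" using ex_cont_point[of 0 1] by auto
    note top = A_k_mult_top[OF z(1)]
    have "\<forall>\<^sub>F j in sequentially. h (A (real (k j)) * z) > - (m / 2)"
      using order_tendstoD(1)[OF h_lim[OF z], of "- (m / 2)"] m by simp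
    moreover have "\<forall>\<^sub>F j in sequentially. (1 - F (A (real (k j)) * z)) < m / 2 / K"
    proof -
      have "(\<lambda>j. 1 - F (A (real (k j)) * z)) \<longlonglongrightarrow> 1 - 1"
        by (intro tendsto_intros filterlim_compose[OF F_lim top])
      then show ?thesis using m K by (intro order_tendstoD(2)[where y = "1 - 1"]) auto
    qed
    moreover note eventually_compose_filterlim[OF tail_eq top]
      eventually_compose_filterlim[OF eventually_gt_at_top[of 0] top]
      eventually_compose_filterlim[OF index_exists[of 1] top]
    ultimately have "\<forall>\<^sub>F j in sequentially. False"
    proof eventually_elim
      case (elim j)
      let ?x = "A (real (k j)) * z"
      from elim obtain n where n: "index_of ?x n" by auto
      have "delta \<alpha> l1 k ?x = ?x / A (real (k n))"
        using elim n by (intro delta_eq) auto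
      then have "0 < delta \<alpha> l1 k ?x"
        using elim n A_k_pos[of n] by (auto simp: index_of_def)
      from m(2)[OF this] have "m / 2 \<le> M (delta \<alpha> l1 k ?x) + h ?x" using elim by linarith
      then have "m / 2 * (1 / K) \<le> (M (delta \<alpha> l1 k ?x) + h ?x) * (1 / B ?x)"
        using Blt[of ?x] elim K m by (intro mult_mono) auto
      then show False using elim by simp
    qed
    then show False by simp
  qed
  show ?thesis
    unfolding filterlim_at_top_gt[where c=0]
  proof (intro allI impI)
    fix K :: real assume K: "0 < K"
    then obtain x where x: "\<And>t. t \<in> level_set x \<Longrightarrow> t \<le> 1 / K" using key[OF K] by blast
    show "\<forall>\<^sub>F y in at_top. K \<le> B y"
      using eventually_ge_at_top[of x] eventually_gt_at_top[of 0]
    proof eventually_elim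
      case (elim y)
      have "level_set y \<subseteq> level_set x" using elim by (auto simp: level_set_def)
      then have "Sup (level_set y) \<le> 1 / K"
        using x by (intro cSup_least level_set_nonempty) auto
      then have "K \<le> 1 / Sup (level_set y)" using Sup_level_set[of y] K by (simp add: field_simps)
      then show ?case using B_eq elim by simp
    qed
  qed
qed

text \<open>\<open>B x\<close> is the reciprocal of a supremum. Some \<open>1 / t\<close> within a
  factor \<open>exp \<eta>\<close> of \<open>B x\<close> satisfies \<open>A (1 / t) > x\<close>,
  whereas \<open>A (B x * exp (- \<eta>)) \<le> x\<close>. Potter's bound for \<open>A\<close>
  carries both inequalities over to \<open>A (B x)\<close> at the price of \<open>e\<close>.\<close>

lemma ln_A_B: "((\<lambda>x. ln (A (B x)) - ln x) \<longlongrightarrow> 0) at_top"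
proof (rule tendstoI)
  fix e :: real assume e: "0 < e"
  \<comment> \<open>\<open>q\<close> is chosen so that
    \<open>\<eta> / \<alpha> + \<eta> * (1 + \<eta>)\<close>, the variation of \<open>ln A\<close>
    over a logarithmic distance \<eta>, is below \<open>e\<close>.\<close>
  define q where "q = 2 + 1 / \<alpha>"
  have p: "0 < q" using alpha_pos by (simp add: q_def add_pos_pos)
  define \<eta> where "\<eta> = min 1 (e / (2 * q))"
  have eta: "0 < \<eta>" "\<eta> \<le> 1" using e p by (auto simp: \<eta>_def)
  have "\<eta> * q \<le> e / (2 * q) * q"
    using p by (intro mult_right_mono) (auto simp: \<eta>_def)
  also have "\<dots> = e / 2" using p by simp
  also have "\<dots> < e" using e by simp
  finally have eta3: "\<eta> * (2 + 1 / \<alpha>) < e" by (simp add: q_def)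
  have "\<eta> * \<eta> \<le> \<eta> * 1" using eta by (intro mult_left_mono) auto
  then have small: "\<eta> / \<alpha> + \<eta> * (1 + \<eta>) < e" using eta3 by (simp add: algebra_simps)
  obtain x0 where x0: "1 \<le> x0" and P: "\<And>s r. x0 \<le> s \<Longrightarrow> x0 \<le> r \<Longrightarrow>
      \<bar>ln (A s) - ln (A r) - 1 / \<alpha> * (ln s - ln r)\<bar> \<le> \<eta> * (1 + \<bar>ln s - ln r\<bar>)"
    using log_regularE[OF A_regular eta(1)] by metis
  have close: "\<bar>ln (A s) - ln (A r)\<bar> < e" if "x0 \<le> s" "x0 \<le> r" "\<bar>ln s - ln r\<bar> \<le> \<eta>" for s r
  proof -
    have "\<eta> * (1 + \<bar>ln s - ln r\<bar>) \<le> \<eta> * (1 + \<eta>)" using that eta by (intro mult_left_mono) auto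
    moreover have "\<bar>1 / \<alpha> * (ln s - ln r)\<bar> \<le> \<eta> / \<alpha>"
      using that alpha_pos by (simp add: abs_mult divide_right_mono)
    ultimately show ?thesis using P[OF that(1,2)] small by linarith
  qed
  have "\<forall>\<^sub>F x in at_top. x0 * exp \<eta> \<le> B x"
    using B_at_top by (auto simp: filterlim_at_top)
  then show "\<forall>\<^sub>F x in at_top. dist (ln (A (B x)) - ln x) 0 < e"
    using eventually_gt_at_top[of 0]
  proof eventually_elim
    case (elim x)
    let ?S = "Sup (level_set x)"
    have S: "0 < ?S" "B x = 1 / ?S" using Sup_level_set B_eq elim by auto
    have "x0 * 1 \<le> x0 * exp \<eta>" using x0 eta by (intro mult_left_mono) auto
    then have Bx0: "x0 \<le> B x" "0 < B x" using elim x0 by linarith+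
    have "?S * exp (- \<eta>) < ?S * 1" using S eta by (intro mult_strict_left_mono) auto
    then have "?S * exp (- \<eta>) < ?S" by simp
    then obtain t where t: "t \<in> level_set x" "?S * exp (- \<eta>) < t"
      using less_cSup_iff[OF level_set_nonempty level_set_bdd] by blast
    have tS: "t \<le> ?S" using cSup_upper[OF t(1) level_set_bdd] .
    have t0: "0 < t" "x < A (1 / t)" using t(1) by (auto simp: level_set_def)
    have "B x \<le> 1 / t" using S tS t0 by (simp add: frac_le)
    moreover have "ln (?S * exp (- \<eta>)) \<le> ln t" using t t0 S by (subst ln_le_cancel_iff) auto
    then have "ln (1 / t) \<le> ln (B x) + \<eta>" using S t0 by (simp add: ln_mult ln_div)
    moreover have "ln (B x) \<le> ln (1 / t)" using calculation(1) Bx0 t0 by (subst ln_le_cancel_iff) auto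
    ultimately have "\<bar>ln (A (1 / t)) - ln (A (B x))\<bar> < e"
      using Bx0 by (intro close) auto
    moreover have "ln x < ln (A (1 / t))" using t0 elim by (subst ln_less_cancel_iff) auto
    ultimately have low: "ln x - ln (A (B x)) < e" by linarith
    let ?r = "B x * exp (- \<eta>)"
    have r: "x0 \<le> ?r"
    proof -
      have "x0 * exp \<eta> * exp (- \<eta>) \<le> ?r" using elim by (intro mult_right_mono) auto
      then show ?thesis by (simp add: mult.assoc exp_add[symmetric])
    qed
    have "1 / ?r = ?S * exp \<eta>" using S(1) by (simp add: S(2) exp_minus field_simps)
    moreover have "?S * 1 < ?S * exp \<eta>" using S eta by (intro mult_strict_left_mono) auto
    ultimately have "?S < 1 / ?r" by simp
    then have "1 / ?r \<notin> level_set x" using cSup_upper[OF _ level_set_bdd, of "1 / ?r" x] by linarith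
    then have "A ?r \<le> x" using r x0 by (auto simp: level_set_def not_less)
    moreover have "0 < A ?r" using r x0 by (intro A_pos) auto
    ultimately have "ln (A ?r) \<le> ln x" using elim by (subst ln_le_cancel_iff) auto
    moreover have "\<bar>ln (A (B x)) - ln (A ?r)\<bar> < e"
      using r Bx0 eta by (intro close) (auto simp: ln_mult)
    ultimately have "ln (A (B x)) - ln x < e" by linarith
    then show ?case using low by simp
  qed
qed

text \<open>Potter's bound for \<open>A\<close> at the points \<open>B s\<close> and
  \<open>B r\<close>, combined with \<open>A (B x)\<close> being asymptotic to \<open>x\<close>, is
  solved for \<open>d = ln (B s) - ln (B r)\<close>.\<close>

lemma B_regular: "log_regular \<alpha> B"
  unfolding log_regular_def
proof (intro allI impI)
  fix \<eta>' :: real assume eta': "0 < \<eta>'"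
  \<comment> \<open>The first bound makes \<open>2 * \<alpha> * \<eta> \<le> 1\<close>, so that the
    error term \<open>\<eta> * \<bar>d\<bar>\<close> can be absorbed on the left; the 9 collects the
    constants that arise afterwards.\<close>
  define \<eta> where "\<eta> = min (1 / (2 * \<alpha>)) (\<eta>' / 9)"
  have eta: "0 < \<eta>" "2 * \<alpha> * \<eta> \<le> 1" "9 * \<eta> \<le> \<eta>'"
    using eta' alpha_pos by (auto simp: \<eta>_def min_def field_simps)
  obtain x0 where x0: "1 \<le> x0" and P: "\<And>s r. x0 \<le> s \<Longrightarrow> x0 \<le> r \<Longrightarrow>
      \<bar>ln (A s) - ln (A r) - 1 / \<alpha> * (ln s - ln r)\<bar> \<le> \<eta> * (1 + \<bar>ln s - ln r\<bar>)"
    using log_regularE[OF A_regular eta(1)] by metis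
  have "\<forall>\<^sub>F x in at_top. \<bar>ln (A (B x)) - ln x\<bar> < \<eta> \<and> x0 \<le> B x"
    using tendstoD[OF ln_A_B eta(1)] eventually_ge_filterlim[OF B_at_top, where c=x0]
    by eventually_elim auto
  then obtain x1 where x1: "\<And>x. x1 \<le> x \<Longrightarrow> \<bar>ln (A (B x)) - ln x\<bar> < \<eta>" "\<And>x. x1 \<le> x \<Longrightarrow> x0 \<le> B x"
    by (auto simp: eventually_at_top_linorder)
  show "\<exists>x0\<ge>1. (\<forall>s\<ge>x0. 0 < B s) \<and>
     (\<forall>s\<ge>x0. \<forall>r\<ge>x0. \<bar>ln (B s) - ln (B r) - \<alpha> * (ln s - ln r)\<bar> \<le> \<eta>' * (1 + \<bar>ln s - ln r\<bar>))"
  proof (intro exI[of _ "max 1 x1"] conjI allI impI)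
    show "0 < B s" if "max 1 x1 \<le> s" for s
      using x1(2)[of s] that x0 by auto
    fix s r assume s: "max 1 x1 \<le> s" "max 1 x1 \<le> r"
    define d where "d = ln (B s) - ln (B r)"
    define L where "L = ln s - ln r"
    have 1: "\<bar>L - 1 / \<alpha> * d\<bar> \<le> 3 * \<eta> + \<eta> * \<bar>d\<bar>"
      using P[of "B s" "B r"] x1[of s] x1[of r] s
      by (auto simp: d_def L_def algebra_simps)
    have "\<alpha> * L - d = \<alpha> * (L - 1 / \<alpha> * d)" using alpha_pos by (simp add: algebra_simps)
    then have "\<alpha> * \<bar>L - 1 / \<alpha> * d\<bar> = \<bar>\<alpha> * L - d\<bar>"
      using alpha_pos by (simp only: abs_mult abs_of_pos)
    then have 2: "\<bar>\<alpha> * L - d\<bar> \<le> \<alpha> * (3 * \<eta> + \<eta> * \<bar>d\<bar>)"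
      using mult_left_mono[OF 1, of \<alpha>] alpha_pos by simp
    have "2 * \<alpha> * \<eta> * \<bar>d\<bar> \<le> 1 * \<bar>d\<bar>" using eta by (intro mult_right_mono) auto
    then have "\<bar>d\<bar> \<le> 2 * (\<bar>\<alpha> * L\<bar> + 3 * \<alpha> * \<eta>)"
      using 2 by (simp add: algebra_simps)
    also have "\<bar>\<alpha> * L\<bar> \<le> \<bar>L\<bar>" using alpha alpha_pos by (simp add: abs_mult mult_left_le_one_le)
    finally have d: "\<bar>d\<bar> \<le> 2 * \<bar>L\<bar> + 3" using eta by (simp add: algebra_simps)
    have "\<bar>\<alpha> * L - d\<bar> \<le> 1 * (3 * \<eta> + \<eta> * (2 * \<bar>L\<bar> + 3))"
      using alpha eta d by (intro order.trans[OF 2] mult_mono add_mono mult_left_mono order.refl) auto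
    also have "\<dots> \<le> 9 * \<eta> * (1 + \<bar>L\<bar>)" using eta by (simp add: algebra_simps)
    also have "\<dots> \<le> \<eta>' * (1 + \<bar>L\<bar>)" using eta by (intro mult_right_mono) auto
    finally show "\<bar>ln (B s) - ln (B r) - \<alpha> * (ln s - ln r)\<bar> \<le> \<eta>' * (1 + \<bar>ln s - ln r\<bar>)"
      by (simp add: d_def L_def abs_minus_commute)
  qed auto
qed

text \<open>\<open>A (B (A r))\<close> is asymptotic to \<open>A r\<close>, and Potter's bound for
  \<open>A\<close> turns closeness of the values into closeness of the arguments
  \<open>B (A r)\<close> and \<open>r\<close>, with the same absorption as in
  \<open>B_regular\<close>.\<close>

lemma B_A: "((\<lambda>r. B (A r) / r) \<longlongrightarrow> 1) at_top"
proof -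
  have "((\<lambda>r. ln (B (A r)) - ln r) \<longlongrightarrow> 0) at_top"
  proof (rule tendstoI)
    fix e :: real assume e: "0 < e"
    define \<eta> where "\<eta> = min (1 / (2 * \<alpha>)) (e / 5)"
    have eta: "0 < \<eta>" "2 * \<alpha> * \<eta> \<le> 1" "4 * \<eta> < e"
      using e alpha_pos by (auto simp: \<eta>_def min_def field_simps)
    obtain x0 where x0: "1 \<le> x0" and P: "\<And>s r. x0 \<le> s \<Longrightarrow> x0 \<le> r \<Longrightarrow>
        \<bar>ln (A s) - ln (A r) - 1 / \<alpha> * (ln s - ln r)\<bar> \<le> \<eta> * (1 + \<bar>ln s - ln r\<bar>)"
      using log_regularE[OF A_regular eta(1)] by metis
    have "((\<lambda>r. ln (A (B (A r))) - ln (A r)) \<longlongrightarrow> 0) at_top"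
      by (rule filterlim_compose[OF ln_A_B A_at_top])
    from tendstoD[OF this eta(1)] eventually_ge_filterlim[OF filterlim_compose[OF B_at_top A_at_top], where c=x0]
      eventually_ge_at_top[of x0]
    show "\<forall>\<^sub>F r in at_top. dist (ln (B (A r)) - ln r) 0 < e"
    proof eventually_elim
      case (elim r)
      define d where "d = ln (B (A r)) - ln r"
      have 1: "\<bar>1 / \<alpha> * d\<bar> \<le> 2 * \<eta> + \<eta> * \<bar>d\<bar>"
        using P[of "B (A r)" r] elim by (auto simp: d_def algebra_simps)
      have "\<alpha> * \<bar>1 / \<alpha> * d\<bar> = \<bar>d\<bar>" using alpha_pos by (simp add: abs_mult)
      then have 2: "\<bar>d\<bar> \<le> \<alpha> * (2 * \<eta> + \<eta> * \<bar>d\<bar>)"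
        using mult_left_mono[OF 1, of \<alpha>] alpha_pos by simp
      have "2 * \<alpha> * \<eta> * \<bar>d\<bar> \<le> 1 * \<bar>d\<bar>" using eta by (intro mult_right_mono) auto
      then have "\<bar>d\<bar> \<le> 4 * (\<alpha> * \<eta>)" using 2 by (simp add: algebra_simps)
      also have "\<dots> \<le> 4 * (1 * \<eta>)" using alpha eta by (intro mult_left_mono mult_right_mono) auto
      also have "\<dots> < e" using eta by simp
      finally show ?case by (simp add: d_def)
    qed
  qed
  then have "((\<lambda>r. exp (ln (B (A r)) - ln r)) \<longlongrightarrow> exp 0) at_top" by (rule tendsto_exp)
  moreover have "\<forall>\<^sub>F r in at_top. exp (ln (B (A r)) - ln r) = B (A r) / r"
    using eventually_gt_filterlim[OF filterlim_compose[OF B_at_top A_at_top], where c=0]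
      eventually_gt_at_top[of 0]
    by eventually_elim (simp add: exp_diff)
  ultimately show ?thesis by (simp add: tendsto_cong)
qed

end

section \<open>Tail estimates\<close>

context semistable_tail
begin

text \<open>The tail of the Levy measure with parameter 1, and the limit of the tails of the step on
  the scale \<open>A (k j)\<close>.\<close>

definition \<Theta> :: "real \<Rightarrow> real" where "\<Theta> z = M z * z powr (- \<alpha>)"

lemma \<Theta>_pos: "0 < z \<Longrightarrow> 0 < \<Theta> z"
  using M_pos by (simp add: \<Theta>_def)

lemma isCont_\<Theta>: "0 < z \<Longrightarrow> isCont M z \<Longrightarrow> isCont \<Theta> z"
  unfolding \<Theta>_def by (intro continuous_intros) auto

lemma Ak_shift_nat: "(\<lambda>j. A (real (k (j + p))) / A (real (k j))) \<longlonglongrightarrow> c powr (real p / \<alpha>)"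
proof (induction p)
  case 0
  have "\<forall>\<^sub>F j in sequentially. A (real (k (j + 0))) / A (real (k j)) = 1"
    using eventually_ge_at_top[of 1] by eventually_elim (use A_k_pos less_irrefl in force)
  then have "(\<lambda>j. A (real (k (j + 0))) / A (real (k j))) \<longlonglongrightarrow> 1"
    by (rule tendsto_eventually)
  then show ?case using c by simp
next
  case (Suc p)
  have "(\<lambda>j. A (real (k (Suc (j + p)))) / A (real (k (j + p)))) \<longlonglongrightarrow> c powr (1 / \<alpha>)"
    using LIMSEQ_ignore_initial_segment[OF Ak_Suc_ratio, of p] by simp
  from tendsto_mult[OF this Suc]
  have "(\<lambda>j. A (real (k (Suc (j + p)))) / A (real (k (j + p))) * (A (real (k (j + p))) / A (real (k j))))
      \<longlonglongrightarrow> c powr (real (Suc p) / \<alpha>)"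
    by (simp add: powr_add[symmetric] add_divide_distrib)
  moreover have "\<forall>\<^sub>F j in sequentially. A (real (k (Suc (j + p)))) / A (real (k (j + p))) *
      (A (real (k (j + p))) / A (real (k j))) = A (real (k (j + Suc p))) / A (real (k j))"
    using eventually_ge_at_top[of 1]
  proof eventually_elim
    case (elim j)
    then show ?case using A_k_pos[of "j + p"] by simp
  qed
  ultimately show ?case by (rule Lim_transform_eventually)
qed

lemma Ak_shift: "(\<lambda>j. A (real (k (nat (int j + i)))) / A (real (k j))) \<longlonglongrightarrow> c powr (of_int i / \<alpha>)"
proof (cases "0 \<le> i")
  case True
  then have "nat (int j + i) = j + nat i" for j by auto
  then show ?thesis using Ak_shift_nat[of "nat i"] True by simp
next
  case False
  define p where "p = nat (- i)"
  have i: "i = - int p" using False by (simp add: p_def)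
  show ?thesis
  proof (rule LIMSEQ_offset[where k=p])
    have "(\<lambda>j. inverse (A (real (k (j + p))) / A (real (k j)))) \<longlonglongrightarrow> inverse (c powr (real p / \<alpha>))"
      using c by (intro tendsto_inverse Ak_shift_nat) auto
    then show "(\<lambda>j. A (real (k (nat (int (j + p) + i)))) / A (real (k (j + p)))) \<longlonglongrightarrow> c powr (of_int i / \<alpha>)"
      by (simp add: i powr_minus)
  qed
qed

lemma M_periodic_nat: "0 < x \<Longrightarrow> M (c powr (real p / \<alpha>) * x) = M x"
proof (induction p)
  case 0
  then show ?case using c by simp
next
  case (Suc p)
  have eq: "c powr (real (Suc p) / \<alpha>) * x = c powr (1 / \<alpha>) * (c powr (real p / \<alpha>) * x)"
    by (simp add: powr_add[symmetric] add_divide_distrib)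
  have "M (c powr (real (Suc p) / \<alpha>) * x) = M (c powr (real p / \<alpha>) * x)"
    unfolding eq using c Suc.prems by (intro M_periodic) auto
  then show ?case using Suc by simp
qed

lemma M_periodic_int: assumes x: "0 < x" shows "M (c powr (of_int i / \<alpha>) * x) = M x"
proof (cases "0 \<le> i")
  case True
  then show ?thesis using M_periodic_nat[OF x, of "nat i"] by simp
next
  case False
  define p where "p = nat (- i)"
  have i: "i = - int p" using False by (simp add: p_def)
  have eq: "c powr (real p / \<alpha>) * (c powr (of_int i / \<alpha>) * x) = x"
    using c by (simp add: i powr_minus)
  have "M (c powr (real p / \<alpha>) * (c powr (of_int i / \<alpha>) * x)) = M (c powr (of_int i / \<alpha>) * x)"
    using x c by (intro M_periodic_nat) auto
  then show ?thesis unfolding eq by (rule sym)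
qed

text \<open>The index behind \<open>delta\<close> at \<open>A (k j) * z\<close> differs from
  \<open>j\<close> by a fixed amount that is known only up to one unit: if \<open>z\<close> is
  itself a power of \<open>c powr (1 / \<alpha>)\<close>, the point can fall on either side of a
  grid value. Periodicity of \<open>M\<close> gives both candidates the same limit
  \<open>M z\<close>.\<close>

lemma M_delta_limit:
  assumes z: "0 < z" "isCont M z"
  shows "(\<lambda>j. M (delta \<alpha> l1 k (A (real (k j)) * z))) \<longlonglongrightarrow> M z"
proof -
  \<comment> \<open>Thus \<open>c powr (i / \<alpha>) \<le> z < c powr ((i + 1) / \<alpha>)\<close>.
    The left inequality may be an equality, so it is weakened to a strict one with
    \<open>i - 1\<close>; strictness is what survives the approximation of the powers by ratios of
    \<open>A\<close>.\<close>
  define i where "i = \<lfloor>\<alpha> * ln z / ln c\<rfloor>"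
  have lnc: "0 < ln c" using c by simp
  have "of_int i \<le> \<alpha> * ln z / ln c" "\<alpha> * ln z / ln c < of_int i + 1"
    unfolding i_def by linarith+
  then have "of_int i * ln c \<le> \<alpha> * ln z" "\<alpha> * ln z < (of_int i + 1) * ln c"
    using lnc by (simp_all add: field_simps)
  then have "of_int i / \<alpha> * ln c \<le> ln z" "ln z < of_int (i + 1) / \<alpha> * ln c"
    using alpha_pos by (simp_all add: field_simps)
  moreover have "of_int (i - 1) / \<alpha> * ln c < of_int i / \<alpha> * ln c"
    using alpha_pos lnc by (simp add: field_simps)
  ultimately have "of_int (i - 1) / \<alpha> * ln c < ln z" "ln z < of_int (i + 1) / \<alpha> * ln c" by linarith+
  then have "exp (of_int (i - 1) / \<alpha> * ln c) < exp (ln z)" "exp (ln z) < exp (of_int (i + 1) / \<alpha> * ln c)"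
    by (simp_all only: exp_less_cancel_iff)
  then have zc: "c powr (of_int (i - 1) / \<alpha>) < z" "z < c powr (of_int (i + 1) / \<alpha>)"
    using z c by (simp_all add: powr_def)
  \<comment> \<open>\<open>w m j\<close> is the value that \<open>delta\<close> takes if its index
    is \<open>j + m\<close>; only \<open>m = i\<close> and \<open>m = i - 1\<close> occur.\<close>
  define w where "w m j = A (real (k j)) * z / A (real (k (nat (int j + m))))" for m j
  have w: "(\<lambda>j. M (w m j)) \<longlonglongrightarrow> M z" for m
  proof -
    have ev: "\<forall>\<^sub>F j in sequentially. 0 < w m j"
      using eventually_ge_at_top[of "nat (\<bar>m\<bar> + 1)"]
      by eventually_elim (use z in \<open>auto simp: w_def intro!: divide_pos_pos mult_pos_pos A_k_pos\<close>)
    have "(\<lambda>j. c powr (of_int m / \<alpha>) * (z * inverse (A (real (k (nat (int j + m)))) / A (real (k j)))))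
        \<longlonglongrightarrow> c powr (of_int m / \<alpha>) * (z * inverse (c powr (of_int m / \<alpha>)))"
      using c by (intro tendsto_intros Ak_shift) auto
    then have "(\<lambda>j. c powr (of_int m / \<alpha>) * w m j) \<longlonglongrightarrow> z"
      using c by (simp add: w_def mult_ac)
    then have "(\<lambda>j. M (c powr (of_int m / \<alpha>) * w m j)) \<longlonglongrightarrow> M z"
      by (rule isCont_tendsto_compose[OF z(2)])
    then show ?thesis
      by (rule Lim_transform_eventually) (use ev in eventually_elim, rule M_periodic_int)
  qed
  have "(\<lambda>j. \<bar>M (w i j) - M z\<bar> + \<bar>M (w (i - 1) j) - M z\<bar>) \<longlonglongrightarrow> \<bar>M z - M z\<bar> + \<bar>M z - M z\<bar>"
    by (intro tendsto_intros w)
  then have lim: "(\<lambda>j. \<bar>M (w i j) - M z\<bar> + \<bar>M (w (i - 1) j) - M z\<bar>) \<longlonglongrightarrow> 0" by simp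
  have "\<forall>\<^sub>F j in sequentially. norm (M (delta \<alpha> l1 k (A (real (k j)) * z)) - M z)
      \<le> \<bar>M (w i j) - M z\<bar> + \<bar>M (w (i - 1) j) - M z\<bar>"
    using order_tendstoD(1)[OF Ak_shift zc(2)] order_tendstoD(2)[OF Ak_shift zc(1)]
      eventually_ge_at_top[of "nat (\<bar>i\<bar> + 2)"]
      eventually_compose_filterlim[OF index_exists[of 1] A_k_mult_top[OF z(1)]]
  proof eventually_elim
    case (elim j)
    define p where "p = nat (int j + (i - 1))"
    have p: "1 \<le> p" "nat (int j + i) = p + 1" "nat (int j + (i + 1)) = p + 2"
      using elim(3) by (auto simp: p_def)
    have Aj: "0 < A (real (k j))" using elim(3) by (intro A_k_pos) auto
    let ?x = "A (real (k j)) * z"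
    have x: "?x < A (real (k (p + 2)))" "A (real (k p)) < ?x"
      using elim(1,2) Aj unfolding p(3) p_def[symmetric] by (simp_all add: field_simps)
    have "index_of ?x (p + 1) \<or> index_of ?x p"
      using x p by (auto simp: index_of_def not_le)
    then have "delta \<alpha> l1 k ?x = w i j \<or> delta \<alpha> l1 k ?x = w (i - 1) j"
      using delta_eq[of ?x "p + 1"] delta_eq[of ?x p] elim(4) p by (auto simp: w_def p_def)
    then show ?case by auto
  qed
  then have "(\<lambda>j. M (delta \<alpha> l1 k (A (real (k j)) * z)) - M z) \<longlonglongrightarrow> 0"
    by (rule Lim_null_comparison[OF _ lim])
  then show ?thesis by (rule LIM_zero_cancel)
qed

lemma B_Ak: "(\<lambda>j. B (A (real (k j))) / real (k j)) \<longlonglongrightarrow> 1"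
  by (rule filterlim_compose[OF B_A k_top])

text \<open>Regular variation makes \<open>B (A (k j) * z)\<close> asymptotic to
  \<open>k j * z powr \<alpha>\<close>; the bracket in the tail formula tends to
  \<open>M z + 0\<close>.\<close>

lemma tail_limit_fixed:
  assumes z: "0 < z" "isCont M z"
  shows "(\<lambda>j. real (k j) * (1 - F (A (real (k j)) * z))) \<longlonglongrightarrow> \<Theta> z"
proof -
  have Aev: "\<forall>\<^sub>F j in sequentially. 0 < A (real (k j))"
    using eventually_ge_at_top[of 1] by eventually_elim (rule A_k_pos)
  have "(\<lambda>j. A (real (k j)) * z / A (real (k j))) \<longlonglongrightarrow> z"
    by (rule tendsto_eventually) (use Aev in eventually_elim, simp)
  from log_regular_ratio[OF B_regular Ak_top this z(1)]
  have "(\<lambda>j. inverse (B (A (real (k j)) * z) / B (A (real (k j))) * (B (A (real (k j))) / real (k j)))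
      * (M (delta \<alpha> l1 k (A (real (k j)) * z)) + h (A (real (k j)) * z)))
    \<longlonglongrightarrow> inverse (z powr \<alpha> * 1) * (M z + 0)"
    using z by (intro tendsto_intros B_Ak M_delta_limit h_lim) auto
  then have "(\<lambda>j. inverse (B (A (real (k j)) * z) / B (A (real (k j))) * (B (A (real (k j))) / real (k j)))
      * (M (delta \<alpha> l1 k (A (real (k j)) * z)) + h (A (real (k j)) * z))) \<longlonglongrightarrow> \<Theta> z"
    by (simp add: \<Theta>_def powr_minus mult.commute)
  then show ?thesis
  proof (rule Lim_transform_eventually)
    show "\<forall>\<^sub>F j in sequentially. inverse (B (A (real (k j)) * z) / B (A (real (k j))) * (B (A (real (k j))) / real (k j)))
      * (M (delta \<alpha> l1 k (A (real (k j)) * z)) + h (A (real (k j)) * z)) = real (k j) * (1 - F (A (real (k j)) * z))"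
      using eventually_compose_filterlim[OF tail_eq A_k_mult_top[OF z(1)]]
        eventually_gt_filterlim[OF filterlim_compose[OF B_at_top Ak_top], where c=0]
    proof eventually_elim
      case (elim j)
      show ?case unfolding elim(1) using elim(2) by (simp add: field_simps)
    qed
  qed
qed

text \<open>The fixed multiple \<open>z\<close> is replaced by any convergent
  \<open>x i / A (k (j i))\<close>. Monotonicity of \<open>F\<close> compares \<open>x i\<close>
  with \<open>A (k (j i)) * w\<close> for a continuity point \<open>w\<close> slightly beyond or
  slightly before \<open>z\<close>, where \<Theta> is still close to
  \<open>\<Theta> z\<close>.\<close>

lemma tail_limit:
  assumes z: "0 < z" "isCont M z" and j: "filterlim j at_top sequentially"
    and x: "(\<lambda>i. x i / A (real (k (j i)))) \<longlonglongrightarrow> z"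
  shows "(\<lambda>i. real (k (j i)) * (1 - F (x i))) \<longlonglongrightarrow> \<Theta> z"
proof (rule order_tendstoI)
  have Aev: "\<forall>\<^sub>F i in sequentially. 0 < A (real (k (j i)))"
    using eventually_ge_filterlim[OF j, where c=1] by eventually_elim (rule A_k_pos)
  note cont = isCont_\<Theta>[OF z, unfolded continuous_at]
  fix a
  {
    assume "a < \<Theta> z"
    then have "\<forall>\<^sub>F w in at z. a < \<Theta> w" using order_tendstoD(1)[OF cont] by blast
    then obtain d where d: "0 < d" "\<And>w. w \<noteq> z \<Longrightarrow> dist w z < d \<Longrightarrow> a < \<Theta> w"
      unfolding eventually_at by auto
    obtain w where w: "z < w" "w < z + d" "isCont M w" using ex_cont_point[of z "z + d"] z d by auto
    have "a < \<Theta> w" using w by (intro d(2)) (auto simp: dist_real_def)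
    from order_tendstoD(1)[OF filterlim_compose[OF tail_limit_fixed[OF _ w(3)] j] this]
    have "\<forall>\<^sub>F i in sequentially. a < real (k (j i)) * (1 - F (A (real (k (j i))) * w))"
      using z w by simp
    with order_tendstoD(2)[OF x w(1)] Aev
    show "\<forall>\<^sub>F i in sequentially. a < real (k (j i)) * (1 - F (x i))"
    proof eventually_elim
      case (elim i)
      have "x i \<le> A (real (k (j i))) * w" using elim by (simp add: field_simps)
      then have "real (k (j i)) * (1 - F (A (real (k (j i))) * w)) \<le> real (k (j i)) * (1 - F (x i))"
        by (intro mult_left_mono diff_left_mono monoD[OF F_mono]) auto
      then show ?case using elim by linarith
    qed
  next
    assume "\<Theta> z < a"
    then have "\<forall>\<^sub>F w in at z. \<Theta> w < a" using order_tendstoD(2)[OF cont] by blast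
    then obtain d where d: "0 < d" "\<And>w. w \<noteq> z \<Longrightarrow> dist w z < d \<Longrightarrow> \<Theta> w < a"
      unfolding eventually_at by auto
    obtain w where w: "max 0 (z - d) < w" "w < z" "isCont M w" using ex_cont_point[of "max 0 (z - d)" z] z d by auto
    have "\<Theta> w < a" using w by (intro d(2)) (auto simp: dist_real_def)
    from order_tendstoD(2)[OF filterlim_compose[OF tail_limit_fixed[OF _ w(3)] j] this]
    have "\<forall>\<^sub>F i in sequentially. real (k (j i)) * (1 - F (A (real (k (j i))) * w)) < a"
      using z w by simp
    with order_tendstoD(1)[OF x w(2)] Aev
    show "\<forall>\<^sub>F i in sequentially. real (k (j i)) * (1 - F (x i)) < a"
    proof eventually_elim
      case (elim i)
      have "A (real (k (j i))) * w \<le> x i" using elim by (simp add: field_simps)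
      then have "real (k (j i)) * (1 - F (x i)) \<le> real (k (j i)) * (1 - F (A (real (k (j i))) * w))"
        by (intro mult_left_mono diff_left_mono monoD[OF F_mono]) auto
      then show ?case using elim by linarith
    qed
  }
qed

text \<open>At general \<open>x\<close> the tail need not have a limit on the scale
  \<open>1 / B x\<close>, but its order survives. Such an \<open>x\<close> lies between two
  consecutive points \<open>A (k j) * z\<close> with \<open>z\<close> a continuity point; the tail
  is monotone between them and \<open>B\<close> varies by a bounded factor.\<close>

lemma tail_order:
  "\<exists>C\<ge>1. \<forall>\<^sub>F x in at_top. 1 / C \<le> (1 - F x) * B x \<and> (1 - F x) * B x \<le> C"
proof -
  obtain z where z: "0 < z" "isCont M z" using ex_cont_point[of 0 1] by auto
  define T where "T = \<Theta> z"
  have T: "0 < T" using \<Theta>_pos z by (simp add: T_def)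
  obtain x0 where x0: "1 \<le> x0" "\<And>s. x0 \<le> s \<Longrightarrow> 0 < B s" and P: "\<And>s r. x0 \<le> s \<Longrightarrow> x0 \<le> r \<Longrightarrow>
      \<bar>ln (B s) - ln (B r) - \<alpha> * (ln s - ln r)\<bar> \<le> 1 * (1 + \<bar>ln s - ln r\<bar>)"
    using log_regularE[OF B_regular zero_less_one] by metis
  \<comment> \<open>\<open>q\<close> eventually exceeds the ratio of consecutive
    \<open>A (k j)\<close>. Hence \<open>\<bar>ln z\<bar> + ln q\<close> bounds the logarithmic
    distance of \<open>x\<close> to \<open>A (k j)\<close>, and \<open>exp K\<close> the resulting
    variation of \<open>B\<close>.\<close>
  define q where "q = 2 * c powr (1 / \<alpha>)"
  have q: "1 < q" using c_powr_gt_1 by (simp add: q_def)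
  define K where "K = 1 + 2 * (\<bar>ln z\<bar> + ln q)"
  have K: "0 < K" using q by (simp add: K_def add_pos_nonneg)
  \<comment> \<open>The two nontrivial entries are the upper bound and the reciprocal of the lower
    bound obtained below.\<close>
  define D where "D = max 1 (max (4 * T * exp K) (8 * c * exp K / T))"
  have "\<forall>\<^sub>F j in sequentially. T / 2 < real (k j) * (1 - F (A (real (k j)) * z)) \<and>
      real (k j) * (1 - F (A (real (k j)) * z)) < 2 * T \<and>
      A (real (k (Suc j))) / A (real (k j)) < q \<and> B (A (real (k j))) / real (k j) < 2 \<and>
      1 / 2 < B (A (real (k j))) / real (k j) \<and> real (k (j + 1)) / real (k j) < 2 * c \<and>
      x0 \<le> A (real (k j)) \<and> 1 \<le> j \<and>
      T / 2 < real (k (Suc j)) * (1 - F (A (real (k (Suc j))) * z))"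
    using order_tendstoD(1)[OF tail_limit_fixed[OF z], of "T / 2"] order_tendstoD(2)[OF tail_limit_fixed[OF z], of "2 * T"]
      order_tendstoD(2)[OF Ak_Suc_ratio, of q] order_tendstoD(2)[OF B_Ak, of 2] order_tendstoD(1)[OF B_Ak, of "1 / 2"]
      order_tendstoD(2)[OF k(3), of "2 * c"] eventually_ge_filterlim[OF Ak_top, where c=x0]
      eventually_ge_at_top[of 1] order_tendstoD(1)[OF LIMSEQ_Suc[OF tail_limit_fixed[OF z]], of "T / 2"]
    using T c c_powr_gt_1 unfolding q_def T_def by (auto simp: eventually_conj_iff)
  then obtain J where J: "\<And>j. J \<le> j \<Longrightarrow> T / 2 < real (k j) * (1 - F (A (real (k j)) * z)) \<and>
      real (k j) * (1 - F (A (real (k j)) * z)) < 2 * T \<and>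
      A (real (k (Suc j))) / A (real (k j)) < q \<and> B (A (real (k j))) / real (k j) < 2 \<and>
      1 / 2 < B (A (real (k j))) / real (k j) \<and> real (k (j + 1)) / real (k j) < 2 * c \<and>
      x0 \<le> A (real (k j)) \<and> 1 \<le> j \<and>
      T / 2 < real (k (Suc j)) * (1 - F (A (real (k (Suc j))) * z))"
    unfolding eventually_sequentially by blast
  have "filterlim (\<lambda>x. x * (1 / z)) at_top at_top"
    using z by (intro filterlim_at_top_mult_tendsto_pos[OF tendsto_const _ filterlim_ident]) auto
  from eventually_compose_filterlim[OF index_exists[of J] this]
  have "\<forall>\<^sub>F x in at_top. 1 / D \<le> (1 - F x) * B x \<and> (1 - F x) * B x \<le> D"
    using eventually_ge_at_top[of x0]
  proof eventually_elim
    case (elim x)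
    then obtain j where j: "index_of (x * (1 / z)) j" "J \<le> j" by blast
    note J = J[OF j(2)]
    let ?a = "A (real (k j))"
    have kj: "0 < real (k j)" "0 < real (k (Suc j))" using k_ge_1[of j] k_ge_1[of "Suc j"] J by auto
    have a: "0 < ?a" "x0 \<le> ?a" using J x0 by auto
    have x: "?a * z \<le> x" "x < A (real (k (Suc j))) * z"
      using j z by (auto simp: index_of_def field_simps)
    have "A (real (k (Suc j))) < q * ?a" using J a by (simp add: field_simps)
    then have "A (real (k (Suc j))) * z < q * ?a * z" using z by (intro mult_strict_right_mono)
    then have xq: "x < q * ?a * z" using x by linarith
    have xpos: "0 < x" using x0 elim by linarith
    have "ln (?a * z) \<le> ln x" using x a z xpos by (subst ln_le_cancel_iff) auto
    moreover have "ln x \<le> ln (q * ?a * z)" using xq a z q xpos by (subst ln_le_cancel_iff) auto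
    ultimately have "\<bar>ln x - ln ?a\<bar> \<le> \<bar>ln z\<bar> + ln q"
      using a z q ln_gt_zero[OF q] unfolding abs_le_iff by (simp add: ln_mult) linarith
    moreover have "\<bar>\<alpha> * (ln x - ln ?a)\<bar> \<le> 1 * \<bar>ln x - ln ?a\<bar>"
      unfolding abs_mult using alpha by (intro mult_right_mono) auto
    moreover have "\<bar>d\<bar> \<le> 1 + 2 * w" if "\<bar>u\<bar> \<le> w" "\<bar>v\<bar> \<le> 1 * \<bar>u\<bar>" "\<bar>d - v\<bar> \<le> 1 * (1 + \<bar>u\<bar>)" for d u v w :: real
      using that abs_triangle_ineq[of "d - v" v] by simp
    ultimately have lnB: "\<bar>ln (B x) - ln (B ?a)\<bar> \<le> K"
      using P[OF elim(2) a(2)] unfolding K_def by blast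
    have Bpos: "0 < B x" "0 < B ?a" using x0 elim a by auto
    have "exp (ln (B x)) \<le> exp (ln (B ?a) + K)" "exp (ln (B ?a)) \<le> exp (ln (B x) + K)"
      using lnB by (auto simp: abs_le_iff)
    then have B1: "B x \<le> B ?a * exp K" "B ?a \<le> B x * exp K" using Bpos by (auto simp: exp_add)
    have Ba: "B ?a \<le> 2 * real (k j)" "real (k j) \<le> 2 * B ?a" using J kj by (auto simp: field_simps)
    have F0: "0 \<le> 1 - F x" using F_le_1 by simp
    have "1 - F x \<le> 1 - F (?a * z)" using monoD[OF F_mono x(1)] by simp
    then have "real (k j) * (1 - F x) \<le> real (k j) * (1 - F (?a * z))" by (intro mult_left_mono) auto
    then have up: "real (k j) * (1 - F x) \<le> 2 * T" using J by linarith
    have "(1 - F x) * B x \<le> (1 - F x) * (2 * real (k j) * exp K)"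
      using F0 Ba B1 by (intro mult_left_mono order.trans[OF B1(1)] mult_right_mono) auto
    also have "\<dots> = (real (k j) * (1 - F x)) * (2 * exp K)" by simp
    also have "\<dots> \<le> (2 * T) * (2 * exp K)" using up by (intro mult_right_mono) auto
    also have "\<dots> \<le> D" by (simp add: D_def)
    finally have 1: "(1 - F x) * B x \<le> D" .
    have "1 - F (A (real (k (Suc j))) * z) \<le> 1 - F x" using monoD[OF F_mono less_imp_le[OF x(2)]] by simp
    then have "real (k (Suc j)) * (1 - F (A (real (k (Suc j))) * z)) \<le> real (k (Suc j)) * (1 - F x)"
      by (intro mult_left_mono) auto
    then have lo: "T / 2 \<le> real (k (Suc j)) * (1 - F x)" using J by linarith
    have "real (k (Suc j)) \<le> 2 * c * real (k j)" using J kj by (simp add: field_simps)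
    also have "\<dots> \<le> 2 * c * (2 * B ?a)" using Ba c by (intro mult_left_mono) auto
    also have "\<dots> \<le> 2 * c * (2 * (B x * exp K))" using B1 c by (intro mult_left_mono) auto
    finally have "real (k (Suc j)) * (1 - F x) \<le> 2 * c * (2 * (B x * exp K)) * (1 - F x)"
      using F0 by (rule mult_right_mono)
    with lo have "T / 2 \<le> (4 * c * exp K) * ((1 - F x) * B x)" by (simp add: mult_ac)
    then have "T / (8 * c * exp K) \<le> (1 - F x) * B x" using c by (simp add: field_simps)
    moreover have "1 / D \<le> 1 / (8 * c * exp K / T)"
      using T c by (intro divide_left_mono) (auto simp: D_def intro!: mult_pos_pos)
    ultimately have "1 / D \<le> (1 - F x) * B x" by simp
    then show ?case using 1 by simp
  qed
  moreover have "1 \<le> D" by (simp add: D_def)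
  ultimately show ?thesis by blast
qed

section \<open>Power bounds for \<open>B\<close> and for the tail, uniform in the scale\<close>

text \<open>Exponents \<open>1/2 < b1 < \<alpha> < b2 < 1\<close> that absorb the slowly varying factors.\<close>

definition b1 :: real where "b1 = (2 * \<alpha> + 1) / 4"
definition b2 :: real where "b2 = (\<alpha> + 1) / 2"

lemma b12: "1 / 2 < b1" "b1 < \<alpha>" "\<alpha> < b2" "b2 < 1" "0 < b1" "b1 < b2" "0 < b2" "b1 < 1"
  using alpha by (simp_all add: b1_def b2_def)

text \<open>Potter's bound with \<eta> at most the smaller gap between \<alpha> and
  \<open>b1\<close>, \<open>b2\<close>, exponentiated; \<open>exp \<eta>\<close> becomes the
  constant.\<close>

lemma B_potter:
  "\<exists>C\<ge>1. \<exists>x0\<ge>1. (\<forall>x\<ge>x0. 0 < B x) \<and>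
     (\<forall>r\<ge>x0. \<forall>s\<ge>r. (s / r) powr b1 * B r \<le> C * B s \<and> B s \<le> C * (s / r) powr b2 * B r)"
proof -
  define \<eta> where "\<eta> = min (\<alpha> - b1) (b2 - \<alpha>)"
  have eta: "0 < \<eta>" "b1 \<le> \<alpha> - \<eta>" "\<alpha> + \<eta> \<le> b2" using b12 by (auto simp: \<eta>_def)
  obtain x0 where x0: "1 \<le> x0" "\<And>s. x0 \<le> s \<Longrightarrow> 0 < B s" and P: "\<And>s r. x0 \<le> s \<Longrightarrow> x0 \<le> r \<Longrightarrow>
      \<bar>ln (B s) - ln (B r) - \<alpha> * (ln s - ln r)\<bar> \<le> \<eta> * (1 + \<bar>ln s - ln r\<bar>)"
    using log_regularE[OF B_regular eta(1)] by metis
  have "(s / r) powr b1 * B r \<le> exp \<eta> * B s \<and> B s \<le> exp \<eta> * (s / r) powr b2 * B r"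
    if r: "x0 \<le> r" and s: "r \<le> s" for r s
  proof -
    define d where "d = ln s - ln r"
    have d: "0 \<le> d" using r s x0 by (simp add: d_def)
    have e: "ln (s / r) = d" using r s x0 by (simp add: d_def ln_div)
    have Bp: "0 < B r" "0 < B s" using x0 r s by auto
    have p: "(s / r) powr b = exp (b * d)" for b using r s x0 by (simp add: powr_def e)
    have P': "\<bar>ln (B s) - ln (B r) - \<alpha> * d\<bar> \<le> \<eta> * (1 + d)"
      using P[of s r] r s d by (simp add: d_def)
    have "b1 * d \<le> (\<alpha> - \<eta>) * d" "(\<alpha> + \<eta>) * d \<le> b2 * d" using eta d by (auto intro: mult_right_mono)
    then have "b1 * d + ln (B r) \<le> \<eta> + ln (B s)" "ln (B s) \<le> \<eta> + b2 * d + ln (B r)"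
      using P' by (auto simp: abs_le_iff algebra_simps)
    then have "exp (b1 * d + ln (B r)) \<le> exp (\<eta> + ln (B s))" "exp (ln (B s)) \<le> exp (\<eta> + b2 * d + ln (B r))"
      by (simp_all only: exp_le_cancel_iff)
    then show ?thesis using Bp unfolding p by (simp_all add: exp_add)
  qed
  with x0 eta show ?thesis by (intro exI[of _ "exp \<eta>"] conjI exI[of _ x0]) auto
qed

text \<open>Valid for every \<open>r > 0\<close>, hence usable as a dominating function. Where
  \<open>L * r\<close> is large, \<open>tail_order\<close> and Potter's bound apply, with
  \<open>b2\<close> for \<open>r \<le> 1\<close> and \<open>b1\<close> beyond; where it is not,
  \<open>1 - F \<le> 1\<close> suffices.\<close>

lemma tail_upper:
  "\<exists>C>0. \<exists>L0\<ge>1. \<forall>L\<ge>L0. 0 < B L \<and> (\<forall>r>0. 1 - F (L * r) \<le> C / B L * (r powr (- b1) + r powr (- b2)))"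
proof -
  obtain C where C: "1 \<le> C" and ev: "\<forall>\<^sub>F x in at_top. 1 / C \<le> (1 - F x) * B x \<and> (1 - F x) * B x \<le> C"
    using tail_order by blast
  obtain D x0 where D: "1 \<le> D" and x0: "1 \<le> x0" "\<And>x. x0 \<le> x \<Longrightarrow> 0 < B x"
    and P: "\<And>r s. x0 \<le> r \<Longrightarrow> r \<le> s \<Longrightarrow> (s / r) powr b1 * B r \<le> D * B s"
      "\<And>r s. x0 \<le> r \<Longrightarrow> r \<le> s \<Longrightarrow> B s \<le> D * (s / r) powr b2 * B r"
    using B_potter by metis
  obtain x1 where x1: "\<And>x. x1 \<le> x \<Longrightarrow> (1 - F x) * B x \<le> C"
    using ev by (auto simp: eventually_at_top_linorder)
  define y where "y = max x0 x1"
  have y: "x0 \<le> y" "x1 \<le> y" "1 \<le> y" using x0 by (auto simp: y_def)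
  define E where "E = max (C * D) (D * B y)"
  have E: "0 < E" using C D by (auto simp: E_def less_max_iff_disj)
  have "0 < B L \<and> (\<forall>r>0. 1 - F (L * r) \<le> E / B L * (r powr (- b1) + r powr (- b2)))" if L: "y \<le> L" for L
  proof (intro conjI allI impI)
    show BL: "0 < B L" using L y x0 by auto
    fix r :: real assume r: "0 < r"
    have F1: "1 - F (L * r) \<le> 1" using F_nonneg by simp
    show "1 - F (L * r) \<le> E / B L * (r powr (- b1) + r powr (- b2))"
    proof (cases "y \<le> L * r")
      case True
      then have "0 < B (L * r)" using x0 y by auto
      have "(1 - F (L * r)) * B (L * r) \<le> C" using x1[of "L * r"] True y by simp
      then have 1: "1 - F (L * r) \<le> C / B (L * r)" using \<open>0 < B (L * r)\<close> by (simp add: field_simps)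
      have 2: "B L \<le> D * (r powr (- b1) + r powr (- b2)) * B (L * r)"
      proof (cases "r \<le> 1")
        case rl: True
        have "B L \<le> D * (L / (L * r)) powr b2 * B (L * r)"
          using True y rl L by (intro P) (auto simp: mult_left_le)
        also have "(L / (L * r)) powr b2 = r powr (- b2)" using L y r by (simp add: powr_minus powr_divide field_simps)
        also have "D * r powr (- b2) * B (L * r) \<le> D * (r powr (- b1) + r powr (- b2)) * B (L * r)"
          using D \<open>0 < B (L * r)\<close> by (intro mult_right_mono mult_left_mono) auto
        finally show ?thesis .
      next
        case False
        have "(L * r / L) powr b1 * B L \<le> D * B (L * r)"
          using y False L by (intro P) auto
        then have "r powr b1 * B L \<le> D * B (L * r)" using L y by simp
        then have "r powr (- b1) * (r powr b1 * B L) \<le> r powr (- b1) * (D * B (L * r))" by (intro mult_left_mono) auto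
        then have "B L \<le> D * r powr (- b1) * B (L * r)" using r by (simp add: powr_minus mult_ac)
        also have "\<dots> \<le> D * (r powr (- b1) + r powr (- b2)) * B (L * r)"
          using D \<open>0 < B (L * r)\<close> by (intro mult_right_mono mult_left_mono) auto
        finally show ?thesis .
      qed
      have "C / B (L * r) \<le> C * D / B L * (r powr (- b1) + r powr (- b2))"
        using mult_left_mono[OF 2, of C] C BL \<open>0 < B (L * r)\<close> by (simp add: field_simps)
      also have "\<dots> \<le> E / B L * (r powr (- b1) + r powr (- b2))"
        using BL by (intro mult_right_mono divide_right_mono) (auto simp: E_def)
      finally show ?thesis using 1 by linarith
    next
      case False
      \<comment> \<open>Here \<open>L / y < 1 / r\<close>, so the growth of \<open>B\<close> alone
        shows that the right-hand side of the claim is at least 1.\<close>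
      have "B L \<le> D * (L / y) powr b2 * B y" using L y by (intro P) auto
      also have "\<dots> \<le> D * r powr (- b2) * B y"
      proof -
        have "L / y \<le> 1 / r" using False r y by (simp add: field_simps)
        then have "(L / y) powr b2 \<le> (1 / r) powr b2" using L y b12 by (intro powr_mono2) auto
        also have "\<dots> = r powr (- b2)" using r by (simp add: powr_minus powr_divide field_simps)
        finally show ?thesis using D x0 y by (intro mult_right_mono mult_left_mono) (auto simp: less_imp_le)
      qed
      also have "\<dots> = (D * B y) * r powr (- b2)" by simp
      also have "\<dots> \<le> E * r powr (- b2)" by (intro mult_right_mono) (auto simp: E_def)
      also have "\<dots> \<le> E * (r powr (- b1) + r powr (- b2))" using E by (intro mult_left_mono) auto
      finally have "1 \<le> E / B L * (r powr (- b1) + r powr (- b2))" using BL by (simp add: field_simps)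
      then show ?thesis using F1 by linarith
    qed
  qed
  then show ?thesis using E y by blast
qed

text \<open>As \<open>r\<close> decreases, the tail at \<open>L * r\<close> exceeds any given
  multiple of \<open>1 / B L\<close>. This gap between two tails is what puts mass into a window of
  size \<open>L\<close> in \<open>Re_char_lower\<close>.\<close>

lemma tail_lower:
  "\<exists>C>0. \<exists>x0\<ge>1. \<forall>L\<ge>x0. 0 < B L \<and> (\<forall>r. x0 \<le> L * r \<longrightarrow> r \<le> 1 \<longrightarrow> r powr (- b1) \<le> C * B L * (1 - F (L * r)))"
proof -
  obtain C where C: "1 \<le> C" and ev: "\<forall>\<^sub>F x in at_top. 1 / C \<le> (1 - F x) * B x \<and> (1 - F x) * B x \<le> C"
    using tail_order by blast
  obtain D x0 where D: "1 \<le> D" and x0: "1 \<le> x0" "\<And>x. x0 \<le> x \<Longrightarrow> 0 < B x"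
    and P: "\<And>r s. x0 \<le> r \<Longrightarrow> r \<le> s \<Longrightarrow> (s / r) powr b1 * B r \<le> D * B s"
    using B_potter by metis
  obtain x1 where x1: "\<And>x. x1 \<le> x \<Longrightarrow> 1 / C \<le> (1 - F x) * B x"
    using ev by (auto simp: eventually_at_top_linorder)
  define y where "y = max x0 x1"
  have y: "x0 \<le> y" "x1 \<le> y" "1 \<le> y" using x0 by (auto simp: y_def)
  have "0 < B L \<and> (\<forall>r. y \<le> L * r \<longrightarrow> r \<le> 1 \<longrightarrow> r powr (- b1) \<le> C * D * B L * (1 - F (L * r)))" if L: "y \<le> L" for L
  proof (intro conjI allI impI)
    show BL: "0 < B L" using L y x0 by auto
    fix r :: real assume r: "y \<le> L * r" "r \<le> 1"
    have r0: "0 < r" using r(1) L y by (smt (verit) mult_nonneg_nonpos)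
    have BLr: "0 < B (L * r)" using r y x0 by auto
    have F0: "0 \<le> 1 - F (L * r)" using F_le_1 by simp
    have "(L / (L * r)) powr b1 * B (L * r) \<le> D * B L"
      using r y L by (intro P) (auto simp: mult_left_le)
    also have "(L / (L * r)) powr b1 = r powr (- b1)" using L y r0 by (simp add: powr_minus powr_divide field_simps)
    finally have "r powr (- b1) * B (L * r) * (1 - F (L * r)) \<le> D * B L * (1 - F (L * r))"
      using F0 by (rule mult_right_mono)
    moreover have "r powr (- b1) * (1 / C) \<le> r powr (- b1) * ((1 - F (L * r)) * B (L * r))"
      using x1[of "L * r"] r y by (intro mult_left_mono) auto
    ultimately have "r powr (- b1) * (1 / C) \<le> D * B L * (1 - F (L * r))" by (simp add: mult_ac)
    then show "r powr (- b1) \<le> C * D * B L * (1 - F (L * r))" using C by (simp add: field_simps)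
  qed
  moreover have "0 < C * D" using C D by auto
  ultimately show ?thesis using y by blast
qed

end

section \<open>Fourier analysis of laws on the line\<close>

lemma set_integrable_powr_0:
  assumes "b < 1" "0 \<le> R"
  shows "set_integrable lborel {0<..R} (\<lambda>v::real. v powr (- b))"
proof -
  have "(\<lambda>v. v powr (- b)) integrable_on {0<..R}"
    using integrable_on_powr_from_0'[of "- b" R] assms by simp
  then have "(\<lambda>v. v powr (- b)) absolutely_integrable_on {0<..R}"
    by (subst absolutely_integrable_on_iff_nonneg) auto
  then show ?thesis unfolding set_integrable_def
    by (subst (asm) integrable_completion) auto
qed

lemma set_integrable_powr_inf:
  assumes "1 < b" "0 < a"
  shows "set_integrable lborel {a..} (\<lambda>v::real. v powr (- b))"
proof -
  have "(\<lambda>v. v powr (- b)) integrable_on {a..}"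
    using has_integral_powr_to_inf[of "- b" a] assms by (auto simp: integrable_on_def)
  then have "(\<lambda>v. v powr (- b)) absolutely_integrable_on {a..}"
    by (subst absolutely_integrable_on_iff_nonneg) auto
  then show ?thesis unfolding set_integrable_def
    by (subst (asm) integrable_completion) auto
qed

text \<open>From \<open>exp x \<ge> x\<^sup>2 / 2\<close> the integrand is at most
  \<open>2 * s powr (- (2 * b))\<close> for \<open>s \<ge> 1\<close>, and
  \<open>2 * b > 1\<close>.\<close>

lemma integrable_exp_powr:
  assumes b: "1 / 2 < b"
  shows "integrable lborel (\<lambda>s::real. exp (- (\<bar>s\<bar> powr b)))"
proof (rule Bochner_Integration.integrable_bound)
  let ?f = "\<lambda>s::real. indicator {1..} s *\<^sub>R s powr (- (2 * b))"
  have f: "integrable lborel ?f"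
    using set_integrable_powr_inf[of "2 * b" 1] b by (simp add: set_integrable_def)
  have f': "integrable lborel (\<lambda>s. ?f (0 + (- 1) * s))"
    by (rule lborel_integrable_real_affine[OF f]) simp
  have i: "integrable lborel (\<lambda>s::real. indicator {-1..1} s :: real)"
    by (simp add: emeasure_lborel_Icc_eq)
  show "integrable lborel (\<lambda>s. indicator {-1..1} s + (2 * ?f s + 2 * ?f (0 + (- 1) * s)))"
    by (rule Bochner_Integration.integrable_add[OF i Bochner_Integration.integrable_add[OF
      integrable_mult_right[OF f] integrable_mult_right[OF f']]])
  have key: "exp (- (s powr b)) \<le> 2 * s powr (- (2 * b))" if "1 \<le> s" for s :: real
  proof -
    have p: "0 < s powr b" using that by simp
    have "(s powr b)\<^sup>2 / 2 \<le> exp (s powr b)"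
      using exp_lower_Taylor_quadratic[OF less_imp_le[OF p]] p by linarith
    then have "exp (- (s powr b)) \<le> 2 / (s powr b)\<^sup>2"
      using p by (simp add: exp_minus field_simps)
    also have "(s powr b)\<^sup>2 = s powr (2 * b)" using that by (simp add: power2_eq_square powr_add[symmetric])
    finally show ?thesis by (simp add: powr_minus field_simps)
  qed
  have le: "exp (- (\<bar>s\<bar> powr b)) \<le> indicator {-1..1} s + (2 * ?f s + 2 * ?f (0 + (- 1) * s))" for s :: real
  proof -
    consider "\<bar>s\<bar> \<le> 1" | "1 < s" | "1 < - s" by linarith
    then show ?thesis
    proof cases
      case 1
      then have "indicator {-1..1} s = (1::real)" by (simp add: abs_le_iff)
      moreover have "exp (- (\<bar>s\<bar> powr b)) \<le> 1" by simp
      moreover have "0 \<le> ?f s" "0 \<le> ?f (0 + (- 1) * s)" by simp_all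
      ultimately show ?thesis by linarith
    next
      case 2
      then show ?thesis using key[of s] by simp
    next
      case 3
      then show ?thesis using key[of "- s"] by simp
    qed
  qed
  show "AE s in lborel. norm (exp (- (\<bar>s\<bar> powr b))) \<le> norm (indicator {-1..1} s + (2 * ?f s + 2 * ?f (0 + (- 1) * s)))"
  proof (rule AE_I2)
    fix s :: real
    show "norm (exp (- (\<bar>s\<bar> powr b))) \<le> norm (indicator {-1..1} s + (2 * ?f s + 2 * ?f (0 + (- 1) * s)))"
      using le[of s] by (simp only: real_norm_def abs_exp_cancel)
  qed
qed simp

text \<open>Scaling by \<open>a powr (1 / b)\<close>. The power of \<open>a\<close> that comes out
  is the source of the exponents in \<open>W\<close>.\<close>

lemma integrable_exp_powr_scaled:
  assumes b: "1 / 2 < b" and a: "0 < a"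
  shows "integrable lborel (\<lambda>s::real. exp (- (a * \<bar>s\<bar> powr b)))"
    "(LBINT s::real. exp (- (a * \<bar>s\<bar> powr b))) = a powr (- (1 / b)) * (LBINT s::real. exp (- (\<bar>s\<bar> powr b)))"
proof -
  define d where "d = a powr (1 / b)"
  have d: "0 < d" "d powr b = a" using a b by (simp_all add: d_def powr_powr)
  have eq: "exp (- (a * \<bar>s\<bar> powr b)) = exp (- (\<bar>0 + d * s\<bar> powr b))" for s
    using d by (simp add: abs_mult powr_mult)
  show "integrable lborel (\<lambda>s::real. exp (- (a * \<bar>s\<bar> powr b)))"
    unfolding eq using d by (intro lborel_integrable_real_affine integrable_exp_powr b) auto
  have "(LBINT s::real. exp (- (\<bar>s\<bar> powr b))) = d * (LBINT s::real. exp (- (a * \<bar>s\<bar> powr b)))"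
    unfolding eq using lborel_integral_real_affine[of d "\<lambda>s::real. exp (- (\<bar>s\<bar> powr b))" 0] d by simp
  then show "(LBINT s::real. exp (- (a * \<bar>s\<bar> powr b))) = a powr (- (1 / b)) * (LBINT s::real. exp (- (\<bar>s\<bar> powr b)))"
    using d a by (simp add: d_def powr_minus)
qed

section \<open>Levy exponents expressed through tails\<close>

lemma FTC_iexp:
  fixes t b :: real
  assumes "0 \<le> b"
  shows "(CLBINT r. indicator {0..b} r *\<^sub>R (\<i> * t * iexp (t * r))) = iexp (t * b) - 1"
proof -
  have "((\<lambda>r. iexp (t * r)) has_vector_derivative (\<i> * t * iexp (t * r))) (at r within {0..b})" for r
  proof -
    have "((\<lambda>z. exp (\<i> * t * z)) has_field_derivative \<i> * t * exp (\<i> * t * r)) (at (complex_of_real r))"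
      by (auto intro!: derivative_eq_intros)
    then have "((\<lambda>z. exp (\<i> * t * of_real z)) has_vector_derivative \<i> * t * exp (\<i> * t * r)) (at r within {0..b})"
      by (rule has_vector_derivative_real_field)
    then show ?thesis by (simp add: mult.assoc)
  qed
  then have "(CLBINT r. indicator {0..b} r *\<^sub>R (\<i> * t * iexp (t * r))) = iexp (t * b) - iexp (t * 0)"
    using assms by (intro integral_FTC_Icc) (auto intro!: continuous_intros)
  then show ?thesis by simp
qed

text \<open>Integrating \<open>iexp (t * x) - 1 = \<integral>\<^sub>0\<^sup>x \<i> t iexp (t r) dr\<close> by parts expresses the Levy exponent
  through the tail of the measure; stopping at \<open>R\<close> keeps the integral absolutely convergent.\<close>

lemma exponent_truncation:
  fixes N :: "real measure" and G :: "real \<Rightarrow> real"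
  assumes sets [measurable_cong]: "sets N = sets borel"
    and fin: "emeasure N {..0} < \<infinity>"
    and G: "\<And>r. 0 < r \<Longrightarrow> emeasure N {r<..} = ennreal (G r)" "\<And>r. 0 < r \<Longrightarrow> 0 \<le> G r"
    and int: "set_integrable lborel {0<..R} G" and R: "0 < R"
  shows "set_integrable N {0<..} (\<lambda>x. iexp (t * x) - 1)"
    and "cmod ((CLINT x:{0<..}|N. iexp (t * x) - 1) - (CLBINT r:{0<..R}. \<i> * t * iexp (t * r) * G r)) \<le> 2 * G R"
proof -
  \<comment> \<open>Fubini needs a \<sigma>-finite measure. A Levy measure may be infinite near 0,
    so the cover consists of \<open>{..0}\<close> and half-lines away from 0.\<close>
  interpret sigma_finite_measure N
  proof
    show "\<exists>A. countable A \<and> A \<subseteq> sets N \<and> \<Union> A = space N \<and> (\<forall>a\<in>A. emeasure N a \<noteq> \<infinity>)"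
    proof (intro exI[of _ "insert {..0} (range (\<lambda>n. {1 / real (Suc n)<..}))"] conjI ballI)
      show "\<Union> (insert {..0} (range (\<lambda>n. {1 / real (Suc n)<..}))) = space N"
      proof -
        have "\<exists>n. 1 / real (Suc n) < x" if "0 < x" for x :: real
          using reals_Archimedean[OF that] by (auto simp: inverse_eq_divide)
        then have "\<Union> (insert {..0} (range (\<lambda>n. {1 / real (Suc n)<..}))) = (UNIV :: real set)"
          by (auto simp: not_le) (use not_le in blast)
        then show ?thesis using sets_eq_imp_space_eq[OF sets] by simp
      qed
      fix a assume "a \<in> insert {..0} (range (\<lambda>n. {1 / real (Suc n)<..}))"
      then show "emeasure N a \<noteq> \<infinity>" using fin G(1) by (auto simp: less_top)
    qed (auto simp: sets)
  qed
  interpret P: pair_sigma_finite lborel N ..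
  have space: "space N = UNIV" using sets_eq_imp_space_eq[OF sets] by simp
  have meas: "measure N {r<..} = G r" if "0 < r" for r
    using G that by (simp add: measure_def)
  \<comment> \<open>Integrating out \<open>x\<close> leaves the tail \<open>G r\<close>; integrating
    out \<open>r\<close> leaves \<open>iexp (t * min x R) - 1\<close>.\<close>
  define f where "f r x = (indicator {0<..R} r * indicator {r<..} x) *\<^sub>R (\<i> * t * iexp (t * r))" for r x :: real
  have f_alt: "f r x = (indicator {z. fst z \<in> {0<..R} \<and> fst z < snd z} (r, x)) *\<^sub>R (\<i> * t * iexp (t * r))" for r x
    by (auto simp: f_def split: split_indicator)
  have fm [measurable]: "case_prod f \<in> borel_measurable (lborel \<Otimes>\<^sub>M N)"
    unfolding f_alt by measurable
  have nf: "norm (f r x) = (\<bar>t\<bar> * indicator {0<..R} r) * indicator {r<..} x" for r x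
    by (simp add: f_def norm_mult split: split_indicator)
  have ind: "integrable N (indicator {r<..} :: real \<Rightarrow> real)" if "0 < r" for r
    using G that by (intro integrable_real_indicator) (auto simp: sets)
  have fint: "integrable (lborel \<Otimes>\<^sub>M N) (case_prod f)"
  proof (rule P.Fubini_integrable[OF fm])
    have "(\<integral>x. norm (case_prod f (r, x)) \<partial>N) = \<bar>t\<bar> * (indicator {0<..R} r *\<^sub>R G r)" for r
      by (simp add: nf meas space split: split_indicator)
    then show "integrable lborel (\<lambda>r. \<integral>x. norm (case_prod f (r, x)) \<partial>N)"
      using int unfolding set_integrable_def by (simp only: integrable_mult_right)
    show "AE r in lborel. integrable N (\<lambda>x. case_prod f (r, x))"
    proof (rule AE_I2)
      fix r :: real
      show "integrable N (\<lambda>x. case_prod f (r, x))"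
      proof (cases "r \<in> {0<..R}")
        case True
        then have "integrable N (\<lambda>x. indicator {r<..} x *\<^sub>R (\<i> * t * iexp (t * r)))"
          using ind[of r] by (intro integrable_scaleR_left) auto
        then show ?thesis using True by (simp add: f_def)
      qed (simp add: f_def)
    qed
  qed
  have inner: "(\<integral>r. f r x \<partial>lborel) = indicator {0<..} x *\<^sub>R (iexp (t * min x R) - 1)" for x
  proof (cases "0 < x")
    case True
    have "(\<integral>r. f r x \<partial>lborel) = (CLBINT r. indicator {0..min x R} r *\<^sub>R (\<i> * t * iexp (t * r)))"
    proof (rule integral_cong_AE)
      show "AE r in lborel. f r x = indicator {0..min x R} r *\<^sub>R (\<i> * t * iexp (t * r))"
        using AE_lborel_singleton[of 0] AE_lborel_singleton[of x]
        by eventually_elim (auto simp: f_def split: split_indicator)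
      have "f r x = indicator ({0<..R} \<inter> {..<x}) r *\<^sub>R (\<i> * t * iexp (t * r))" for r
        by (auto simp: f_def split: split_indicator)
      then show "(\<lambda>r. f r x) \<in> borel_measurable lborel" by simp
    qed simp_all
    also have "\<dots> = iexp (t * min x R) - 1" using True R by (intro FTC_iexp) auto
    finally show ?thesis using True by simp
  next
    case False
    then have "f r x = 0" for r by (auto simp: f_def split: split_indicator)
    then show ?thesis using False by simp
  qed
  have int1: "integrable N (\<lambda>x. indicator {0<..} x *\<^sub>R (iexp (t * min x R) - 1))"
    using P.integrable_snd[OF fint] unfolding inner .
  have val: "(\<integral>x. indicator {0<..} x *\<^sub>R (iexp (t * min x R) - 1) \<partial>N) = (CLBINT r:{0<..R}. \<i> * t * iexp (t * r) * G r)"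
  proof -
    have "(\<integral>x. indicator {0<..} x *\<^sub>R (iexp (t * min x R) - 1) \<partial>N) = (\<integral>x. (\<integral>r. f r x \<partial>lborel) \<partial>N)"
      by (simp only: inner)
    also have "\<dots> = (\<integral>r. (\<integral>x. f r x \<partial>N) \<partial>lborel)" by (rule P.Fubini_integral[OF fint])
    also have "(\<lambda>r. \<integral>x. f r x \<partial>N) = (\<lambda>r. indicator {0<..R} r *\<^sub>R (\<i> * t * iexp (t * r) * G r))"
    proof
      fix r :: real
      show "(\<integral>x. f r x \<partial>N) = indicator {0<..R} r *\<^sub>R (\<i> * t * iexp (t * r) * G r)"
      proof (cases "r \<in> {0<..R}")
        case True
        then have "(\<integral>x. f r x \<partial>N) = (\<integral>x. indicator {r<..} x *\<^sub>R (\<i> * t * iexp (t * r)) \<partial>N)"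
          by (simp add: f_def)
        also have "\<dots> = G r *\<^sub>R (\<i> * t * iexp (t * r))"
          using ind[of r] True meas[of r] space by (subst integral_scaleR_left) auto
        finally show ?thesis using True by (simp add: scaleR_conv_of_real mult.commute)
      qed (simp add: f_def)
    qed
    finally show ?thesis by (simp add: set_lebesgue_integral_def)
  qed
  \<comment> \<open>The remainder lives on \<open>{R<..}\<close>, a set of mass \<open>G R\<close>,
    and is bounded there by 2.\<close>
  define e where "e x = indicator {R<..} x *\<^sub>R (iexp (t * x) - iexp (t * R))" for x
  have em: "e \<in> borel_measurable N" unfolding e_def by simp
  have ne: "norm (e x) \<le> 2 * indicator {R<..} x" for x
    using norm_triangle_ineq4[of "iexp (t * x)" "iexp (t * R)"] by (auto simp: e_def split: split_indicator)
  have int2: "integrable N e"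
    by (rule Bochner_Integration.integrable_bound[OF integrable_mult_right[OF ind[OF R], of 2] em])
      (use ne in auto)
  have dec: "indicator {0<..} x *\<^sub>R (iexp (t * x) - 1) = indicator {0<..} x *\<^sub>R (iexp (t * min x R) - 1) + e x" for x
    using R by (auto simp: e_def min_def split: split_indicator)
  show "set_integrable N {0<..} (\<lambda>x. iexp (t * x) - 1)"
    unfolding set_integrable_def dec by (intro Bochner_Integration.integrable_add int1 int2)
  have "(CLINT x:{0<..}|N. iexp (t * x) - 1) - (CLBINT r:{0<..R}. \<i> * t * iexp (t * r) * G r) = (\<integral>x. e x \<partial>N)"
    unfolding set_lebesgue_integral_def[of N] dec
    by (simp only: Bochner_Integration.integral_add[OF int1 int2] val add_diff_cancel_left')
  also have "cmod \<dots> \<le> (\<integral>x. 2 * indicator {R<..} x \<partial>N)"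
    by (rule order.trans[OF integral_norm_bound integral_mono])
      (use int2 ne ind[OF R] in \<open>auto intro!: integrable_norm\<close>)
  also have "\<dots> = 2 * G R" using meas[OF R] space by simp
  finally show "cmod ((CLINT x:{0<..}|N. iexp (t * x) - 1) - (CLBINT r:{0<..R}. \<i> * t * iexp (t * r) * G r)) \<le> 2 * G R" .
qed

text \<open>The truncation errors are uniformly small for large \<open>R\<close>, since the
  dominating powers vanish at infinity. On the bounded interval that remains, dominated convergence
  applies: exponents below 1 make the powers integrable at 0, and a countable exceptional set is
  null.\<close>

lemma exponent_convergence:
  fixes E :: "nat \<Rightarrow> complex" and E' :: complex and G :: "nat \<Rightarrow> real \<Rightarrow> real" and G' :: "real \<Rightarrow> real" and t :: real
  assumes trunc: "\<And>i R. 0 < R \<Longrightarrow> cmod (E i - (CLBINT r:{0<..R}. \<i> * t * iexp (t * r) * G i r)) \<le> 2 * G i R"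
    and trunc': "\<And>R. 0 < R \<Longrightarrow> cmod (E' - (CLBINT r:{0<..R}. \<i> * t * iexp (t * r) * G' r)) \<le> 2 * G' R"
    and D: "countable D" and conv: "\<And>v. 0 < v \<Longrightarrow> v \<notin> D \<Longrightarrow> (\<lambda>i. G i v) \<longlonglongrightarrow> G' v"
    and bound: "\<And>i v. 0 < v \<Longrightarrow> \<bar>G i v\<bar> \<le> C * (v powr (- b) + v powr (- b'))"
    and b: "0 < b" "b < 1" "0 < b'" "b' < 1"
    and meas [measurable]: "\<And>i. G i \<in> borel_measurable borel" "G' \<in> borel_measurable borel"
  shows "E \<longlonglongrightarrow> E'"
proof (rule tendstoI)
  fix e :: real assume e: "0 < e"
  have "((\<lambda>R. 2 * (C * (R powr (- b) + R powr (- b')))) \<longlongrightarrow> 2 * (C * (0 + 0))) at_top"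
    using b by (intro tendsto_intros tendsto_neg_powr filterlim_ident) auto
  then have "\<forall>\<^sub>F R in at_top. 2 * (C * (R powr (- b) + R powr (- b'))) < e / 4"
    by (rule order_tendstoD) (use e in auto)
  then obtain K where K: "\<And>R. K \<le> R \<Longrightarrow> 2 * (C * (R powr (- b) + R powr (- b'))) < e / 4"
    by (auto simp: eventually_at_top_linorder)
  \<comment> \<open>\<open>R\<close> has to avoid \<open>D\<close>, because the bound for
    \<open>G' R\<close> is obtained as the limit of the bounds for \<open>G i R\<close>.\<close>
  obtain R where "R \<in> {max K 0<..<max K 0 + 1}" "R \<notin> D"
    using open_minus_countable[OF D, of "{max K 0<..<max K 0 + 1}"] by auto
  then have R: "0 < R" "R \<notin> D" "K \<le> R" by auto
  have GR: "2 * G i R < e / 4" for i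
    using bound[OF R(1), of i] K[OF R(3)] by linarith
  have G'R: "2 * G' R \<le> e / 4"
    by (rule LIMSEQ_le_const2[OF tendsto_mult_left[OF conv[OF R(1,2)]]]) (use GR less_imp_le in auto)
  let ?I = "\<lambda>g::real\<Rightarrow>real. CLBINT r:{0<..R}. \<i> * t * iexp (t * r) * g r"
  have "(\<lambda>i. ?I (G i)) \<longlonglongrightarrow> ?I G'"
    unfolding set_lebesgue_integral_def
  proof (rule integral_dominated_convergence)
    let ?w = "\<lambda>r. \<bar>t\<bar> * C * (indicator {0<..R} r *\<^sub>R r powr (- b) + indicator {0<..R} r *\<^sub>R r powr (- b'))"
    show "integrable lborel ?w"
      using set_integrable_powr_0[of b R] set_integrable_powr_0[of b' R] b R
      unfolding set_integrable_def by (intro integrable_mult_right Bochner_Integration.integrable_add) auto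
    fix i
    show "AE r in lborel. norm (indicator {0<..R} r *\<^sub>R (\<i> * t * iexp (t * r) * G i r)) \<le> ?w r"
    proof (rule AE_I2)
      fix r :: real
      show "norm (indicator {0<..R} r *\<^sub>R (\<i> * t * iexp (t * r) * G i r)) \<le> ?w r"
      proof (cases "r \<in> {0<..R}")
        case True
        then have "\<bar>t\<bar> * \<bar>G i r\<bar> \<le> \<bar>t\<bar> * (C * (r powr (- b) + r powr (- b')))"
          using bound[of r i] by (intro mult_left_mono) auto
        then show ?thesis using True by (simp add: norm_mult mult.assoc)
      qed simp
    qed
  next
    have "AE r in lborel. r \<notin> D" by (rule AE_discrete_difference[OF D, simplified]) auto
    then show "AE r in lborel. (\<lambda>i. indicator {0<..R} r *\<^sub>R (\<i> * t * iexp (t * r) * G i r))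
        \<longlonglongrightarrow> indicator {0<..R} r *\<^sub>R (\<i> * t * iexp (t * r) * G' r)"
    proof eventually_elim
      case (elim r)
      then show ?case using conv[of r]
        by (cases "r \<in> {0<..R}") (auto intro!: tendsto_intros)
    qed
  qed simp_all
  from tendstoD[OF this, of "e / 4"] e have "\<forall>\<^sub>F i in sequentially. dist (?I (G i)) (?I G') < e / 4" by simp
  then show "\<forall>\<^sub>F i in sequentially. dist (E i) E' < e"
  proof eventually_elim
    case (elim i)
    have "dist (E i) E' \<le> dist (E i) (?I (G i)) + dist (?I (G i)) (?I G') + dist E' (?I G')"
      using dist_triangle[of "E i" E' "?I (G i)"] dist_triangle[of "?I (G i)" E' "?I G'"]
      by (simp add: dist_commute)
    moreover have "dist (E i) (?I (G i)) < e / 4" using trunc[OF R(1), of i] GR[of i] by (simp add: dist_norm)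
    moreover have "dist E' (?I G') \<le> e / 4" using trunc'[OF R(1)] G'R by (simp add: dist_norm)
    ultimately show ?case using elim e by linarith
  qed
qed

text \<open>Tightness yields a weakly convergent subsequence, and its limit must have characteristic
  function \<psi>.\<close>

lemma char_limit_exists:
  assumes tight: "tight \<mu>" and conv: "\<And>t. (\<lambda>n. char (\<mu> n) t) \<longlonglongrightarrow> \<psi> t"
  shows "\<exists>\<nu>. real_distribution \<nu> \<and> (\<forall>t. char \<nu> t = \<psi> t)"
proof -
  obtain r \<nu> where r: "strict_mono (r :: nat \<Rightarrow> nat)" and nu: "real_distribution \<nu>" "weak_conv_m (\<mu> \<circ> id \<circ> r) \<nu>"
    using tight_imp_convergent_subsubsequence[OF tight, of id] by (auto simp: strict_mono_def)
  have "char \<nu> t = \<psi> t" for t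
  proof (rule LIMSEQ_unique)
    show "(\<lambda>n. char ((\<mu> \<circ> id \<circ> r) n) t) \<longlonglongrightarrow> char \<nu> t"
      by (rule levy_continuity1[OF _ nu]) (use tight in \<open>simp add: tight_def\<close>)
    show "(\<lambda>n. char ((\<mu> \<circ> id \<circ> r) n) t) \<longlonglongrightarrow> \<psi> t"
      using LIMSEQ_subseq_LIMSEQ[OF conv r] by (simp add: comp_def)
  qed
  with nu show ?thesis by blast
qed


section \<open>Fourier inversion for integrable characteristic functions\<close>

context real_distribution
begin

text \<open>The inversion integral is real, because \<open>char M (- t)\<close> is the conjugate of
  \<open>char M t\<close>; \<open>Re\<close> merely changes its type.\<close>

definition inversion_density :: "real \<Rightarrow> real" where
  "inversion_density x = Re (CLBINT t. char M t * iexp (- (t * x))) / (2 * pi)"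

context
  assumes int: "integrable lborel (char M)"
begin

lemma isCont_inversion_density: "isCont inversion_density x"
  unfolding inversion_density_def continuous_at_sequentially comp_def
proof (intro allI impI)
  fix u assume u: "u \<longlonglongrightarrow> x"
  have "(\<lambda>n. CLBINT t. char M t * iexp (- (t * u n))) \<longlonglongrightarrow> (CLBINT t. char M t * iexp (- (t * x)))"
    by (rule integral_dominated_convergence[where w="\<lambda>t. norm (char M t)"])
      (use int u in \<open>auto intro!: integrable_norm tendsto_intros simp: norm_mult\<close>)
  then show "(\<lambda>n. Re (CLBINT t. char M t * iexp (- (t * u n))) / (2 * pi))
      \<longlonglongrightarrow> Re (CLBINT t. char M t * iexp (- (t * x))) / (2 * pi)"
    by (intro tendsto_intros) auto
qed

lemma inversion_density_bound: "\<bar>inversion_density x\<bar> \<le> (LBINT t. norm (char M t)) / (2 * pi)"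
proof -
  have "\<bar>Re (CLBINT t. char M t * iexp (- (t * x)))\<bar> \<le> (LBINT t. norm (char M t * iexp (- (t * x))))"
    by (rule order.trans[OF abs_Re_le_cmod integral_norm_bound])
  then show ?thesis by (simp add: inversion_density_def norm_mult divide_right_mono)
qed

text \<open>The kernel \<open>H\<close> of Levy's inversion formula is bounded by
  \<open>b - a\<close>, so integrability of the characteristic function turns the limit over
  symmetric intervals into one absolutely convergent integral. As \<open>H t\<close> is itself the
  integral of \<open>iexp (- (t * x))\<close> over \<open>{a..b}\<close>, Fubini produces the
  density. The condition on the endpoints is the one of the inversion formula and is removed
  afterwards.\<close>

lemma inversion_density_Ioc_aux:
  assumes ab: "a \<le> b" and "prob {a} = 0" "prob {b} = 0"
  shows "prob {a<..b} = (LBINT x:{a..b}. inversion_density x)"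
proof -
  define H where "H t = (iexp (- (t * a)) - iexp (- (t * b))) / (\<i> * t)" for t :: real
  have Hb: "norm (H t) \<le> b - a" if "t \<noteq> 0" for t
    unfolding H_def using Levy_Inversion_aux2[of "- b" "- a" t] that ab by simp
  have Hm [measurable]: "H \<in> borel_measurable borel" unfolding H_def by simp
  have "(\<lambda>T::nat. CLBINT t. indicator {- real T<..<real T} t *\<^sub>R (H t * char M t)) \<longlonglongrightarrow> (CLBINT t. H t * char M t)"
  proof (rule integral_dominated_convergence)
    show "integrable lborel (\<lambda>t. (b - a) * norm (char M t))" using int by (intro integrable_mult_right integrable_norm)
    show "AE t in lborel. norm (indicator {- real T<..<real T} t *\<^sub>R (H t * char M t)) \<le> (b - a) * norm (char M t)" for T :: nat
      using AE_lborel_singleton[of 0]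
      by eventually_elim (use Hb ab in \<open>auto simp: norm_mult split: split_indicator intro!: mult_right_mono\<close>)
    show "AE t in lborel. (\<lambda>T. indicator {- real T<..<real T} t *\<^sub>R (H t * char M t)) \<longlonglongrightarrow> H t * char M t"
    proof (rule AE_I2)
      fix t :: real
      have "\<forall>\<^sub>F T in sequentially. indicator {- real T<..<real T} t *\<^sub>R (H t * char M t) = H t * char M t"
        using eventually_gt_at_top[of "nat \<lceil>\<bar>t\<bar>\<rceil>"]
      proof eventually_elim
        case (elim T)
        then have "\<bar>t\<bar> < real T" by linarith
        then show ?case by (simp add: abs_less_iff)
      qed
      then show "(\<lambda>T. indicator {- real T<..<real T} t *\<^sub>R (H t * char M t)) \<longlonglongrightarrow> H t * char M t"
        by (rule tendsto_eventually)
    qed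
  qed simp_all
  then have "(\<lambda>T::nat. 1 / (2 * pi) * (CLBINT t=-T..T. H t * char M t)) \<longlonglongrightarrow> 1 / (2 * pi) * (CLBINT t. H t * char M t)"
    by (intro tendsto_mult_left) (simp add: interval_lebesgue_integral_def set_lebesgue_integral_def)
  from LIMSEQ_unique[OF this Levy_Inversion[OF assms, folded H_def]]
  have 1: "of_real (prob {a<..b}) = 1 / (2 * pi) * (CLBINT t. H t * char M t)" by simp
  let ?f = "\<lambda>x t. indicator {a..b} x *\<^sub>R (char M t * iexp (- (t * x)))"
  have fint: "integrable (lborel \<Otimes>\<^sub>M lborel) (\<lambda>(x, t). ?f x t)"
  proof (rule lborel_pair.Fubini_integrable)
    have eq: "(\<integral>t. norm (case (x, t) of (x, t) \<Rightarrow> ?f x t) \<partial>lborel) = indicator {a..b} x *\<^sub>R (LBINT t. norm (char M t))" for x :: real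
      by (simp add: norm_mult del: of_real_mult of_real_minus)
    show "integrable lborel (\<lambda>x. \<integral>t. norm (case (x, t) of (x, t) \<Rightarrow> ?f x t) \<partial>lborel)"
      unfolding eq by (simp add: emeasure_lborel_Icc_eq)
    show "AE x in lborel. integrable lborel (\<lambda>t. case (x, t) of (x, t) \<Rightarrow> ?f x t)"
    proof (rule AE_I2)
      fix x :: real
      have "integrable lborel (\<lambda>t. char M t * iexp (- (t * x)))"
        by (rule Bochner_Integration.integrable_bound[OF int]) (auto simp: norm_mult)
      then show "integrable lborel (\<lambda>t. case (x, t) of (x, t) \<Rightarrow> ?f x t)" by simp
    qed
  qed measurable
  have "(CLBINT t. H t * char M t) = (CLBINT t. (CLBINT x. ?f x t))"
  proof (rule integral_cong_AE)
    show "AE t in lborel. H t * char M t = (CLBINT x. ?f x t)"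
      using AE_lborel_singleton[of 0]
    proof eventually_elim
      case (elim t)
      have "((\<lambda>x. (iexp (- (t * x))) / (- \<i> * t)) has_vector_derivative (iexp (- (t * x)))) (at x within {a..b})" for x
      proof -
        have "((\<lambda>z. exp (- \<i> * t * z) / (- \<i> * t)) has_field_derivative exp (- \<i> * t * x)) (at (complex_of_real x))"
          using elim by (auto intro!: derivative_eq_intros)
        then have "((\<lambda>z. exp (- \<i> * t * of_real z) / (- \<i> * t)) has_vector_derivative exp (- \<i> * t * x)) (at x within {a..b})"
          by (rule has_vector_derivative_real_field)
        then show ?thesis by (simp add: mult.assoc)
      qed
      then have "(CLBINT x. indicator {a..b} x *\<^sub>R iexp (- (t * x))) = (iexp (- (t * b))) / (- \<i> * t) - (iexp (- (t * a))) / (- \<i> * t)"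
        using ab by (intro integral_FTC_Icc) (auto intro!: continuous_intros)
      also have "\<dots> = H t" by (simp add: H_def diff_divide_distrib)
      finally have eq: "(CLBINT x. indicator {a..b} x *\<^sub>R iexp (- (t * x))) = H t" .
      have "(CLBINT x. (indicator {a..b} x *\<^sub>R iexp (- (t * x))) * char M t) = H t * char M t"
        unfolding eq[symmetric] by (rule integral_mult_left_zero)
      then show ?case by (simp add: mult.commute)
    qed
  qed simp_all
  also have "\<dots> = (CLBINT x. (CLBINT t. ?f x t))" by (rule lborel_pair.Fubini_integral[OF fint])
  also have "\<dots> = (CLBINT x. indicator {a..b} x *\<^sub>R (CLBINT t. char M t * iexp (- (t * x))))"
    by simp
  finally have 2: "of_real (prob {a<..b}) = 1 / (2 * pi) * (CLBINT x. indicator {a..b} x *\<^sub>R (CLBINT t. char M t * iexp (- (t * x))))"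
    using 1 by simp
  have int3: "integrable lborel (\<lambda>x. indicator {a..b} x *\<^sub>R (CLBINT t. char M t * iexp (- (t * x))))"
    using lborel_pair.integrable_fst[OF fint] by simp
  have "prob {a<..b} = Re (of_real (prob {a<..b}))" by simp
  also have "\<dots> = 1 / (2 * pi) * Re (CLBINT x. indicator {a..b} x *\<^sub>R (CLBINT t. char M t * iexp (- (t * x))))"
    unfolding 2 by (simp flip: of_real_mult of_real_divide)
  also have "\<dots> = 1 / (2 * pi) * (LBINT x. Re (indicator {a..b} x *\<^sub>R (CLBINT t. char M t * iexp (- (t * x)))))"
    by (simp only: integral_Re[OF int3])
  also have "\<dots> = (LBINT x:{a..b}. inversion_density x)"
    unfolding set_lebesgue_integral_def inversion_density_def integral_mult_right_zero[symmetric]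
    by (simp add: mult_ac)
  finally show ?thesis .
qed

lemma set_integrable_inversion_density: "set_integrable lborel {a..b} inversion_density"
  unfolding set_integrable_def
  by (rule borel_integrable_compact) (auto intro!: continuous_at_imp_continuous_on isCont_inversion_density)

text \<open>The density is bounded, so a short interval around \<open>x\<close> has small
  probability. Its endpoints are taken outside the countable set of atoms, where the formula for
  intervals is already available.\<close>

lemma inversion_density_no_atoms: "prob {x} = 0"
proof (rule ccontr)
  assume "prob {x} \<noteq> 0"
  then have p: "0 < prob {x}" by (simp add: zero_less_measure_iff)
  define K where "K = (LBINT t. norm (char M t)) / (2 * pi) + 1"
  have K: "0 < K" "inversion_density y \<le> K" for y
    using inversion_density_bound[of y] unfolding K_def by linarith+
  \<comment> \<open>An interval of length below \<open>2 * d\<close> then carries at most half of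
    \<open>prob {x}\<close>.\<close>
  define d where "d = prob {x} / (4 * K)"
  have d: "0 < d" using p K by (simp add: d_def)
  have "countable {x. 0 < prob {x}}" by (rule countable_atoms)
  from open_minus_countable[OF this, of "{x - d<..<x}"] open_minus_countable[OF this, of "{x<..<x + d}"] d
  obtain a b where ab: "x - d < a" "a < x" "x < b" "b < x + d" "prob {a} = 0" "prob {b} = 0"
    by (auto simp: zero_less_measure_iff)
  have "prob {x} \<le> prob {a<..b}" using ab by (intro finite_measure_mono) auto
  also have "\<dots> = (LBINT x:{a..b}. inversion_density x)" using ab by (intro inversion_density_Ioc_aux) auto
  also have "\<dots> \<le> (LBINT x:{a..b}. K)"
    using K by (intro set_integral_mono set_integrable_inversion_density)
      (auto simp: set_integrable_def emeasure_lborel_Icc_eq)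
  also have "\<dots> = K * (b - a)" using ab by (simp add: set_lebesgue_integral_def)
  also have "\<dots> \<le> K * (2 * d)" using ab K by (intro mult_left_mono) auto
  also have "\<dots> = prob {x} / 2" using K by (simp add: d_def)
  finally show False using p by simp
qed

lemma inversion_density_Ioc: "a \<le> b \<Longrightarrow> prob {a<..b} = (LBINT x:{a..b}. inversion_density x)"
  by (intro inversion_density_Ioc_aux inversion_density_no_atoms)

lemma inversion_density_nonneg: "0 \<le> inversion_density x"
proof (rule ccontr)
  assume "\<not> ?thesis"
  then have neg: "inversion_density x < 0" "inversion_density x < inversion_density x / 2" by simp_all
  have "(inversion_density \<longlongrightarrow> inversion_density x) (at x)"
    using isCont_inversion_density by (simp add: continuous_at)
  from order_tendstoD(2)[OF this neg(2)]
  obtain d where d: "0 < d" "\<And>y. y \<noteq> x \<Longrightarrow> dist y x < d \<Longrightarrow> inversion_density y < inversion_density x / 2"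
    unfolding eventually_at by auto
  define e where "e = d / 2"
  have e: "0 < e" "e < d" using d by (auto simp: e_def)
  have "0 \<le> prob {x - e<..x + e}" by simp
  also have "\<dots> = (LBINT x:{x - e..x + e}. inversion_density x)" using e by (intro inversion_density_Ioc) auto
  also have "\<dots> \<le> (LBINT y:{x - e..x + e}. inversion_density x / 2)"
  proof (intro set_integral_mono set_integrable_inversion_density)
    show "set_integrable lborel {x - e..x + e} (\<lambda>y. inversion_density x / 2)"
      by (auto simp: set_integrable_def emeasure_lborel_Icc_eq)
    show "inversion_density y \<le> inversion_density x / 2" if "y \<in> {x - e..x + e}" for y
    proof -
      have "dist y x < d" using that e by (auto simp: dist_real_def abs_less_iff)
      then have "inversion_density y < inversion_density x / 2" using d(2)[of y] neg by (cases "y = x") auto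
      then show ?thesis by simp
    qed
  qed
  also have "\<dots> = e * inversion_density x" using e by (simp add: set_lebesgue_integral_def)
  also have "\<dots> < 0" using e neg by (simp add: mult_pos_neg)
  finally show False by simp
qed

lemma eq_density_inversion: "M = density lborel (\<lambda>x. ennreal (inversion_density x))"
proof (rule measure_eqI_lessThan)
  have bm [measurable]: "inversion_density \<in> borel_measurable borel"
    by (intro borel_measurable_continuous_onI continuous_at_imp_continuous_on ballI isCont_inversion_density)
  let ?D = "density lborel (\<lambda>x. ennreal (inversion_density x))"
  show "emeasure M {x<..} < \<infinity>" for x by (simp add: less_top[symmetric])
  show "emeasure M {x<..} = emeasure ?D {x<..}" for x
  proof (rule LIMSEQ_unique)
    have U: "(\<Union>n. {x<..x + real n}) = {x<..}"
    proof (intro equalityI subsetI)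
      fix y assume "y \<in> {x<..}"
      moreover obtain n where "y - x \<le> real n" using real_arch_simple by blast
      ultimately show "y \<in> (\<Union>n. {x<..x + real n})" by (auto intro!: exI[of _ n])
    qed auto
    have "(\<lambda>n. emeasure M {x<..x + real n}) \<longlonglongrightarrow> emeasure M (\<Union>n. {x<..x + real n})"
      by (rule Lim_emeasure_incseq) (auto simp: incseq_def)
    then show "(\<lambda>n. emeasure M {x<..x + real n}) \<longlonglongrightarrow> emeasure M {x<..}" unfolding U .
    have "(\<lambda>n. emeasure ?D {x<..x + real n}) \<longlonglongrightarrow> emeasure ?D (\<Union>n. {x<..x + real n})"
      by (rule Lim_emeasure_incseq) (auto simp: incseq_def)
    moreover have "emeasure ?D {x<..x + real n} = emeasure M {x<..x + real n}" for n
    proof -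
      have "emeasure ?D {x<..x + real n} = (\<integral>\<^sup>+y. ennreal (indicator {x..x + real n} y *\<^sub>R inversion_density y) \<partial>lborel)"
        by (subst emeasure_density) (auto intro!: nn_integral_cong_AE eventually_mono[OF AE_lborel_singleton[of x]] simp: inversion_density_nonneg split: split_indicator)
      also have "\<dots> = ennreal (LBINT y:{x..x + real n}. inversion_density y)"
        unfolding set_lebesgue_integral_def
        using set_integrable_inversion_density[of x "x + real n"]
        by (intro nn_integral_eq_integral) (auto simp: set_integrable_def inversion_density_nonneg)
      also have "\<dots> = emeasure M {x<..x + real n}"
        by (simp add: emeasure_eq_measure inversion_density_Ioc)
      finally show ?thesis .
    qed
    ultimately show "(\<lambda>n. emeasure M {x<..x + real n}) \<longlonglongrightarrow> emeasure ?D {x<..}" unfolding U by simp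
  qed
qed simp_all

end

end

text \<open>The set where two such densities differ is open and null, hence empty. This is what
  makes the \<open>THE\<close> in \<open>semistable_density\<close> well defined.\<close>

lemma continuous_density_unique:
  fixes f g :: "real \<Rightarrow> real"
  assumes f: "continuous_on UNIV f" "\<And>x. 0 \<le> f x" and g: "continuous_on UNIV g" "\<And>x. 0 \<le> g x"
    and eq: "density lborel (\<lambda>x. ennreal (f x)) = density lborel (\<lambda>x. ennreal (g x))"
  shows "f = g"
proof -
  have [measurable]: "f \<in> borel_measurable borel" "g \<in> borel_measurable borel"
    using f g by (auto intro: borel_measurable_continuous_onI)
  have "AE x in lborel. ennreal (f x) = ennreal (g x)"
    by (rule sigma_finite_measure.density_unique[OF lborel.sigma_finite_measure_axioms _ _ eq]) auto
  then have ae: "AE x in lborel. f x = g x"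
    by eventually_elim (use f g in auto)
  have op: "open {x. f x \<noteq> g x}"
    by (rule open_Collect_neq) (use f g in auto)
  have "{x. f x \<noteq> g x} \<in> null_sets lborel"
    using ae by (subst (asm) AE_iff_null) auto
  then have "negligible {x. f x \<noteq> g x}"
    by (simp add: negligible_iff_null_sets null_sets_completionI)
  then have "{x. f x \<noteq> g x} = {}"
    using open_not_negligible[OF op] by blast
  then show ?thesis by auto
qed

section \<open>Characteristic function of the step\<close>

locale semistable_renewal = semistable_tail F \<alpha> c k l1 M h + prob_space P
  for F :: "real \<Rightarrow> real" and \<alpha> c :: real and k :: "nat \<Rightarrow> nat" and l1 M h :: "real \<Rightarrow> real"
    and P :: "'a measure" +
  fixes X :: "nat \<Rightarrow> 'a \<Rightarrow> nat"
  assumes indep: "indep_vars (\<lambda>_. count_space UNIV) X UNIV"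
    and ident: "\<And>i. distr P (count_space UNIV) (X i) = distr P (count_space UNIV) (X 0)"
    and span: "has_span P (\<lambda>\<omega>. real (X 0 \<omega>)) 1"
    and F_cdf: "F = cdf (distr P borel (\<lambda>\<omega>. real (X 0 \<omega>)))"
begin

definition \<mu> :: "real measure" where "\<mu> = distr P borel (\<lambda>\<omega>. real (X 0 \<omega>))"

abbreviation \<phi> :: "real \<Rightarrow> complex" where "\<phi> \<equiv> char \<mu>"

lemma X_measurable [measurable]: "X i \<in> measurable P (count_space UNIV)"
  using indep unfolding indep_vars_def by auto

lemma real_X_measurable [measurable]: "(\<lambda>\<omega>. real (X i \<omega>)) \<in> borel_measurable P"
  by (rule measurable_compose[OF X_measurable]) simp

sublocale \<mu>: real_distribution \<mu>
  unfolding \<mu>_def by (rule real_distribution_distr) simp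

lemma sets_\<mu> [measurable_cong, simp]: "sets \<mu> = sets borel"
  by (simp add: \<mu>_def)

lemma distr_X: "distr P borel (\<lambda>\<omega>. real (X i \<omega>)) = \<mu>"
proof -
  have "distr (distr P (count_space UNIV) (X j)) borel real = distr P borel (\<lambda>\<omega>. real (X j \<omega>))" for j
    by (subst distr_distr) (auto simp: comp_def)
  then show ?thesis unfolding \<mu>_def using ident[of i] by metis
qed

lemma F_\<mu>: "F = cdf \<mu>" by (simp add: F_cdf \<mu>_def)

lemma tail_measure: "measure \<mu> {r<..} = 1 - F r"
proof -
  have "measure \<mu> (space \<mu> - {..r}) = 1 - measure \<mu> {..r}" by (rule \<mu>.prob_compl) simp
  moreover have "space \<mu> - {..r} = {r<..}" by auto
  ultimately show ?thesis by (simp add: F_\<mu> cdf_def)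
qed

lemma AE_\<mu>_nonneg: "AE x in \<mu>. 0 \<le> x"
  unfolding \<mu>_def by (subst AE_distr_iff) auto

definition S :: "nat \<Rightarrow> 'a \<Rightarrow> real" where "S m \<omega> = (\<Sum>i<m. real (X i \<omega>))"

lemma S_measurable [measurable]: "S m \<in> borel_measurable P"
  unfolding S_def by simp

lemma S_partial_sum: "S m \<omega> = real (partial_sum X m \<omega>)"
  by (simp add: S_def partial_sum_def)

definition p :: "nat \<Rightarrow> nat \<Rightarrow> real" where "p m n = prob {\<omega> \<in> space P. partial_sum X m \<omega> = n}"

lemma p_eq: "p m n = prob {\<omega> \<in> space P. S m \<omega> = real n}"
  by (simp add: p_def S_partial_sum)

lemma char_S: "char (distr P borel (S m)) t = \<phi> t ^ m"
proof -
  have "indep_vars (\<lambda>_. borel) (\<lambda>i \<omega>. real (X i \<omega>)) {..<m}"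
    by (rule indep_vars_subset[OF indep_vars_compose2[OF indep]]) auto
  from char_distr_sum[OF this, of t] show ?thesis
    unfolding S_def[abs_def] by (simp add: distr_X)
qed

lemma expectation_iexp_S: "(CLINT \<omega>|P. iexp (t * S m \<omega>)) = \<phi> t ^ m"
proof -
  have "char (distr P borel (S m)) t = (CLINT \<omega>|P. iexp (t * S m \<omega>))"
    unfolding char_def by (subst integral_distr) simp_all
  then show ?thesis by (simp only: char_S)
qed

text \<open>The shift \<open>d\<close> covers both the plain inversion integral and its translate.
  Orthogonality of integer frequencies on \<open>{-pi..pi}\<close> leaves only the event
  \<open>S m = n\<close>, on which the shift contributes the phase
  \<open>iexp (d * n)\<close>.\<close>

lemma Fourier_coefficient:
  fixes n :: nat
  shows "(CLBINT t:{-pi..pi}. \<phi> (t + d) ^ m * iexp (- (t * real n))) = 2 * pi * iexp (d * real n) * p m n"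
proof -
  interpret L: pair_sigma_finite P lborel ..
  let ?f = "\<lambda>\<omega> t::real. indicator {-pi..pi} t *\<^sub>R (iexp ((t + d) * S m \<omega>) * iexp (- (t * real n)))"
  have fint: "integrable (P \<Otimes>\<^sub>M lborel) (\<lambda>(\<omega>, t). ?f \<omega> t)"
  proof (rule L.Fubini_integrable)
    have "(\<integral>t. norm (case (\<omega>, t) of (\<omega>, t) \<Rightarrow> ?f \<omega> t) \<partial>lborel) = 2 * pi" for \<omega>
      by (simp add: norm_mult del: of_real_mult of_real_minus)
    then show "integrable P (\<lambda>\<omega>. \<integral>t. norm (case (\<omega>, t) of (\<omega>, t) \<Rightarrow> ?f \<omega> t) \<partial>lborel)" by simp
    have "integrable lborel (\<lambda>t::real. indicator {-pi..pi} t :: real)" by (simp add: emeasure_lborel_Icc_eq)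
    then have "integrable lborel (\<lambda>t. ?f \<omega> t)" for \<omega>
      by (rule Bochner_Integration.integrable_bound) (auto simp: norm_mult split: split_indicator)
    then show "AE \<omega> in P. integrable lborel (\<lambda>t. case (\<omega>, t) of (\<omega>, t) \<Rightarrow> ?f \<omega> t)" by simp
  qed measurable
  have inner: "(\<integral>t. ?f \<omega> t \<partial>lborel) = indicator {\<omega>. S m \<omega> = real n} \<omega> *\<^sub>R (2 * pi * iexp (d * real n))" for \<omega>
  proof -
    \<comment> \<open>The step is integer valued, so the remaining frequency \<open>j\<close> is an
      integer and its exponential integrates to 0 unless \<open>j = 0\<close>.\<close>
    define j where "j = int (partial_sum X m \<omega>) - int n"
    have Sj: "S m \<omega> = real n + of_int j" by (simp add: S_partial_sum j_def)
    have "?f \<omega> t = iexp (d * S m \<omega>) * (indicator {-pi..pi} t *\<^sub>R iexp (t * of_int j))" for t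
      unfolding Sj by (simp add: exp_add[symmetric] algebra_simps split: split_indicator)
    then have "(\<integral>t. ?f \<omega> t \<partial>lborel) = iexp (d * S m \<omega>) * (\<integral>t. indicator {-pi..pi} t *\<^sub>R iexp (t * of_int j) \<partial>lborel)"
      by (simp only: integral_mult_right_zero)
    also have "(\<integral>t. indicator {-pi..pi} t *\<^sub>R iexp (t * of_int j) \<partial>lborel) = (if j = 0 then 2 * pi else 0)"
    proof (cases "j = 0")
      case False
      have "((\<lambda>x. iexp (x * of_int j) / (\<i> * of_int j)) has_vector_derivative (iexp (x * of_int j))) (at x within {-pi..pi})" for x
      proof -
        have "((\<lambda>z. exp (\<i> * (z * of_int j)) / (\<i> * of_int j)) has_field_derivative exp (\<i> * (of_real x * of_int j))) (at (complex_of_real x))"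
        proof -
          have "((\<lambda>z. exp (\<i> * (z * of_int j))) has_field_derivative exp (\<i> * (of_real x * of_int j)) * (\<i> * of_int j)) (at (complex_of_real x))"
            by (auto intro!: derivative_eq_intros)
          from DERIV_cdivide[OF this, of "\<i> * of_int j"] show ?thesis using False by simp
        qed
        from has_vector_derivative_real_field[OF this] show ?thesis by simp
      qed
      then have "(\<integral>t. indicator {-pi..pi} t *\<^sub>R iexp (t * of_int j) \<partial>lborel)
          = iexp (pi * of_int j) / (\<i> * of_int j) - iexp (- pi * of_int j) / (\<i> * of_int j)"
        by (intro integral_FTC_Icc) (auto intro!: continuous_intros)
      also have "iexp (- pi * of_int j) = iexp (pi * of_int j)"
      proof -
        have e1: "exp (2 * of_int j * of_real pi * \<i>) = 1" using exp_integer_2pi[of "of_int j"] by simp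
        have "exp (\<i> * (of_int j * of_real pi)) = exp (- (\<i> * (of_int j * of_real pi)) + 2 * of_int j * of_real pi * \<i>)"
          by (simp add: algebra_simps)
        also have "\<dots> = exp (- (\<i> * (of_int j * of_real pi)))" by (simp only: exp_add e1 mult_1_right)
        finally show ?thesis by (simp add: mult.commute)
      qed
      finally show ?thesis using False by simp
    qed (simp add: scaleR_conv_of_real)
    finally show ?thesis by (auto simp: Sj split: split_indicator)
  qed
  have "(CLBINT t:{-pi..pi}. \<phi> (t + d) ^ m * iexp (- (t * real n))) = (\<integral>t. (\<integral>\<omega>. ?f \<omega> t \<partial>P) \<partial>lborel)"
    unfolding set_lebesgue_integral_def expectation_iexp_S[symmetric]
    by (simp only: integral_scaleR_right integral_mult_left_zero)
  also have "\<dots> = (\<integral>\<omega>. (\<integral>t. ?f \<omega> t \<partial>lborel) \<partial>P)" by (rule L.Fubini_integral[OF fint])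
  also have "\<dots> = (\<integral>\<omega>. indicator {\<omega> \<in> space P. S m \<omega> = real n} \<omega> *\<^sub>R (2 * pi * iexp (d * real n)) \<partial>P)"
    unfolding inner by (intro Bochner_Integration.integral_cong) (auto split: split_indicator)
  also have "\<dots> = p m n *\<^sub>R (2 * pi * iexp (d * real n))"
    unfolding p_eq by (subst integral_scaleR_left) (auto intro!: integrable_real_indicator simp: emeasure_eq_measure)
  finally show ?thesis by (simp add: scaleR_conv_of_real mult_ac)
qed

section \<open>Truncated mean and increments of \<phi>\<close>

text \<open>Layer-cake formula: for \<open>x \<ge> 0\<close>, \<open>min x L\<close> is the length
  of the set of \<open>r\<close> in \<open>{0<..L}\<close> with \<open>r < x\<close>.\<close>

lemma expectation_min:
  assumes L: "0 < L"
  shows "ennreal (LINT x|\<mu>. min (max 0 x) L) = (\<integral>\<^sup>+r. indicator {0<..L} r * ennreal (1 - F r) \<partial>lborel)"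
proof -
  interpret L: pair_sigma_finite lborel \<mu> ..
  let ?g = "\<lambda>z::real \<times> real. indicator {z. 0 < fst z \<and> fst z \<le> L \<and> fst z < snd z} z :: ennreal"
  have gm: "?g \<in> borel_measurable (lborel \<Otimes>\<^sub>M \<mu>)" by measurable
  have i: "integrable \<mu> (\<lambda>x. min (max 0 x) L)"
    by (rule \<mu>.integrable_const_bound[of _ L]) (use L in auto)
  have "ennreal (LINT x|\<mu>. min (max 0 x) L) = (\<integral>\<^sup>+x. ennreal (min (max 0 x) L) \<partial>\<mu>)"
    using i L by (intro nn_integral_eq_integral[symmetric]) auto
  also have "\<dots> = (\<integral>\<^sup>+x. (\<integral>\<^sup>+r. ?g (r, x) \<partial>lborel) \<partial>\<mu>)"
  proof (intro nn_integral_cong)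
    fix x :: real
    have "(\<integral>\<^sup>+r. ?g (r, x) \<partial>lborel) = (\<integral>\<^sup>+r. indicator {0..min (max 0 x) L} r \<partial>lborel)"
      by (intro nn_integral_cong_AE eventually_mono[OF AE_conjI[OF AE_lborel_singleton[of 0] AE_lborel_singleton[of x]]])
        (auto split: split_indicator)
    also have "\<dots> = ennreal (min (max 0 x) L)" using L by simp
    finally show "ennreal (min (max 0 x) L) = (\<integral>\<^sup>+r. ?g (r, x) \<partial>lborel)" by simp
  qed
  also have "\<dots> = (\<integral>\<^sup>+r. (\<integral>\<^sup>+x. ?g (r, x) \<partial>\<mu>) \<partial>lborel)" by (rule L.Fubini[OF gm])
  also have "\<dots> = (\<integral>\<^sup>+r. indicator {0<..L} r * ennreal (1 - F r) \<partial>lborel)"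
  proof (intro nn_integral_cong)
    fix r :: real
    have "(\<integral>\<^sup>+x. ?g (r, x) \<partial>\<mu>) = (\<integral>\<^sup>+x. indicator {0<..L} r * indicator {r<..} x \<partial>\<mu>)"
      by (intro nn_integral_cong) (auto split: split_indicator)
    also have "\<dots> = indicator {0<..L} r * emeasure \<mu> {r<..}"
      by (subst nn_integral_cmult) auto
    finally show "(\<integral>\<^sup>+x. ?g (r, x) \<partial>\<mu>) = indicator {0<..L} r * ennreal (1 - F r)"
      by (simp add: \<mu>.emeasure_eq_measure tail_measure)
  qed
  finally show ?thesis .
qed

text \<open>After \<open>r = L * u\<close> the uniform tail bound leaves the integral of
  \<open>u powr (- b1) + u powr (- b2)\<close> over \<open>{0<..1}\<close>, which is finite because
  both exponents are below 1.\<close>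

lemma expectation_min_bound:
  "\<exists>C>0. \<exists>L0\<ge>1. \<forall>L\<ge>L0. 0 < B L \<and> (LINT x|\<mu>. min (max 0 x) L) \<le> C * L / B L"
proof -
  obtain C L0 where C: "0 < C" "1 \<le> L0" "\<And>L. L0 \<le> L \<Longrightarrow> 0 < B L"
    and T: "\<And>L r. L0 \<le> L \<Longrightarrow> 0 < r \<Longrightarrow> 1 - F (L * r) \<le> C / B L * (r powr (- b1) + r powr (- b2))"
    using tail_upper by metis
  let ?g = "\<lambda>u::real. indicator {0<..1} u *\<^sub>R u powr (- b1) + indicator {0<..1} u *\<^sub>R u powr (- b2)"
  have gi: "integrable lborel ?g"
    using set_integrable_powr_0[of b1 1] set_integrable_powr_0[of b2 1] b12
    unfolding set_integrable_def by (intro Bochner_Integration.integrable_add) auto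
  define K where "K = (LBINT u. ?g u)"
  have K: "0 \<le> K" unfolding K_def by (intro integral_nonneg_AE AE_I2) (auto split: split_indicator)
  have "(LINT x|\<mu>. min (max 0 x) L) \<le> C * (K + 1) * L / B L" if L: "L0 \<le> L" for L
  proof -
    have L0: "0 < L" using L C by linarith
    have BL: "0 < B L" using C L by auto
    have "ennreal (LINT x|\<mu>. min (max 0 x) L) = (\<integral>\<^sup>+r. indicator {0<..L} r * ennreal (1 - F r) \<partial>lborel)"
      by (rule expectation_min[OF L0])
    also have "\<dots> = ennreal L * (\<integral>\<^sup>+u. indicator {0<..L} (0 + L * u) * ennreal (1 - F (0 + L * u)) \<partial>lborel)"
    proof -
      have [measurable]: "F \<in> borel_measurable borel" using F_mono by (rule borel_measurable_mono)
      show ?thesis using L0 by (subst nn_integral_real_affine[of _ L 0]) auto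
    qed
    also have "\<dots> \<le> ennreal L * (\<integral>\<^sup>+u. ennreal (C / B L * ?g u) \<partial>lborel)"
    proof (intro mult_left_mono nn_integral_mono)
      fix u :: real
      show "indicator {0<..L} (0 + L * u) * ennreal (1 - F (0 + L * u)) \<le> ennreal (C / B L * ?g u)"
        using T[OF L, of u] L0 by (auto split: split_indicator simp: zero_less_mult_iff intro!: ennreal_leI)
    qed auto
    also have "(\<integral>\<^sup>+u. ennreal (C / B L * ?g u) \<partial>lborel) = ennreal (C / B L * K)"
      unfolding K_def using gi C BL
      by (subst nn_integral_eq_integral) (auto intro!: AE_I2 mult_nonneg_nonneg split: split_indicator)
    also have "ennreal L * ennreal (C / B L * K) = ennreal (L * (C / B L * K))"
      using L0 by (intro ennreal_mult''[symmetric]) (use C BL K in auto)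
    finally have "(LINT x|\<mu>. min (max 0 x) L) \<le> L * (C / B L * K)"
      using L0 C BL K by (subst (asm) ennreal_le_iff) auto
    also have "\<dots> \<le> C * (K + 1) * L / B L" using L0 C BL by (simp add: field_simps)
    finally show ?thesis .
  qed
  then show ?thesis using C K by (intro exI[of _ "C * (K + 1)"] conjI exI[of _ L0]) auto
qed

text \<open>For \<open>x \<ge> 0\<close> both \<open>\<bar>d\<bar> * x\<close> and 2 bound
  \<open>\<bar>iexp (d * x) - 1\<bar>\<close>; the first is used for \<open>x \<le> L\<close>, the
  second beyond. The free scale \<open>L\<close> is matched to \<open>1 / d\<close> later.\<close>

lemma char_increment:
  assumes L: "0 < L"
  shows "cmod (\<phi> (t + d) - \<phi> t) \<le> (2 + \<bar>d\<bar> * L) * ((LINT x|\<mu>. min (max 0 x) L) / L)"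
proof -
  have i: "integrable \<mu> (\<lambda>x. min (max 0 x) L)"
    by (rule \<mu>.integrable_const_bound[of _ L]) (use L in auto)
  have ii: "complex_integrable \<mu> (\<lambda>x. iexp (s * x))" for s
    by (rule \<mu>.integrable_iexp) auto
  have "\<phi> (t + d) - \<phi> t = (CLINT x|\<mu>. iexp ((t + d) * x) - iexp (t * x))"
    unfolding char_def by (rule Bochner_Integration.integral_diff[symmetric, OF ii ii])
  also have "cmod \<dots> \<le> (LINT x|\<mu>. cmod (iexp ((t + d) * x) - iexp (t * x)))" by (rule integral_norm_bound)
  also have "\<dots> \<le> (LINT x|\<mu>. (2 + \<bar>d\<bar> * L) / L * min (max 0 x) L)"
  proof (rule integral_mono_AE)
    show "integrable \<mu> (\<lambda>x. cmod (iexp ((t + d) * x) - iexp (t * x)))"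
      by (intro integrable_norm Bochner_Integration.integrable_diff ii)
    show "integrable \<mu> (\<lambda>x. (2 + \<bar>d\<bar> * L) / L * min (max 0 x) L)" by (intro integrable_mult_right i)
    show "AE x in \<mu>. cmod (iexp ((t + d) * x) - iexp (t * x)) \<le> (2 + \<bar>d\<bar> * L) / L * min (max 0 x) L"
      using AE_\<mu>_nonneg
    proof eventually_elim
      case (elim x)
      have "iexp ((t + d) * x) - iexp (t * x) = iexp (t * x) * (iexp (d * x) - 1)"
        by (simp add: exp_add[symmetric] algebra_simps)
      then have eq: "cmod (iexp ((t + d) * x) - iexp (t * x)) = cmod (iexp (d * x) - 1)"
        by (simp add: norm_mult del: of_real_mult)
      have b1: "cmod (iexp (d * x) - 1) \<le> \<bar>d * x\<bar>" using iexp_approx1[of "d * x" 0] by simp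
      have b2: "cmod (iexp (d * x) - 1) \<le> 2" using norm_triangle_ineq4[of "iexp (d * x)" 1] by simp
      show ?case
      proof (cases "x \<le> L")
        case True
        have "\<bar>d * x\<bar> \<le> (2 + \<bar>d\<bar> * L) / L * x"
          using elim L by (simp add: abs_mult field_simps)
        then show ?thesis using b1 eq True elim by simp
      next
        case False
        have "0 \<le> \<bar>d\<bar> * L" "(2 + \<bar>d\<bar> * L) / L * L = 2 + \<bar>d\<bar> * L" using L by simp_all
        moreover have "min (max 0 x) L = L" using False elim by simp
        ultimately show ?thesis using b2 unfolding eq by simp
      qed
    qed
  qed
  also have "\<dots> = (2 + \<bar>d\<bar> * L) / L * (LINT x|\<mu>. min (max 0 x) L)" by simp
  finally show ?thesis by simp
qed

lemma char_increment_bound: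
  "\<exists>C>0. \<exists>L0\<ge>1. \<forall>L\<ge>L0. 0 < B L \<and> (\<forall>t d. cmod (\<phi> (t + d) - \<phi> t) \<le> (2 + \<bar>d\<bar> * L) * (C / B L))"
proof -
  obtain C L0 where C: "0 < C" "1 \<le> L0" "\<And>L. L0 \<le> L \<Longrightarrow> 0 < B L"
    and T: "\<And>L. L0 \<le> L \<Longrightarrow> (LINT x|\<mu>. min (max 0 x) L) \<le> C * L / B L"
    using expectation_min_bound by metis
  have "cmod (\<phi> (t + d) - \<phi> t) \<le> (2 + \<bar>d\<bar> * L) * (C / B L)" if L: "L0 \<le> L" for L t d
  proof -
    have L0: "0 < L" using L C by linarith
    have "(LINT x|\<mu>. min (max 0 x) L) / L \<le> C / B L"
      using T[OF L] L0 by (simp add: field_simps)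
    then have "(2 + \<bar>d\<bar> * L) * ((LINT x|\<mu>. min (max 0 x) L) / L) \<le> (2 + \<bar>d\<bar> * L) * (C / B L)"
      using L0 by (intro mult_left_mono) auto
    then show ?thesis using char_increment[OF L0, of t d] by linarith
  qed
  then show ?thesis using C by blast
qed

section \<open>Decay of the modulus of \<phi>\<close>

text \<open>Only steps between \<open>L * e\<close> and \<open>L * pi\<close> are kept. There
  \<open>1 - cos (x / L)\<close> is at least \<open>1 - cos e\<close>, and the mass of this window
  is at least \<open>1 / B L\<close> once \<open>e\<close> is small.\<close>

lemma Re_char_lower:
  "\<exists>C>0. \<exists>L0\<ge>1. \<forall>L\<ge>L0. 0 < B L \<and> (\<forall>t. \<bar>t\<bar> = 1 / L \<longrightarrow> C / B L \<le> 1 - Re (\<phi> t))"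
proof -
  obtain C L0 where C: "0 < C" "1 \<le> L0" "\<And>L. L0 \<le> L \<Longrightarrow> 0 < B L"
    and T: "\<And>L r. L0 \<le> L \<Longrightarrow> 0 < r \<Longrightarrow> 1 - F (L * r) \<le> C / B L * (r powr (- b1) + r powr (- b2))"
    using tail_upper by metis
  obtain D x0 where D: "0 < D" "1 \<le> x0"
    and T': "\<And>L r. x0 \<le> L \<Longrightarrow> x0 \<le> L * r \<Longrightarrow> r \<le> 1 \<Longrightarrow> r powr (- b1) \<le> D * B L * (1 - F (L * r))"
    using tail_lower by metis
  \<comment> \<open>With \<open>e powr (- b1) \<ge> q\<close>, the tail at \<open>L * e\<close> is
    at least \<open>(2 * C + 1) / B L\<close>, while the tail at \<open>L * pi\<close> is at most
    \<open>2 * C / B L\<close>.\<close>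
  define q where "q = D * (2 * C + 1)"
  have q: "0 < q" using C D by (simp add: q_def)
  define e where "e = min 1 (q powr (- (1 / b1)))"
  have e: "0 < e" "e \<le> 1" using q by (auto simp: e_def)
  have eq: "q \<le> e powr (- b1)"
  proof -
    have "(q powr (- (1 / b1))) powr (- b1) = q" using q b12 by (simp add: powr_powr)
    moreover have "(q powr (- (1 / b1))) powr (- b1) \<le> e powr (- b1)"
      using e b12 by (intro powr_mono2') (auto simp: e_def)
    ultimately show ?thesis by simp
  qed
  have cos_e: "cos e < 1"
    using cos_monotone_0_pi[of 0 e] e pi_gt3 by simp
  have main: "(1 - cos e) / B L \<le> 1 - Re (\<phi> t)" if L: "max L0 (x0 / e) \<le> L" and t: "\<bar>t\<bar> = 1 / L" for L t
  proof -
    have LL: "L0 \<le> L" "x0 / e \<le> L" "0 < L" using L C by auto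
    then have x0e: "x0 \<le> L * e" using e by (simp add: field_simps)
    have "L * e \<le> L" using e LL by (simp add: mult_left_le)
    then have x0L: "x0 \<le> L" using x0e by linarith
    have BL: "0 < B L" using C LL by auto
    have one: "cos (t * x) = cos (x / L)" for x
    proof -
      have "cos (t * x) = cos \<bar>t * x\<bar>" by simp
      also have "\<bar>t * x\<bar> = \<bar>x / L\<bar>" using t LL by (simp add: abs_mult)
      finally show ?thesis by (simp only: cos_abs_real)
    qed
    have ii: "complex_integrable \<mu> (\<lambda>x. iexp (s * x))" for s by (rule \<mu>.integrable_iexp) auto
    have ci: "integrable \<mu> (\<lambda>x. cos (x / L))" by (rule \<mu>.integrable_const_bound[of _ 1]) auto
    have "Re (\<phi> t) = (LINT x|\<mu>. Re (iexp (t * x)))" unfolding char_def by (simp only: integral_Re[OF ii])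
    also have "\<dots> = (LINT x|\<mu>. cos (x / L))" by (simp add: Re_exp one flip: of_real_mult)
    finally have "1 - Re (\<phi> t) = (LINT x|\<mu>. 1 - cos (x / L))" using ci \<mu>.prob_space by simp
    moreover have "(LINT x|\<mu>. indicator {L * e<..L * pi} x *\<^sub>R (1 - cos e)) \<le> (LINT x|\<mu>. 1 - cos (x / L))"
    proof (rule integral_mono)
      show "integrable \<mu> (\<lambda>x. indicator {L * e<..L * pi} x *\<^sub>R (1 - cos e))"
        by (intro integrable_scaleR_left) (auto intro!: integrable_real_indicator simp: less_top[symmetric])
      show "integrable \<mu> (\<lambda>x. 1 - cos (x / L))" using ci by simp
      fix x
      show "indicator {L * e<..L * pi} x *\<^sub>R (1 - cos e) \<le> 1 - cos (x / L)"
      proof (cases "x \<in> {L * e<..L * pi}")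
        case True
        then have "e \<le> x / L" "x / L \<le> pi" using LL by (auto simp: field_simps)
        then have "cos (x / L) \<le> cos e" using e by (intro cos_monotone_0_pi_le) auto
        then show ?thesis using True by simp
      qed simp
    qed
    moreover have "(LINT x|\<mu>. indicator {L * e<..L * pi} x *\<^sub>R (1 - cos e)) = measure \<mu> {L * e<..L * pi} * (1 - cos e)"
      by (subst integral_scaleR_left) (auto intro!: integrable_real_indicator simp: less_top[symmetric])
    moreover have "1 / B L \<le> measure \<mu> {L * e<..L * pi}"
    proof -
      have "measure \<mu> {L * e<..L * pi} = F (L * pi) - F (L * e)"
        unfolding F_\<mu> using LL e pi_gt3 by (subst \<mu>.cdf_diff_eq) auto
      moreover have "1 - F (L * pi) \<le> C / B L * (pi powr (- b1) + pi powr (- b2))" using T LL by auto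
      moreover have "C / B L * (pi powr (- b1) + pi powr (- b2)) \<le> C / B L * (1 + 1)"
      proof (intro mult_left_mono add_mono)
        have "1 \<le> pi powr b1" "1 \<le> pi powr b2" using pi_gt3 b12 by (auto intro!: ge_one_powr_ge_zero)
        then show "pi powr (- b1) \<le> 1" "pi powr (- b2) \<le> 1" by (auto simp: powr_minus_divide)
      qed (use C BL in auto)
      moreover have "q \<le> D * B L * (1 - F (L * e))" using T'[OF x0L x0e e(2)] eq by linarith
      then have "2 * C + 1 \<le> B L * (1 - F (L * e))" using D by (simp add: q_def mult.assoc)
      then have "(2 * C + 1) / B L \<le> 1 - F (L * e)" using BL by (simp add: field_simps)
      moreover have "(2 * C + 1) / B L = C / B L * (1 + 1) + 1 / B L" by (simp add: add_divide_distrib)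
      ultimately show ?thesis by linarith
    qed
    then have "1 / B L * (1 - cos e) \<le> measure \<mu> {L * e<..L * pi} * (1 - cos e)"
      using cos_e by (intro mult_right_mono) auto
    ultimately show ?thesis by simp
  qed
  have "0 < B L \<and> (\<forall>t. \<bar>t\<bar> = 1 / L \<longrightarrow> (1 - cos e) / B L \<le> 1 - Re (\<phi> t))" if "max L0 (x0 / e) \<le> L" for L
    using main[OF that] C that by auto
  moreover have "1 \<le> max L0 (x0 / e)" using C by auto
  ultimately show ?thesis using cos_e by (intro exI[of _ "1 - cos e"] conjI exI[of _ "max L0 (x0 / e)"]) auto
qed

text \<open>For \<open>w = \<phi> t - 1\<close> the squared modulus is
  \<open>1 + 2 * Re w + \<bar>w\<bar>\<^sup>2\<close>. The linear term is at most
  \<open>- 2 * C / B L\<close>; the quadratic one is of order \<open>1 / (B L)\<^sup>2\<close> and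
  takes back at most half of it as soon as \<open>B L\<close> is large.\<close>

lemma norm_char_small:
  "\<exists>C>0. \<exists>L0\<ge>1. \<forall>L\<ge>L0. \<forall>t. \<bar>t\<bar> = 1 / L \<longrightarrow> cmod (\<phi> t) \<le> exp (- (C / B L))"
proof -
  obtain C L0 where C: "0 < C" "1 \<le> L0" "\<And>L. L0 \<le> L \<Longrightarrow> 0 < B L"
    and T: "\<And>L t. L0 \<le> L \<Longrightarrow> \<bar>t\<bar> = 1 / L \<Longrightarrow> C / B L \<le> 1 - Re (\<phi> t)"
    using Re_char_lower by metis
  obtain D L1 where D: "0 < D" "1 \<le> L1"
    and T': "\<And>L t d. L1 \<le> L \<Longrightarrow> cmod (\<phi> (t + d) - \<phi> t) \<le> (2 + \<bar>d\<bar> * L) * (D / B L)"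
    using char_increment_bound by metis
  have "\<forall>\<^sub>F L in at_top. (3 * D)\<^sup>2 / C \<le> B L" using B_at_top by (auto simp: filterlim_at_top)
  then obtain L2 where L2: "\<And>L. L2 \<le> L \<Longrightarrow> (3 * D)\<^sup>2 / C \<le> B L" by (auto simp: eventually_at_top_linorder)
  have "cmod (\<phi> t) \<le> exp (- ((C / 2) / B L))" if L: "max L0 (max L1 L2) \<le> L" and t: "\<bar>t\<bar> = 1 / L" for L t
  proof -
    have LL: "L0 \<le> L" "L1 \<le> L" "L2 \<le> L" "0 < L" using L C by auto
    have BL: "0 < B L" using C LL by auto
    define w where "w = \<phi> t - 1"
    have phi: "\<phi> t = 1 + w" by (simp add: w_def)
    have w1: "cmod w \<le> 3 * D / B L"
      using T'[OF LL(2), of 0 t] t LL by (simp add: w_def \<mu>.char_zero)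
    have w2: "C / B L \<le> - Re w" using T[OF LL(1) t] by (simp add: w_def)
    have "(cmod (\<phi> t))\<^sup>2 = 1 + 2 * Re w + (cmod w)\<^sup>2"
      unfolding phi by (simp only: cmod_power2) (simp add: power2_eq_square algebra_simps)
    also have "\<dots> \<le> 1 - 2 * (C / B L) + (3 * D / B L)\<^sup>2"
      using w1 w2 by (intro add_mono power_mono) auto
    also have "(3 * D / B L)\<^sup>2 \<le> C / B L"
    proof -
      have "(3 * D)\<^sup>2 \<le> C * B L" using L2[OF LL(3)] C by (simp add: field_simps)
      then have "(3 * D)\<^sup>2 / (B L)\<^sup>2 \<le> C * B L / (B L)\<^sup>2" by (intro divide_right_mono) auto
      also have "\<dots> = C / B L" using BL by (simp add: power2_eq_square)
      finally show ?thesis by (simp add: power_divide)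
    qed
    also have "1 - 2 * (C / B L) + C / B L \<le> exp (- (C / B L))"
      using exp_ge_add_one_self[of "- (C / B L)"] by simp
    also have "\<dots> = (exp (- ((C / 2) / B L)))\<^sup>2" by (simp add: power2_eq_square exp_add[symmetric] add_divide_distrib[symmetric])
    finally show ?thesis by (simp add: power2_le_iff_abs_le abs_le_square_iff[symmetric])
  qed
  then show ?thesis using C by (intro exI[of _ "C / 2"] conjI exI[of _ "max L0 (max L1 L2)"]) auto
qed

text \<open>Modulus 1 forces \<open>cos (t * x - \<theta>) = 1\<close> almost surely, which
  concentrates the step on a lattice of mesh \<open>2 * pi / \<bar>t\<bar>\<close>. As 4 < 2 pi,
  this mesh is larger than the span.\<close>

lemma norm_char_less_1:
  assumes t: "t \<noteq> 0" "\<bar>t\<bar> \<le> 4"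
  shows "cmod (\<phi> t) < 1"
proof (rule ccontr)
  assume "\<not> ?thesis"
  then have one: "cmod (\<phi> t) = 1" using \<mu>.cmod_char_le_1[of t] by simp
  define \<theta> where "\<theta> = Arg (\<phi> t)"
  have th: "\<phi> t = iexp \<theta>" using rcis_cmod_Arg[of "\<phi> t"] by (simp add: rcis_def cis_conv_exp one \<theta>_def)
  have ii: "complex_integrable \<mu> (\<lambda>x. iexp (s * x))" for s by (rule \<mu>.integrable_iexp) auto
  have ci: "integrable \<mu> (\<lambda>x. cos (t * x - \<theta>))" by (rule \<mu>.integrable_const_bound[of _ 1]) auto
  have "(CLINT x|\<mu>. iexp (- \<theta>) * iexp (t * x)) = iexp (- \<theta>) * \<phi> t"
    unfolding char_def by (rule integral_mult_right_zero)
  also have "\<dots> = 1" unfolding th by (simp add: exp_add[symmetric])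
  finally have "Re (CLINT x|\<mu>. iexp (- \<theta>) * iexp (t * x)) = 1" by simp
  moreover have "Re (CLINT x|\<mu>. iexp (- \<theta>) * iexp (t * x)) = (LINT x|\<mu>. Re (iexp (- \<theta>) * iexp (t * x)))"
    by (rule integral_Re[symmetric]) (intro integrable_mult_right ii)
  moreover have "Re (iexp (- \<theta>) * iexp (t * x)) = cos (t * x - \<theta>)" for x
    by (simp add: exp_add[symmetric] Re_exp algebra_simps cos_diff sin_diff)
  ultimately have "(LINT x|\<mu>. 1 - cos (t * x - \<theta>)) = 0" using ci \<mu>.prob_space by simp
  then have "AE x in \<mu>. 1 - cos (t * x - \<theta>) = 0"
    using ci by (subst (asm) integral_nonneg_eq_0_iff_AE) auto
  then have "AE \<omega> in P. 1 - cos (t * real (X 0 \<omega>) - \<theta>) = 0"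
    unfolding \<mu>_def by (subst (asm) AE_distr_iff) auto
  then have "AE \<omega> in P. \<exists>j::int. real (X 0 \<omega>) = \<theta> / t + (2 * pi / \<bar>t\<bar>) * of_int j"
  proof eventually_elim
    case (elim \<omega>)
    then have "cos (t * real (X 0 \<omega>) - \<theta>) = 1" by simp
    then obtain j :: int where "t * real (X 0 \<omega>) - \<theta> = of_int j * 2 * pi" using cos_one_2pi_int by blast
    then have "real (X 0 \<omega>) = \<theta> / t + (2 * pi / t) * of_int j" using t by (simp add: field_simps)
    also have "\<dots> = \<theta> / t + (2 * pi / \<bar>t\<bar>) * of_int (if 0 < t then j else - j)" by (simp add: abs_if)
    finally show ?case by blast
  qed
  then have "concentrated_on_lattice P (\<lambda>\<omega>. real (X 0 \<omega>)) (\<theta> / t) (2 * pi / \<bar>t\<bar>)"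
    by (simp add: concentrated_on_lattice_def)
  moreover have "0 < 2 * pi / \<bar>t\<bar>" using t by simp
  ultimately have "2 * pi / \<bar>t\<bar> \<le> 1" using span unfolding has_span_def by blast
  then have "2 * pi \<le> \<bar>t\<bar>" using t by (simp add: field_simps)
  then show False using t pi_gt3 by linarith
qed

text \<open>Up to a constant, a lower bound for \<open>B L / B (L / \<bar>s\<bar>)\<close> obtained
  from Potter's bounds: \<open>b2\<close> is active for \<open>\<bar>s\<bar> \<le> 1\<close>,
  \<open>b1\<close> for larger \<open>\<bar>s\<bar>\<close>.\<close>

definition \<kappa> :: "real \<Rightarrow> real" where "\<kappa> s = min (\<bar>s\<bar> powr b1) (\<bar>s\<bar> powr b2)"

lemma \<kappa>_nonneg: "0 \<le> \<kappa> s" by (simp add: \<kappa>_def)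

text \<open>Near 0, \<open>norm_char_small\<close> is used at the scale
  \<open>L / \<bar>s\<bar>\<close>. On the remaining compact part of \<open>{-4..4}\<close> the
  modulus is at most some \<rho> < 1, and the bound \<open>C1\<close> on
  \<open>\<kappa> s / B L\<close> lets \<rho> be written in the same exponential form.
  \<open>C1\<close> is exported because it also pays for one lost factor in a power of
  \<phi>.\<close>

lemma norm_char_bound:
  "\<exists>C0>0. \<exists>C1>0. \<exists>L0\<ge>1. \<forall>L\<ge>L0. 0 < B L \<and>
     (\<forall>s. \<bar>s\<bar> \<le> 4 * L \<longrightarrow> cmod (\<phi> (s / L)) \<le> exp (- (C0 * \<kappa> s / B L)) \<and> \<kappa> s / B L \<le> C1)"
proof -
  obtain C L0 where C: "0 < C" "1 \<le> L0"
    and small: "\<And>L t. L0 \<le> L \<Longrightarrow> \<bar>t\<bar> = 1 / L \<Longrightarrow> cmod (\<phi> t) \<le> exp (- (C / B L))"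
    using norm_char_small by metis
  obtain D x0 where D: "1 \<le> D" and x0: "1 \<le> x0" "\<And>x. x0 \<le> x \<Longrightarrow> 0 < B x"
    and Q: "\<And>r s. x0 \<le> r \<Longrightarrow> r \<le> s \<Longrightarrow> (s / r) powr b1 * B r \<le> D * B s"
      "\<And>r s. x0 \<le> r \<Longrightarrow> r \<le> s \<Longrightarrow> B s \<le> D * (s / r) powr b2 * B r"
    using B_potter by metis
  define y where "y = max L0 x0"
  have y: "1 \<le> y" "L0 \<le> y" "x0 \<le> y" using x0 by (auto simp: y_def)
  define t0 where "t0 = 1 / y"
  have t0: "0 < t0" "t0 \<le> 1" using y by (auto simp: t0_def)
  have "compact ({-4..-t0} \<union> {t0..4})" by (intro compact_Un compact_Icc)
  moreover have "{-4..-t0} \<union> {t0..4} \<noteq> {}" using t0 by auto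
  moreover have "continuous_on ({-4..-t0} \<union> {t0..4}) (\<lambda>t. cmod (\<phi> t))"
    by (intro continuous_on_norm continuous_at_imp_continuous_on ballI \<mu>.isCont_char)
  ultimately obtain s0 where s0: "s0 \<in> {-4..-t0} \<union> {t0..4}"
    and max: "\<And>t. t \<in> {-4..-t0} \<union> {t0..4} \<Longrightarrow> cmod (\<phi> t) \<le> cmod (\<phi> s0)"
    using continuous_attains_sup by meson
  have "cmod (\<phi> s0) < 1" using s0 t0 by (intro norm_char_less_1) auto
  \<comment> \<open>The 1/2 keeps \<rho> positive, so that \<open>ln \<rho>\<close> can be
    used.\<close>
  define \<rho> where "\<rho> = max (1 / 2) (cmod (\<phi> s0))"
  have rho: "0 < \<rho>" "\<rho> < 1" "cmod (\<phi> s0) \<le> \<rho>" using \<open>cmod (\<phi> s0) < 1\<close> by (auto simp: \<rho>_def)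
  \<comment> \<open>For \<open>\<bar>s\<bar> \<le> 4 * L\<close>, \<open>\<kappa> s\<close> is at
    most \<open>(4 * L) powr b1\<close>; Potter's bound from \<open>x0\<close> to \<open>L\<close>
    compares this with \<open>B L\<close>.\<close>
  define C1 where "C1 = (4 * x0) powr b1 * D / B x0"
  have C1: "0 < C1" using x0 D by (simp add: C1_def)
  define C0 where "C0 = min (C / D) (- ln \<rho> / C1)"
  have "ln \<rho> < 0" using rho by simp
  then have C0: "0 < C0" using C D C1 by (simp add: C0_def divide_neg_pos)
  have "0 < B L \<and> (\<forall>s. \<bar>s\<bar> \<le> 4 * L \<longrightarrow> cmod (\<phi> (s / L)) \<le> exp (- (C0 * \<kappa> s / B L)) \<and> \<kappa> s / B L \<le> C1)" if L: "y \<le> L" for L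
  proof (intro conjI allI impI)
    show BL: "0 < B L" using x0 y L by auto
    have Lpos: "0 < L" using L y by linarith
    fix s assume s: "\<bar>s\<bar> \<le> 4 * L"
    show kC1: "\<kappa> s / B L \<le> C1"
    proof -
      have "\<kappa> s \<le> \<bar>s\<bar> powr b1" by (simp add: \<kappa>_def)
      also have "\<dots> \<le> (4 * L) powr b1" using s b12 by (intro powr_mono2) auto
      also have "\<dots> = (4 * x0) powr b1 * (L / x0) powr b1"
        using Lpos x0 by (simp add: powr_mult[symmetric])
      also have "\<dots> \<le> (4 * x0) powr b1 * (D * B L / B x0)"
      proof (intro mult_left_mono)
        show "(L / x0) powr b1 \<le> D * B L / B x0"
          using Q(1)[of x0 L] y L x0 by (simp add: field_simps)
      qed auto
      finally show ?thesis using BL by (simp add: C1_def field_simps)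
    qed
    show "cmod (\<phi> (s / L)) \<le> exp (- (C0 * \<kappa> s / B L))"
    proof (cases "s = 0")
      case True
      then show ?thesis using b12 by (simp add: \<kappa>_def \<mu>.char_zero)
    next
      case s0': False
      show ?thesis
      proof (cases "\<bar>s / L\<bar> \<le> t0")
        case True
        define R where "R = L / \<bar>s\<bar>"
        have R: "y \<le> R" using True s0' Lpos y by (simp add: R_def t0_def field_simps)
        have BR: "0 < B R" using R y x0 by auto
        have "\<kappa> s * B R \<le> D * B L"
        proof (cases "\<bar>s\<bar> \<le> 1")
          case le1: True
          have "L \<le> R" using le1 Lpos s0' by (simp add: R_def field_simps)
          then have "B R \<le> D * (R / L) powr b2 * B L" using L y by (intro Q) auto
          also have "R / L = 1 / \<bar>s\<bar>" using Lpos by (simp add: R_def)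
          finally have "\<bar>s\<bar> powr b2 * B R \<le> \<bar>s\<bar> powr b2 * (D * (1 / \<bar>s\<bar>) powr b2 * B L)"
            by (intro mult_left_mono) auto
          also have "\<dots> = D * B L" using s0' by (simp add: powr_divide)
          finally have "\<bar>s\<bar> powr b2 * B R \<le> D * B L" .
          moreover have "\<kappa> s * B R \<le> \<bar>s\<bar> powr b2 * B R" using BR by (intro mult_right_mono) (auto simp: \<kappa>_def)
          ultimately show ?thesis by linarith
        next
          case False
          have "R \<le> L" using False Lpos s0' by (simp add: R_def field_simps)
          then have "(L / R) powr b1 * B R \<le> D * B L" using R y by (intro Q) auto
          also have "L / R = \<bar>s\<bar>" using Lpos s0' by (simp add: R_def)
          finally have "\<bar>s\<bar> powr b1 * B R \<le> D * B L" .
          moreover have "\<kappa> s * B R \<le> \<bar>s\<bar> powr b1 * B R" using BR by (intro mult_right_mono) (auto simp: \<kappa>_def)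
          ultimately show ?thesis by linarith
        qed
        then have "\<kappa> s / B L \<le> D / B R" using BL BR by (simp add: field_simps)
        then have "C0 * (\<kappa> s / B L) \<le> C / D * (D / B R)"
          using C0 \<kappa>_nonneg[of s] BL C D by (intro mult_mono) (auto simp: C0_def)
        then have "C0 * \<kappa> s / B L \<le> C / B R" using D by simp
        moreover have "cmod (\<phi> (s / L)) \<le> exp (- (C / B R))"
          using R y Lpos s0' by (intro small) (auto simp: R_def abs_divide)
        ultimately show ?thesis by (meson exp_le_cancel_iff neg_le_iff_le order.trans)
      next
        case False
        have "\<bar>s / L\<bar> \<le> 4" using s Lpos by (simp add: abs_divide field_simps)
        then have "s / L \<in> {-4..-t0} \<union> {t0..4}" using False by (auto simp: abs_if split: if_splits)
        then have "cmod (\<phi> (s / L)) \<le> \<rho>" using max rho by force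
        also have "\<rho> = exp (ln \<rho>)" using rho by simp
        also have "\<dots> \<le> exp (- (C0 * \<kappa> s / B L))"
        proof -
          have "C0 * (\<kappa> s / B L) \<le> - ln \<rho> / C1 * C1"
            using kC1 C0 C1 rho \<kappa>_nonneg[of s] BL by (intro mult_mono) (auto simp: C0_def)
          then show ?thesis using C1 by simp
        qed
        finally show ?thesis .
      qed
    qed
  qed
  then show ?thesis using C0 C1 y by (intro exI[of _ C0] conjI exI[of _ C1] exI[of _ y]) auto
qed

end

section \<open>Semistable Levy measures\<close>

context semistable_tail
begin

text \<open>The value 0 on the nonpositive axis is a default that yields a Borel function on the
  whole line.\<close>

definition levy_tail :: "real \<Rightarrow> real \<Rightarrow> real" where
  "levy_tail lam v = (if 0 < v then v powr (- \<alpha>) * M (lam powr (1 / \<alpha>) * v) else 0)"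

lemma levy_tail_eq_\<Theta>:
  assumes "0 < lam" "0 < v" shows "levy_tail lam v = lam * \<Theta> (lam powr (1 / \<alpha>) * v)"
  using assms alpha_pos by (simp add: levy_tail_def \<Theta>_def powr_mult powr_powr powr_minus)

lemma levy_tail_nonneg: "0 < lam \<Longrightarrow> 0 \<le> levy_tail lam v"
  using M_pos by (auto simp: levy_tail_def less_imp_le)

lemma \<Theta>_antimono: "0 < x \<Longrightarrow> x \<le> y \<Longrightarrow> \<Theta> y \<le> \<Theta> x"
  using M_mono by (auto simp: \<Theta>_def monotone_on_def)

lemma levy_tail_antimono: "0 < lam \<Longrightarrow> 0 < x \<Longrightarrow> x \<le> y \<Longrightarrow> levy_tail lam y \<le> levy_tail lam x"
  by (simp add: levy_tail_eq_\<Theta> \<Theta>_antimono)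

lemma levy_tail_measurable [measurable]:
  assumes "0 < lam" shows "levy_tail lam \<in> borel_measurable borel"
proof -
  have "mono_on {0<..} (\<lambda>v. - levy_tail lam v)"
    using levy_tail_antimono[OF assms] by (auto simp: monotone_on_def)
  then have "(\<lambda>v. - levy_tail lam v) \<in> borel_measurable (restrict_space borel {0<..})"
    by (rule borel_measurable_mono_on_fnc)
  then have "(\<lambda>v. indicator {0<..} v *\<^sub>R (- levy_tail lam v)) \<in> borel_measurable borel"
    by (subst (asm) borel_measurable_restrict_space_iff) auto
  moreover have "(\<lambda>v. indicator {0<..} v *\<^sub>R (- levy_tail lam v)) = (\<lambda>v. - levy_tail lam v)"
    by (auto simp: levy_tail_def split: split_indicator)
  ultimately have "(\<lambda>v. - levy_tail lam v) \<in> borel_measurable borel" by (simp only:)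
  then show ?thesis by simp
qed

lemma levy_tail_upper: "\<exists>K>0. \<forall>lam>0. \<forall>v>0. levy_tail lam v \<le> K * v powr (- \<alpha>)"
proof -
  obtain K where K: "\<And>x. 0 < x \<Longrightarrow> M x \<le> K" using M_bounded by auto
  have "levy_tail lam v \<le> max K 1 * v powr (- \<alpha>)" if "0 < lam" "0 < v" for lam v
    using that K[of "lam powr (1 / \<alpha>) * v"] by (auto simp: levy_tail_def mult.commute intro!: mult_right_mono)
  then show ?thesis by (intro exI[of _ "max K 1"]) auto
qed

lemma levy_tail_lower: "\<exists>m>0. \<forall>lam>0. \<forall>v>0. m * v powr (- \<alpha>) \<le> levy_tail lam v"
proof -
  obtain m where m: "0 < m" "\<And>x. 0 < x \<Longrightarrow> m \<le> M x" using M_bounded_away by auto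
  have "m * v powr (- \<alpha>) \<le> levy_tail lam v" if "0 < lam" "0 < v" for lam v
    using that m(2)[of "lam powr (1 / \<alpha>) * v"] by (auto simp: levy_tail_def mult.commute intro!: mult_right_mono)
  then show ?thesis using m by blast
qed

text \<open>The generalized inverse of the tail: it pushes Lebesgue measure on \<open>(0, \<infinity>)\<close> forward to the
  Levy measure.\<close>

definition levy_quantile :: "real \<Rightarrow> real \<Rightarrow> real" where
  "levy_quantile lam u = (if 0 < u then Inf {x. 0 < x \<and> levy_tail lam x \<le> u} else 0)"

text \<open>The Galois connection between the tail and its generalized inverse. From right to left
  it uses right-continuity of \<open>M\<close>: \<open>u < levy_tail lam x\<close> persists slightly
  to the right of \<open>x\<close>, which keeps the infimum strictly above \<open>x\<close>.\<close>

lemma less_levy_quantile: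
  assumes lam: "0 < lam" and x: "0 < x" and u: "0 < u"
  shows "x < levy_quantile lam u \<longleftrightarrow> u < levy_tail lam x"
proof -
  let ?Q = "{x. 0 < x \<and> levy_tail lam x \<le> u}"
  have bdd: "bdd_below ?Q" by (rule bdd_belowI[of _ 0]) auto
  have ne: "?Q \<noteq> {}"
  proof -
    obtain K where K: "0 < K" "\<And>v. 0 < v \<Longrightarrow> levy_tail lam v \<le> K * v powr (- \<alpha>)"
      using levy_tail_upper lam by metis
    have "((\<lambda>v. K * v powr (- \<alpha>)) \<longlongrightarrow> K * 0) at_top"
      using alpha_pos by (intro tendsto_intros tendsto_neg_powr filterlim_ident) auto
    then have "\<forall>\<^sub>F v in at_top. K * v powr (- \<alpha>) < u" by (rule order_tendstoD) (use u in auto)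
    with eventually_gt_at_top[of 0] have "\<forall>\<^sub>F v in at_top. 0 < v \<and> levy_tail lam v \<le> u"
      by eventually_elim (use K in fastforce)
    then show ?thesis by (auto dest: eventually_happens)
  qed
  show ?thesis
  proof
    assume "x < levy_quantile lam u"
    then have "x \<notin> ?Q" using cInf_lower[OF _ bdd, of x] u by (auto simp: levy_quantile_def)
    then show "u < levy_tail lam x" using x by auto
  next
    assume ux: "u < levy_tail lam x"
    have "continuous (at_right (lam powr (1 / \<alpha>) * x)) M" using lam x by (intro M_right_cont) auto
    then have lim: "(M \<longlongrightarrow> M (lam powr (1 / \<alpha>) * x)) (at_right (lam powr (1 / \<alpha>) * x))"
      by (simp add: continuous_within)
    have "filterlim (\<lambda>v. lam powr (1 / \<alpha>) * v) (at_right (lam powr (1 / \<alpha>) * x)) (at_right x)"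
      unfolding filterlim_at using lam
      by (auto intro!: tendsto_intros simp: eventually_at_filter)
    from filterlim_compose[OF lim this]
    have "((\<lambda>v. v powr (- \<alpha>) * M (lam powr (1 / \<alpha>) * v)) \<longlongrightarrow> x powr (- \<alpha>) * M (lam powr (1 / \<alpha>) * x)) (at_right x)"
      using x by (intro tendsto_intros) auto
    then have "\<forall>\<^sub>F v in at_right x. u < v powr (- \<alpha>) * M (lam powr (1 / \<alpha>) * v)"
      by (rule order_tendstoD) (use ux x in \<open>simp add: levy_tail_def\<close>)
    then obtain y where y: "x < y" "\<And>v. x < v \<Longrightarrow> v < y \<Longrightarrow> u < v powr (- \<alpha>) * M (lam powr (1 / \<alpha>) * v)"
      unfolding eventually_at_right_field by blast
    define w where "w = (x + y) / 2"
    have w: "x < w" "u < levy_tail lam w" using y(2)[of w] y(1) x by (auto simp: w_def levy_tail_def)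
    have "w \<le> Inf ?Q"
    proof (rule cInf_greatest[OF ne])
      fix z assume z: "z \<in> ?Q"
      show "w \<le> z"
      proof (rule ccontr)
        assume "\<not> w \<le> z"
        then show False using levy_tail_antimono[OF lam, of z w] z w by auto
      qed
    qed
    then show "x < levy_quantile lam u" using w u by (simp add: levy_quantile_def)
  qed
qed

text \<open>\<open>M\<close> is bounded away from 0, so the tail is unbounded at 0 and no positive
  \<open>u\<close> is sent to 0.\<close>

lemma levy_quantile_pos:
  assumes lam: "0 < lam" and u: "0 < u" shows "0 < levy_quantile lam u"
proof -
  obtain m where m: "0 < m" "\<And>v. 0 < v \<Longrightarrow> m * v powr (- \<alpha>) \<le> levy_tail lam v"
    using levy_tail_lower lam by metis
  define x where "x = (2 * u / m) powr (- (1 / \<alpha>))"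
  have x: "0 < x" using u m by (simp add: x_def)
  have "x powr (- \<alpha>) = 2 * u / m" using u m alpha_pos by (simp add: x_def powr_powr)
  then have "u < levy_tail lam x" using m(2)[OF x] m(1) u by simp
  then have "x < levy_quantile lam u" using less_levy_quantile[OF lam x u] by simp
  then show ?thesis using x by simp
qed

lemma levy_quantile_measurable [measurable]:
  assumes lam: "0 < lam" shows "levy_quantile lam \<in> borel_measurable borel"
  unfolding borel_measurable_iff_greater
proof
  fix a :: real
  consider "a < 0" | "a = 0" | "0 < a" by linarith
  then show "{w \<in> space borel. a < levy_quantile lam w} \<in> sets borel"
  proof cases
    case 1
    have "a < levy_quantile lam w" for w
      using levy_quantile_pos[OF lam, of w] 1 by (cases "0 < w") (auto simp: levy_quantile_def)
    then show ?thesis by simp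
  next
    case 2
    have "{w \<in> space borel. a < levy_quantile lam w} = {0<..}"
      using levy_quantile_pos[OF lam] 2 by (auto simp: levy_quantile_def split: if_splits)
    then show ?thesis by simp
  next
    case 3
    have "{w \<in> space borel. a < levy_quantile lam w} = {0<..<levy_tail lam a}"
      using less_levy_quantile[OF lam 3] 3 by (auto simp: levy_quantile_def split: if_splits)
    then show ?thesis by simp
  qed
qed

definition is_levy_measure :: "real \<Rightarrow> real measure \<Rightarrow> bool" where
  "is_levy_measure lam N \<longleftrightarrow> sets N = sets borel \<and> emeasure N {..0} = 0 \<and>
     (\<forall>x>0. emeasure N {x<..} = ennreal (x powr (- \<alpha>) * M (lam powr (1 / \<alpha>) * x)))"

lemma is_levy_measure_exists:
  assumes lam: "0 < lam"
  shows "is_levy_measure lam (distr (restrict_space lborel {0<..}) borel (levy_quantile lam))"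
proof -
  let ?R = "restrict_space lborel {0::real<..}"
  have [measurable]: "levy_quantile lam \<in> borel_measurable ?R"
    using lam by (intro measurable_restrict_space1) simp
  have em: "emeasure (distr ?R borel (levy_quantile lam)) A = emeasure lborel ({u. 0 < u \<and> levy_quantile lam u \<in> A})"
    if A: "A \<in> sets borel" for A
  proof -
    have "emeasure (distr ?R borel (levy_quantile lam)) A = emeasure ?R (levy_quantile lam -` A \<inter> space ?R)"
      using A by (intro emeasure_distr) auto
    also have "levy_quantile lam -` A \<inter> space ?R = {u. 0 < u \<and> levy_quantile lam u \<in> A}"
      by (auto simp: space_restrict_space)
    also have "emeasure ?R \<dots> = emeasure lborel {u. 0 < u \<and> levy_quantile lam u \<in> A}"
      by (intro emeasure_restrict_space) auto
    finally show ?thesis .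
  qed
  have 0: "{u. 0 < u \<and> levy_quantile lam u \<in> {..0}} = {}"
    using levy_quantile_pos[OF lam] not_le by auto
  have 1: "{u. 0 < u \<and> levy_quantile lam u \<in> {x<..}} = {0<..<levy_tail lam x}" if "0 < x" for x
    using less_levy_quantile[OF lam that] by auto
  have "emeasure (distr ?R borel (levy_quantile lam)) {x<..} = ennreal (x powr (- \<alpha>) * M (lam powr (1 / \<alpha>) * x))"
    if "0 < x" for x
  proof -
    have "emeasure (distr ?R borel (levy_quantile lam)) {x<..} = ennreal (levy_tail lam x)"
      unfolding em[OF borel_open[OF open_greaterThan]] 1[OF that] using levy_tail_nonneg[OF lam] by simp
    then show ?thesis using that by (simp add: levy_tail_def)
  qed
  moreover have "emeasure (distr ?R borel (levy_quantile lam)) {..0} = 0"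
    unfolding em[OF borel_closed[OF closed_atMost]] 0 by simp
  ultimately show ?thesis unfolding is_levy_measure_def by simp
qed

text \<open>The measure may be infinite near 0, so tails determine it only after restriction to
  \<open>{e n<..}\<close>, where it is finite. Letting \<open>e n\<close> decrease to 0 recovers it
  on the positive axis, and the complement is null.\<close>

lemma is_levy_measure_unique:
  assumes N1: "is_levy_measure lam N1" and N2: "is_levy_measure lam N2"
  shows "N1 = N2"
proof (rule measure_eqI)
  have s: "sets N = sets borel" "space N = UNIV" if "is_levy_measure lam N" for N
    using that sets_eq_imp_space_eq[of N borel] by (auto simp: is_levy_measure_def)
  show "sets N1 = sets N2" using s[OF N1] s[OF N2] by simp
  fix A assume "A \<in> sets N1"
  then have A: "A \<in> sets borel" using s[OF N1] by simp
  define e where "e n = 1 / real (Suc n)" for n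
  have e: "0 < e n" for n by (simp add: e_def)
  have eqn: "density N1 (indicator {e n<..}) = density N2 (indicator {e n<..})" for n
  proof (rule measure_eqI_lessThan)
    have em: "emeasure (density N (indicator {e n<..})) {x<..} = ennreal ((max x (e n)) powr (- \<alpha>) * M (lam powr (1 / \<alpha>) * max x (e n)))"
      if N: "is_levy_measure lam N" for N x
    proof -
      have "emeasure (density N (indicator {e n<..})) {x<..} = (\<integral>\<^sup>+y. indicator {e n<..} y * indicator {x<..} y \<partial>N)"
        using s[OF N] by (intro emeasure_density borel_measurable_indicator) auto
      also have "\<dots> = (\<integral>\<^sup>+y. indicator {max x (e n)<..} y \<partial>N)"
        by (intro nn_integral_cong) (auto split: split_indicator)
      also have "\<dots> = emeasure N {max x (e n)<..}" using s[OF N] by (intro nn_integral_indicator) auto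
      finally show ?thesis using N e[of n] by (auto simp: is_levy_measure_def less_max_iff_disj)
    qed
    show "emeasure (density N1 (indicator {e n<..})) {x<..} < \<infinity>" for x
      unfolding em[OF N1] by simp
    show "emeasure (density N1 (indicator {e n<..})) {x<..} = emeasure (density N2 (indicator {e n<..})) {x<..}" for x
      unfolding em[OF N1] em[OF N2] ..
  qed (use s[OF N1] s[OF N2] in auto)
  have lim: "(\<lambda>n. emeasure (density N (indicator {e n<..})) A) \<longlonglongrightarrow> emeasure N A" if N: "is_levy_measure lam N" for N
  proof -
    have "emeasure (density N (indicator {e n<..})) A = emeasure N ({e n<..} \<inter> A)" for n
    proof -
      have "emeasure (density N (indicator {e n<..})) A = (\<integral>\<^sup>+y. indicator {e n<..} y * indicator A y \<partial>N)"
        using s[OF N] A by (intro emeasure_density borel_measurable_indicator) auto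
      also have "\<dots> = (\<integral>\<^sup>+y. indicator ({e n<..} \<inter> A) y \<partial>N)"
        by (intro nn_integral_cong) (auto split: split_indicator)
      finally show ?thesis using s[OF N] A by simp
    qed
    moreover have "(\<lambda>n. emeasure N ({e n<..} \<inter> A)) \<longlonglongrightarrow> emeasure N (\<Union>n. {e n<..} \<inter> A)"
    proof (rule Lim_emeasure_incseq)
      show "range (\<lambda>n. {e n<..} \<inter> A) \<subseteq> sets N" using s[OF N] A by auto
      have "e n \<le> e m" if "m \<le> n" for m n using that by (simp add: e_def frac_le)
      then show "incseq (\<lambda>n. {e n<..} \<inter> A)" by (fastforce simp: incseq_def)
    qed
    moreover have "(\<Union>n. {e n<..} \<inter> A) = A - {..0}"
    proof -
      have "\<exists>n. e n < x" if "0 < x" for x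
        using reals_Archimedean[OF that] by (auto simp: inverse_eq_divide e_def)
      then have iff: "(\<exists>n. e n < x) = (0 < x)" for x using e less_trans by blast
      have "(\<Union>n. {e n<..} \<inter> A) = {x \<in> A. \<exists>n. e n < x}" by auto
      then show ?thesis unfolding iff by auto
    qed
    moreover have "emeasure N (A - {..0}) = emeasure N A"
      using N s[OF N] A by (intro emeasure_Diff_null_set) (auto simp: is_levy_measure_def null_sets_def)
    ultimately show ?thesis by simp
  qed
  show "emeasure N1 A = emeasure N2 A"
    using LIMSEQ_unique[OF lim[OF N1]] lim[OF N2] unfolding eqn by blast
qed

lemma levy_measure: "0 < lam \<Longrightarrow> is_levy_measure lam (levy_measure \<alpha> M lam)"
  unfolding levy_measure_def is_levy_measure_def[symmetric]
  using is_levy_measure_exists is_levy_measure_unique by (intro theI[of "is_levy_measure lam"]) auto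

definition \<Psi> :: "real \<Rightarrow> real \<Rightarrow> complex" where
  "\<Psi> lam t = (CLINT x:{0<..}|levy_measure \<alpha> M lam. iexp (t * x) - 1)"

lemma \<Psi>_truncation:
  assumes lam: "0 < lam" and R: "0 < R"
  shows "cmod (\<Psi> lam t - (CLBINT r:{0<..R}. \<i> * t * iexp (t * r) * levy_tail lam r)) \<le> 2 * levy_tail lam R"
  unfolding \<Psi>_def
proof (rule exponent_truncation(2))
  obtain K where K: "0 < K" "\<And>v. 0 < v \<Longrightarrow> levy_tail lam v \<le> K * v powr (- \<alpha>)"
    using levy_tail_upper lam by metis
  show "set_integrable lborel {0<..R} (levy_tail lam)"
    unfolding set_integrable_def
  proof (rule Bochner_Integration.integrable_bound)
    show "integrable lborel (\<lambda>v. K * (indicator {0<..R} v *\<^sub>R v powr (- \<alpha>)))"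
      using set_integrable_powr_0[of \<alpha> R] alpha R unfolding set_integrable_def by (intro integrable_mult_right) auto
    show "AE v in lborel. norm (indicator {0<..R} v *\<^sub>R levy_tail lam v) \<le> norm (K * (indicator {0<..R} v *\<^sub>R v powr (- \<alpha>)))"
      using K levy_tail_nonneg[OF lam] by (auto simp: abs_mult split: split_indicator)
  qed (use lam in simp)
  show "0 \<le> levy_tail lam r" if "0 < r" for r using levy_tail_nonneg[OF lam] .
qed (use levy_measure[OF lam] R in \<open>auto simp: is_levy_measure_def levy_tail_def\<close>)

end

section \<open>Convergence of characteristic functions\<close>

text \<open>Both \<open>z\<close> and \<open>exp (z - 1)\<close> lie in the unit disc, so the
  difference of their powers is at most \<open>m\<close> times their distance, which is quadratic in
  \<open>z - 1\<close>. The bound is small when \<open>m * (z - 1)\<close> is bounded and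
  \<open>z\<close> tends to 1.\<close>

lemma norm_power_diff_exp:
  fixes z :: complex
  assumes z: "cmod z \<le> 1"
  shows "cmod (z ^ m - exp (of_nat m * (z - 1))) \<le> exp 2 * (real m * cmod (z - 1)) * cmod (z - 1)"
proof -
  have "Re (z - 1) \<le> 0" using complex_Re_le_cmod[of z] z by simp
  then have "cmod (exp (z - 1)) \<le> 1" by simp
  then have "cmod (z ^ m - exp (z - 1) ^ m) \<le> real m * cmod (z - exp (z - 1))"
    using z by (intro norm_power_diff) auto
  also have "\<dots> \<le> real m * (exp 2 * (cmod (z - 1) * cmod (z - 1)))"
  proof (rule mult_left_mono)
    have "cmod (exp (z - 1) - (\<Sum>i\<le>1. (z - 1) ^ i / fact i)) \<le> exp (cmod (z - 1)) * (cmod (z - 1) ^ Suc 1) / fact 1"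
      by (rule Taylor_exp_field)
    moreover have "exp (z - 1) - (\<Sum>i\<le>1. (z - 1) ^ i / fact i) = - (z - exp (z - 1))" by simp
    ultimately have "cmod (z - exp (z - 1)) \<le> exp (cmod (z - 1)) * (cmod (z - 1) * cmod (z - 1))"
      by (simp add: norm_minus_commute power2_eq_square)
    also have "\<dots> \<le> exp 2 * (cmod (z - 1) * cmod (z - 1))"
      using norm_triangle_ineq4[of z 1] z by (intro mult_right_mono) auto
    finally show "cmod (z - exp (z - 1)) \<le> exp 2 * (cmod (z - 1) * cmod (z - 1))" .
  qed simp
  finally show ?thesis by (simp add: exp_of_nat_mult mult_ac)
qed

context semistable_renewal
begin

text \<open>\<open>exponent_truncation\<close> for the law of \<open>X / L\<close>. An atom at 0
  does no harm: the integrand \<open>iexp (t * x) - 1\<close> vanishes there, so restriction to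
  \<open>{0<..}\<close> leaves the integral unchanged.\<close>

lemma char_truncation:
  assumes L: "0 < L" and R: "0 < R"
  shows "cmod ((\<phi> (t / L) - 1) - (CLBINT r:{0<..R}. \<i> * t * iexp (t * r) * (1 - F (L * r)))) \<le> 2 * (1 - F (L * R))"
proof -
  define \<nu> where "\<nu> = distr \<mu> borel (\<lambda>x. x / L)"
  have [measurable]: "F \<in> borel_measurable borel" using F_mono by (rule borel_measurable_mono)
  interpret \<nu>: real_distribution \<nu> unfolding \<nu>_def by (rule \<mu>.real_distribution_distr) simp
  have nu: "emeasure \<nu> {r<..} = ennreal (1 - F (L * r))" for r
  proof -
    have "emeasure \<nu> {r<..} = emeasure \<mu> ((\<lambda>x. x / L) -` {r<..} \<inter> space \<mu>)"
      unfolding \<nu>_def by (intro emeasure_distr) auto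
    also have "(\<lambda>x. x / L) -` {r<..} \<inter> space \<mu> = {L * r<..}" using L by (auto simp: field_simps)
    finally show ?thesis by (simp add: \<mu>.emeasure_eq_measure tail_measure)
  qed
  have F01: "0 \<le> 1 - F x" "1 - F x \<le> 1" for x using F_le_1[of x] F_nonneg[of x] by auto
  have "cmod ((CLINT x:{0<..}|\<nu>. iexp (t * x) - 1) - (CLBINT r:{0<..R}. \<i> * t * iexp (t * r) * (1 - F (L * r)))) \<le> 2 * (1 - F (L * R))"
  proof (rule exponent_truncation(2))
    show "set_integrable lborel {0<..R} (\<lambda>r. 1 - F (L * r))"
      unfolding set_integrable_def
    proof (rule Bochner_Integration.integrable_bound)
      show "integrable lborel (indicator {0<..R} :: real \<Rightarrow> real)"
        by (intro integrable_real_indicator) (use R in auto)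
      show "AE r in lborel. norm (indicator {0<..R} r *\<^sub>R (1 - F (L * r))) \<le> norm (indicator {0<..R} r :: real)"
        using F01 by (auto split: split_indicator)
    qed simp
    show "emeasure \<nu> {..0} < \<infinity>" by (simp add: \<nu>.emeasure_eq_measure)
  qed (use nu F01 R in auto)
  moreover have "(CLINT x:{0<..}|\<nu>. iexp (t * x) - 1) = \<phi> (t / L) - 1"
  proof -
    have "AE x in \<nu>. 0 \<le> x" unfolding \<nu>_def using AE_\<mu>_nonneg L by (subst AE_distr_iff) auto
    then have "(CLINT x:{0<..}|\<nu>. iexp (t * x) - 1) = (CLINT x|\<nu>. iexp (t * x) - 1)"
      unfolding set_lebesgue_integral_def
      by (intro integral_cong_AE) (auto elim!: eventually_mono split: split_indicator)
    also have "\<dots> = (CLINT x|\<nu>. iexp (t * x)) - 1"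
      using \<nu>.prob_space by (subst Bochner_Integration.integral_diff) (auto intro!: \<nu>.integrable_iexp)
    also have "(CLINT x|\<nu>. iexp (t * x)) = \<phi> (t / L)"
      unfolding \<nu>_def char_def by (subst integral_distr) simp_all
    finally show ?thesis .
  qed
  ultimately show ?thesis by simp
qed

text \<open>Along such sequences the tails of \<open>S m / L\<close> scale to \<open>\<Lambda>\<^sub>\<lambda>\<close>, where \<open>\<lambda> = lim m / k\<close>.\<close>

definition scaling :: "real \<Rightarrow> (nat \<Rightarrow> nat) \<Rightarrow> (nat \<Rightarrow> nat) \<Rightarrow> (nat \<Rightarrow> real) \<Rightarrow> bool" where
  "scaling lam j m L \<longleftrightarrow> 0 < lam \<and> filterlim j at_top sequentially \<and>
     (\<lambda>i. real (m i) / real (k (j i))) \<longlonglongrightarrow> lam \<and>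
     (\<lambda>i. L i / A (real (k (j i)))) \<longlonglongrightarrow> lam powr (1 / \<alpha>)"

context
  fixes lam :: real and j m :: "nat \<Rightarrow> nat" and L :: "nat \<Rightarrow> real"
  assumes sc: "scaling lam j m L"
begin

lemma scaling_lam: "0 < lam" and scaling_j: "filterlim j at_top sequentially"
  and scaling_m: "(\<lambda>i. real (m i) / real (k (j i))) \<longlonglongrightarrow> lam"
  and scaling_L: "(\<lambda>i. L i / A (real (k (j i)))) \<longlonglongrightarrow> lam powr (1 / \<alpha>)"
  using sc by (auto simp: scaling_def)

lemma scaling_Aj: "filterlim (\<lambda>i. A (real (k (j i)))) at_top sequentially"
  by (rule filterlim_compose[OF Ak_top scaling_j])

lemma scaling_kj: "filterlim (\<lambda>i. real (k (j i))) at_top sequentially"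
  by (rule filterlim_compose[OF k_top scaling_j])

lemma scaling_L_top: "filterlim L at_top sequentially"
proof -
  have "filterlim (\<lambda>i. L i / A (real (k (j i))) * A (real (k (j i)))) at_top sequentially"
    using scaling_lam by (intro filterlim_tendsto_pos_mult_at_top[OF scaling_L _ scaling_Aj]) auto
  moreover have "\<forall>\<^sub>F i in sequentially. L i / A (real (k (j i))) * A (real (k (j i))) = L i"
    using eventually_gt_filterlim[OF scaling_Aj, where c=0] by eventually_elim auto
  ultimately show ?thesis by (simp add: filterlim_cong)
qed

lemma scaling_B: "(\<lambda>i. B (L i) / real (k (j i))) \<longlonglongrightarrow> lam"
proof -
  have "(\<lambda>i. B (L i) / B (A (real (k (j i)))) * (B (A (real (k (j i)))) / real (k (j i)))) \<longlonglongrightarrow> (lam powr (1 / \<alpha>)) powr \<alpha> * 1"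
    using scaling_lam
    by (intro tendsto_mult log_regular_ratio[OF B_regular scaling_Aj scaling_L] filterlim_compose[OF B_Ak scaling_j]) auto
  moreover have "(lam powr (1 / \<alpha>)) powr \<alpha> * 1 = lam" using scaling_lam alpha_pos by (simp add: powr_powr)
  moreover have "\<forall>\<^sub>F i in sequentially. B (L i) / B (A (real (k (j i)))) * (B (A (real (k (j i)))) / real (k (j i))) = B (L i) / real (k (j i))"
    using eventually_gt_filterlim[OF filterlim_compose[OF B_at_top scaling_Aj], where c=0]
    by eventually_elim auto
  ultimately show ?thesis using Lim_transform_eventually by fastforce
qed

lemma scaling_m_B: "(\<lambda>i. real (m i) / B (L i)) \<longlonglongrightarrow> 1"
proof -
  have "(\<lambda>i. (real (m i) / real (k (j i))) / (B (L i) / real (k (j i)))) \<longlonglongrightarrow> lam / lam"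
    using scaling_lam by (intro tendsto_divide scaling_m scaling_B) auto
  moreover have "\<forall>\<^sub>F i in sequentially. (real (m i) / real (k (j i))) / (B (L i) / real (k (j i))) = real (m i) / B (L i)"
    using eventually_gt_filterlim[OF scaling_kj, where c=0] by eventually_elim auto
  ultimately show ?thesis using scaling_lam Lim_transform_eventually by fastforce
qed

lemma scaling_tail_bound:
  "\<exists>C. \<forall>\<^sub>F i in sequentially. 0 < L i \<and> (\<forall>v>0. \<bar>real (m i) * (1 - F (L i * v))\<bar> \<le> C * (v powr (- b1) + v powr (- b2)))"
proof -
  obtain C L0 where C: "0 < C" "1 \<le> L0" "\<And>L. L0 \<le> L \<Longrightarrow> 0 < B L"
    and T: "\<And>L r. L0 \<le> L \<Longrightarrow> 0 < r \<Longrightarrow> 1 - F (L * r) \<le> C / B L * (r powr (- b1) + r powr (- b2))"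
    using tail_upper by metis
  have "\<forall>\<^sub>F i in sequentially. 0 < L i \<and> (\<forall>v>0. \<bar>real (m i) * (1 - F (L i * v))\<bar> \<le> 2 * C * (v powr (- b1) + v powr (- b2)))"
    using order_tendstoD(2)[OF scaling_m_B, of 2, simplified] eventually_ge_filterlim[OF scaling_L_top, where c=L0]
  proof eventually_elim
    case (elim i)
    have BL: "0 < B (L i)" using C elim by auto
    show ?case
    proof (intro conjI allI impI)
      show "0 < L i" using elim C by linarith
      fix v :: real assume v: "0 < v"
      have F0: "0 \<le> 1 - F (L i * v)" using F_le_1 by simp
      have "\<bar>real (m i) * (1 - F (L i * v))\<bar> = real (m i) * (1 - F (L i * v))" using F0 by simp
      also have "\<dots> \<le> real (m i) * (C / B (L i) * (v powr (- b1) + v powr (- b2)))"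
        using T[OF elim(2) v] by (intro mult_left_mono) auto
      also have "\<dots> = real (m i) / B (L i) * (C * (v powr (- b1) + v powr (- b2)))" by simp
      also have "\<dots> \<le> 2 * (C * (v powr (- b1) + v powr (- b2)))"
        using elim C by (intro mult_right_mono) auto
      finally show "\<bar>real (m i) * (1 - F (L i * v))\<bar> \<le> 2 * C * (v powr (- b1) + v powr (- b2))" by simp
    qed
  qed
  then show ?thesis by blast
qed

lemma countable_discont_scaled: "countable {v. 0 < v \<and> \<not> isCont M (lam powr (1 / \<alpha>) * v)}"
proof (rule countable_image_inj_on)
  let ?f = "\<lambda>v. lam powr (1 / \<alpha>) * v"
  show "countable (?f ` {v. 0 < v \<and> \<not> isCont M (?f v)})"
    by (rule countable_subset[OF _ countable_discont]) (use scaling_lam in auto)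
  show "inj_on ?f {v. 0 < v \<and> \<not> isCont M (?f v)}" using scaling_lam by (auto simp: inj_on_def)
qed

lemma scaling_tail_limit:
  assumes v: "0 < v" "isCont M (lam powr (1 / \<alpha>) * v)"
  shows "(\<lambda>i. real (m i) * (1 - F (L i * v))) \<longlonglongrightarrow> levy_tail lam v"
proof -
  have "(\<lambda>i. L i / A (real (k (j i))) * v) \<longlonglongrightarrow> lam powr (1 / \<alpha>) * v"
    by (intro tendsto_intros scaling_L)
  then have "(\<lambda>i. (L i * v) / A (real (k (j i)))) \<longlonglongrightarrow> lam powr (1 / \<alpha>) * v" by simp
  then have "(\<lambda>i. real (k (j i)) * (1 - F (L i * v))) \<longlonglongrightarrow> \<Theta> (lam powr (1 / \<alpha>) * v)"
    using v scaling_lam by (intro tail_limit scaling_j) auto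
  with scaling_m have "(\<lambda>i. real (m i) / real (k (j i)) * (real (k (j i)) * (1 - F (L i * v)))) \<longlonglongrightarrow> lam * \<Theta> (lam powr (1 / \<alpha>) * v)"
    by (rule tendsto_mult)
  moreover have "\<forall>\<^sub>F i in sequentially. real (m i) / real (k (j i)) * (real (k (j i)) * (1 - F (L i * v))) = real (m i) * (1 - F (L i * v))"
    using eventually_gt_filterlim[OF scaling_kj, where c=0] by eventually_elim auto
  ultimately show ?thesis
    unfolding levy_tail_eq_\<Theta>[OF scaling_lam v(1)] by (rule Lim_transform_eventually)
qed

lemma scaling_exponent: "(\<lambda>i. of_nat (m i) * (\<phi> (t / L i) - 1)) \<longlonglongrightarrow> \<Psi> lam t"
proof -
  obtain C where "\<forall>\<^sub>F i in sequentially. 0 < L i \<and> (\<forall>v>0. \<bar>real (m i) * (1 - F (L i * v))\<bar> \<le> C * (v powr (- b1) + v powr (- b2)))"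
    using scaling_tail_bound by blast
  then obtain N where N: "\<And>i. N \<le> i \<Longrightarrow> 0 < L i"
      "\<And>i v. N \<le> i \<Longrightarrow> 0 < v \<Longrightarrow> \<bar>real (m i) * (1 - F (L i * v))\<bar> \<le> C * (v powr (- b1) + v powr (- b2))"
    unfolding eventually_sequentially by metis
  have Fm [measurable]: "F \<in> borel_measurable borel" using F_mono by (rule borel_measurable_mono)
  \<comment> \<open>\<open>exponent_convergence\<close> asks for bounds at every index, hence the
    shift by \<open>N\<close>.\<close>
  have "(\<lambda>i. of_nat (m (i + N)) * (\<phi> (t / L (i + N)) - 1)) \<longlonglongrightarrow> \<Psi> lam t"
  proof (rule exponent_convergence[where G="\<lambda>i v. real (m (i + N)) * (1 - F (L (i + N) * v))" and t=t])
    fix i and R :: real assume R: "0 < R"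
    have L: "0 < L (i + N)" using N by simp
    let ?m = "of_nat (m (i + N)) :: complex"
    have "?m * (\<phi> (t / L (i + N)) - 1) - (CLBINT r:{0<..R}. \<i> * t * iexp (t * r) * (real (m (i + N)) * (1 - F (L (i + N) * r))))
      = ?m * ((\<phi> (t / L (i + N)) - 1) - (CLBINT r:{0<..R}. \<i> * t * iexp (t * r) * (1 - F (L (i + N) * r))))"
      unfolding right_diff_distrib[of ?m "\<phi> (t / L (i + N)) - 1"] set_integral_mult_right[symmetric]
      by (simp add: mult_ac)
    also have "cmod \<dots> \<le> real (m (i + N)) * (2 * (1 - F (L (i + N) * R)))"
      unfolding norm_mult using char_truncation[OF L R, of t] by (simp add: mult_left_mono)
    also have "\<dots> = 2 * (real (m (i + N)) * (1 - F (L (i + N) * R)))" by simp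
    finally show "cmod (?m * (\<phi> (t / L (i + N)) - 1) - (CLBINT r:{0<..R}. \<i> * t * iexp (t * r) * (real (m (i + N)) * (1 - F (L (i + N) * r)))))
      \<le> 2 * (real (m (i + N)) * (1 - F (L (i + N) * R)))" .
  next
    show "cmod (\<Psi> lam t - (CLBINT r:{0<..R}. \<i> * t * iexp (t * r) * levy_tail lam r)) \<le> 2 * levy_tail lam R" if "0 < R" for R
      by (rule \<Psi>_truncation[OF scaling_lam that])
    show "countable {v. 0 < v \<and> \<not> isCont M (lam powr (1 / \<alpha>) * v)}" by (rule countable_discont_scaled)
    show "(\<lambda>i. real (m (i + N)) * (1 - F (L (i + N) * v))) \<longlonglongrightarrow> levy_tail lam v"
      if "0 < v" "v \<notin> {v. 0 < v \<and> \<not> isCont M (lam powr (1 / \<alpha>) * v)}" for v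
      using that by (intro LIMSEQ_ignore_initial_segment[OF scaling_tail_limit]) auto
    show "\<bar>real (m (i + N)) * (1 - F (L (i + N) * v))\<bar> \<le> C * (v powr (- b1) + v powr (- b2))" if "0 < v" for i v
      using N that by simp
  qed (use b12 scaling_lam in auto)
  then show ?thesis by (rule LIMSEQ_offset)
qed

lemma scaling_char: "(\<lambda>i. \<phi> (t / L i) ^ m i) \<longlonglongrightarrow> exp (\<Psi> lam t)"
proof -
  let ?w = "\<lambda>i. \<phi> (t / L i) - 1"
  have "(\<lambda>i. t / L i) \<longlonglongrightarrow> 0"
    by (rule tendsto_divide_0[OF tendsto_const filterlim_at_top_imp_at_infinity[OF scaling_L_top]])
  then have "(\<lambda>i. \<phi> (t / L i)) \<longlonglongrightarrow> \<phi> 0" by (rule isCont_tendsto_compose[OF \<mu>.isCont_char])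
  then have w0: "?w \<longlonglongrightarrow> 0" using LIM_zero[of "\<lambda>i. \<phi> (t / L i)"] by (simp add: \<mu>.char_zero)
  have "(\<lambda>i. exp 2 * (cmod (of_nat (m i) * ?w i)) * cmod (?w i)) \<longlonglongrightarrow> exp 2 * cmod (\<Psi> lam t) * cmod 0"
    by (intro tendsto_intros w0 scaling_exponent)
  then have z: "(\<lambda>i. exp 2 * (cmod (of_nat (m i) * ?w i)) * cmod (?w i)) \<longlonglongrightarrow> 0" by simp
  have "(\<lambda>i. \<phi> (t / L i) ^ m i - exp (of_nat (m i) * ?w i)) \<longlonglongrightarrow> 0"
    by (rule Lim_null_comparison[OF _ z])
      (use norm_power_diff_exp[OF \<mu>.cmod_char_le_1] in \<open>simp add: norm_mult\<close>)
  from tendsto_add[OF this tendsto_exp[OF scaling_exponent[of t]]] show ?thesis by simp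
qed

end

text \<open>Every \<lambda> > 0 is reached by sums of the step; this is how statements about \<phi>
  are transferred to \<open>\<Psi> lam\<close>.\<close>

lemma scaling_exists: "0 < lam \<Longrightarrow> scaling lam id (\<lambda>i. nat \<lfloor>lam * real (k i)\<rfloor>) (\<lambda>i. A (real (k i)) * lam powr (1 / \<alpha>))"
  unfolding scaling_def
proof (intro conjI)
  assume lam: "0 < lam"
  show "filterlim id at_top sequentially" by (simp add: filterlim_ident id_def)
  have ev: "\<forall>\<^sub>F i in sequentially. 0 < A (real (k i))" using eventually_gt_filterlim[OF Ak_top, where c=0] .
  have "\<forall>\<^sub>F i in sequentially. A (real (k (id i))) * lam powr (1 / \<alpha>) / A (real (k (id i))) = lam powr (1 / \<alpha>)"
    using ev by eventually_elim auto
  then show "(\<lambda>i. A (real (k i)) * lam powr (1 / \<alpha>) / A (real (k (id i)))) \<longlonglongrightarrow> lam powr (1 / \<alpha>)"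
    by (simp add: tendsto_eventually)
  have "(\<lambda>i. lam - 1 / real (k i)) \<longlonglongrightarrow> lam - 0"
    by (intro tendsto_intros tendsto_divide_0[OF tendsto_const filterlim_at_top_imp_at_infinity[OF k_top]])
  then have lo: "(\<lambda>i. lam - 1 / real (k i)) \<longlonglongrightarrow> lam" by simp
  have ev1: "\<forall>\<^sub>F i in sequentially. 1 \<le> real (k i)"
    using eventually_ge_at_top[of 1] by eventually_elim (rule k_ge_1)
  show "(\<lambda>i. real (nat \<lfloor>lam * real (k i)\<rfloor>) / real (k (id i))) \<longlonglongrightarrow> lam"
  proof (rule tendsto_sandwich[OF _ _ lo tendsto_const])
    show "\<forall>\<^sub>F i in sequentially. lam - 1 / real (k i) \<le> real (nat \<lfloor>lam * real (k i)\<rfloor>) / real (k (id i))"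
      using ev1
    proof eventually_elim
      case (elim i)
      have "0 \<le> lam * real (k i)" using lam by simp
      then have "lam * real (k i) - 1 \<le> real (nat \<lfloor>lam * real (k i)\<rfloor>)" by linarith
      then have "(lam * real (k i) - 1) / real (k i) \<le> real (nat \<lfloor>lam * real (k i)\<rfloor>) / real (k i)"
        by (intro divide_right_mono) auto
      then show ?case using elim by (simp add: diff_divide_distrib)
    qed
    show "\<forall>\<^sub>F i in sequentially. real (nat \<lfloor>lam * real (k i)\<rfloor>) / real (k (id i)) \<le> lam"
      using ev1
    proof eventually_elim
      case (elim i)
      have "0 \<le> lam * real (k i)" using lam by simp
      then have "real (nat \<lfloor>lam * real (k i)\<rfloor>) \<le> lam * real (k i)" by linarith
      then show ?case using elim by (simp add: field_simps)
    qed
  qed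
qed

text \<open>The bound for \<phi> passes to the limit along a scaling sequence. The constant does not
  depend on \<lambda>, because \<open>m / B L\<close> tends to 1 whatever \<lambda> is.\<close>

lemma norm_exp_\<Psi>: "\<exists>C0>0. \<forall>lam>0. \<forall>t. cmod (exp (\<Psi> lam t)) \<le> exp (- (C0 * \<kappa> t))"
proof -
  obtain C0 L0 where C0: "0 < C0" and L0: "1 \<le> L0" "\<And>L. L0 \<le> L \<Longrightarrow> 0 < B L"
    and bd: "\<And>L s. L0 \<le> L \<Longrightarrow> \<bar>s\<bar> \<le> 4 * L \<Longrightarrow> cmod (\<phi> (s / L)) \<le> exp (- (C0 * \<kappa> s / B L))"
    using norm_char_bound by metis
  have "cmod (exp (\<Psi> lam t)) \<le> exp (- (C0 * \<kappa> t))" if lam: "0 < lam" for lam t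
  proof -
    note sc = scaling_exists[OF lam]
    let ?m = "\<lambda>i. nat \<lfloor>lam * real (k i)\<rfloor>" and ?L = "\<lambda>i. A (real (k i)) * lam powr (1 / \<alpha>)"
    have 1: "(\<lambda>i. cmod (\<phi> (t / ?L i) ^ ?m i)) \<longlonglongrightarrow> cmod (exp (\<Psi> lam t))"
      by (intro tendsto_norm scaling_char[OF sc])
    have 2: "(\<lambda>i. exp (- (C0 * \<kappa> t) * (real (?m i) / B (?L i)))) \<longlonglongrightarrow> exp (- (C0 * \<kappa> t) * 1)"
      by (intro tendsto_intros scaling_m_B[OF sc])
    have "\<forall>\<^sub>F i in sequentially. cmod (\<phi> (t / ?L i) ^ ?m i) \<le> exp (- (C0 * \<kappa> t) * (real (?m i) / B (?L i)))"
      using eventually_ge_filterlim[OF scaling_L_top[OF sc], where c="max L0 (\<bar>t\<bar>)"]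
    proof eventually_elim
      case (elim i)
      have "cmod (\<phi> (t / ?L i)) \<le> exp (- (C0 * \<kappa> t / B (?L i)))"
        using elim L0 by (intro bd) auto
      then have "cmod (\<phi> (t / ?L i)) ^ ?m i \<le> exp (- (C0 * \<kappa> t / B (?L i))) ^ ?m i"
        by (intro power_mono) auto
      then show ?case by (simp add: norm_power exp_of_nat_mult[symmetric] mult_ac)
    qed
    from tendsto_le[OF _ 2 1 this] show ?thesis by simp
  qed
  then show ?thesis using C0 by blast
qed

end

section \<open>Semistable laws and densities\<close>

context semistable_renewal
begin

section \<open>Tightness and existence of the semistable law\<close>

lemma expectation_min_S:
  assumes c0: "0 < c0"
  shows "(LINT \<omega>|P. min (S m \<omega>) c0) \<le> real m * (LINT x|\<mu>. min (max 0 x) c0)"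
proof -
  have le: "min (S m \<omega>) c0 \<le> (\<Sum>i<m. min (real (X i \<omega>)) c0)" for \<omega>
  proof (induction m)
    case (Suc m)
    have "0 \<le> S m \<omega>" "S (Suc m) \<omega> = S m \<omega> + real (X m \<omega>)" by (simp_all add: S_def sum_nonneg)
    then have "min (S (Suc m) \<omega>) c0 \<le> min (S m \<omega>) c0 + min (real (X m \<omega>)) c0"
      using c0 by (auto simp: min_def)
    then show ?case using Suc by simp
  qed (use c0 in \<open>simp add: S_def\<close>)
  have S0: "0 \<le> S m \<omega>" for \<omega> by (simp add: S_def sum_nonneg)
  have i: "integrable P (\<lambda>\<omega>. min (real (X i \<omega>)) c0)" for i
    by (rule integrable_const_bound[of _ c0]) (use c0 in auto)
  have "(LINT \<omega>|P. min (S m \<omega>) c0) \<le> (LINT \<omega>|P. (\<Sum>i<m. min (real (X i \<omega>)) c0))"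
  proof (rule integral_mono[OF _ _ le])
    show "integrable P (\<lambda>\<omega>. min (S m \<omega>) c0)"
      by (rule integrable_const_bound[of _ c0]) (use c0 S0 in auto)
    show "integrable P (\<lambda>\<omega>. \<Sum>i<m. min (real (X i \<omega>)) c0)" using i by simp
  qed
  also have "\<dots> = (\<Sum>i<m. LINT \<omega>|P. min (real (X i \<omega>)) c0)" using i by (intro Bochner_Integration.integral_sum) auto
  also have "\<dots> = (\<Sum>i<m. LINT x|\<mu>. min (max 0 x) c0)"
  proof (intro sum.cong refl)
    fix i
    show "(LINT \<omega>|P. min (real (X i \<omega>)) c0) = (LINT x|\<mu>. min (max 0 x) c0)"
      unfolding distr_X[of i, symmetric] by (subst integral_distr) auto
  qed
  finally show ?thesis by simp
qed

text \<open>Markov's inequality has to be applied to the truncated sum, since the step has infinite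
  mean; truncation at \<open>c0\<close> is subadditive over the summands.\<close>

lemma prob_S_greater:
  assumes c0: "0 < c0"
  shows "prob {\<omega> \<in> space P. c0 < S m \<omega>} \<le> real m * (LINT x|\<mu>. min (max 0 x) c0) / c0"
proof -
  have S0: "0 \<le> S m \<omega>" for \<omega> by (simp add: S_def sum_nonneg)
  have "c0 * prob {\<omega> \<in> space P. c0 < S m \<omega>} = (LINT \<omega>|P. c0 * indicator {\<omega> \<in> space P. c0 < S m \<omega>} \<omega>)"
    by (simp add: Int_absorb2)
  also have "\<dots> \<le> (LINT \<omega>|P. min (S m \<omega>) c0)"
  proof (rule integral_mono)
    show "integrable P (\<lambda>\<omega>. min (S m \<omega>) c0)"
      by (rule integrable_const_bound[of _ c0]) (use c0 S0 in auto)
    show "integrable P (\<lambda>\<omega>. c0 * indicator {\<omega> \<in> space P. c0 < S m \<omega>} \<omega>)"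
      by (intro integrable_mult_right integrable_real_indicator) (auto simp: emeasure_eq_measure)
  qed (use c0 S0 in \<open>auto split: split_indicator\<close>)
  also have "\<dots> \<le> real m * (LINT x|\<mu>. min (max 0 x) c0)" by (rule expectation_min_S[OF c0])
  finally show ?thesis using c0 by (simp add: field_simps)
qed

text \<open>The law is the weak limit of \<open>S m / L\<close> along a scaling sequence. For
  tightness, \<open>prob_S_greater\<close> at level \<open>K * L\<close> gives
  \<open>m * C / B (K * L)\<close>, which Potter's bound and \<open>m \<le> 2 * B L\<close> reduce
  to a multiple of \<open>K powr (- b1)\<close>.\<close>

lemma semistable_law_exists:
  assumes lam: "0 < lam"
  shows "\<exists>\<nu>. real_distribution \<nu> \<and> (\<forall>t. char \<nu> t = exp (\<Psi> lam t))"
proof -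
  define m where "m i = nat \<lfloor>lam * real (k i)\<rfloor>" for i
  define L where "L i = A (real (k i)) * lam powr (1 / \<alpha>)" for i
  have sc: "scaling lam id m L" using scaling_exists[OF lam] by (simp add: m_def[abs_def] L_def[abs_def])
  obtain C L0 where C: "0 < C" "1 \<le> L0" "\<And>L. L0 \<le> L \<Longrightarrow> 0 < B L"
    and T: "\<And>L. L0 \<le> L \<Longrightarrow> (LINT x|\<mu>. min (max 0 x) L) \<le> C * L / B L"
    using expectation_min_bound by metis
  obtain D x0 where D: "1 \<le> D" and x0: "1 \<le> x0" "\<And>x. x0 \<le> x \<Longrightarrow> 0 < B x"
    and Q: "\<And>r s. x0 \<le> r \<Longrightarrow> r \<le> s \<Longrightarrow> (s / r) powr b1 * B r \<le> D * B s"
    using B_potter by metis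
  have "\<forall>\<^sub>F i in sequentially. max L0 x0 \<le> L i \<and> real (m i) / B (L i) < 2"
    using eventually_ge_filterlim[OF scaling_L_top[OF sc], where c="max L0 x0"]
      order_tendstoD(2)[OF scaling_m_B[OF sc], of 2, simplified]
    by eventually_elim auto
  then obtain N where N: "\<And>i. N \<le> i \<Longrightarrow> max L0 x0 \<le> L i \<and> real (m i) / B (L i) < 2"
    unfolding eventually_sequentially by blast
  define \<nu> where "\<nu> i = distr P borel (\<lambda>\<omega>. S (m (i + N)) \<omega> / L (i + N))" for i
  have rd: "real_distribution (\<nu> i)" for i unfolding \<nu>_def by (rule real_distribution_distr) simp
  have bound: "1 - 2 * C * D * K powr (- b1) \<le> measure (\<nu> i) {-1<..K}" if K: "1 \<le> K" for K i
  proof -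
    let ?m = "m (i + N)" and ?L = "L (i + N)"
    have L: "L0 \<le> ?L" "x0 \<le> ?L" "real ?m / B ?L < 2" "0 < ?L" using N[of "i + N"] C by auto
    have LK: "?L \<le> K * ?L" using K L by simp
    have BL: "0 < B ?L" "0 < B (K * ?L)" using C(3)[OF L(1)] C(3)[OF order.trans[OF L(1) LK]] by auto
    have S0: "0 \<le> S m \<omega>" for \<omega> m by (simp add: S_def sum_nonneg)
    have "measure (\<nu> i) {-1<..K} = prob ((\<lambda>\<omega>. S ?m \<omega> / ?L) -` {-1<..K} \<inter> space P)"
      unfolding \<nu>_def by (rule measure_distr) auto
    also have "(\<lambda>\<omega>. S ?m \<omega> / ?L) -` {-1<..K} \<inter> space P = space P - {\<omega> \<in> space P. K * ?L < S ?m \<omega>}"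
    proof -
      have "- 1 < S ?m \<omega> / ?L" for \<omega>
        using divide_nonneg_pos[OF S0[of ?m \<omega>] L(4)] by linarith
      then show ?thesis using L by (auto simp: field_simps not_less)
    qed
    also have "prob \<dots> = 1 - prob {\<omega> \<in> space P. K * ?L < S ?m \<omega>}"
      by (rule prob_compl) simp
    finally have eq: "measure (\<nu> i) {-1<..K} = 1 - prob {\<omega> \<in> space P. K * ?L < S ?m \<omega>}" .
    have "prob {\<omega> \<in> space P. K * ?L < S ?m \<omega>} \<le> real ?m * (LINT x|\<mu>. min (max 0 x) (K * ?L)) / (K * ?L)"
      using K L by (intro prob_S_greater) auto
    also have "\<dots> \<le> real ?m * (C * (K * ?L) / B (K * ?L)) / (K * ?L)"
      using K L LK order.trans[OF L(1) LK] by (intro divide_right_mono mult_left_mono T) auto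
    also have "\<dots> = real ?m * C / B (K * ?L)" using K L by simp
    also have "\<dots> \<le> 2 * C * D * K powr (- b1)"
    proof -
      have "K powr b1 * B ?L \<le> D * B (K * ?L)" using Q[OF L(2) LK] L by simp
      then have "B ?L \<le> K powr (- b1) * D * B (K * ?L)" using K by (simp add: powr_minus_divide field_simps)
      then have "2 * B ?L \<le> 2 * (K powr (- b1) * D * B (K * ?L))" by simp
      moreover have "real ?m \<le> 2 * B ?L" using L BL by (simp add: field_simps)
      ultimately have "real ?m \<le> 2 * (K powr (- b1) * D * B (K * ?L))" by linarith
      then have "real ?m * C \<le> 2 * (K powr (- b1) * D * B (K * ?L)) * C" using C by (intro mult_right_mono) auto
      then show ?thesis using BL by (simp add: field_simps)
    qed
    finally show ?thesis using eq by simp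
  qed
  have "tight \<nu>"
    unfolding tight_def
  proof (intro conjI allI impI)
    show "real_distribution (\<nu> n)" for n by (rule rd)
    fix e :: real assume e: "0 < e"
    have "((\<lambda>K. 2 * C * D * K powr (- b1)) \<longlongrightarrow> 2 * C * D * 0) at_top"
      using b12 by (intro tendsto_intros tendsto_neg_powr filterlim_ident) auto
    then have "\<forall>\<^sub>F K in at_top. 2 * C * D * K powr (- b1) < e" by (rule order_tendstoD) (use e in auto)
    with eventually_ge_at_top[of 1] have "\<forall>\<^sub>F K in at_top. 1 \<le> K \<and> 2 * C * D * K powr (- b1) < e" by eventually_elim auto
    then obtain K where K: "1 \<le> K" "2 * C * D * K powr (- b1) < e" by (auto dest: eventually_happens)
    show "\<exists>a b. a < b \<and> (\<forall>n. 1 - e < measure (\<nu> n) {a<..b})"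
    \<comment> \<open>The sums are nonnegative, so -1 serves as left endpoint of a half-open
      interval that contains 0.\<close>
    proof (rule exI[of _ "-1"], rule exI[of _ K], intro conjI allI)
      show "1 - e < measure (\<nu> n) {-1<..K}" for n using bound[OF K(1), of n] K by linarith
    qed (use K in auto)
  qed
  then show ?thesis
  proof (rule char_limit_exists)
    fix t
    have "char (\<nu> i) t = \<phi> (t / L (i + N)) ^ m (i + N)" for i
    proof -
      have "char (\<nu> i) t = (CLINT \<omega>|P. iexp (t / L (i + N) * S (m (i + N)) \<omega>))"
        unfolding \<nu>_def char_def by (subst integral_distr) simp_all
      then show ?thesis by (simp only: expectation_iexp_S)
    qed
    then show "(\<lambda>i. char (\<nu> i) t) \<longlonglongrightarrow> exp (\<Psi> lam t)"
      using LIMSEQ_ignore_initial_segment[OF scaling_char[OF sc]] by simp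
  qed
qed

lemma semistable_law:
  assumes lam: "0 < lam"
  shows "real_distribution (semistable_law \<alpha> M lam)" "char (semistable_law \<alpha> M lam) t = exp (\<Psi> lam t)"
proof -
  have "\<exists>!\<nu>. real_distribution \<nu> \<and> (\<forall>t. char \<nu> t = exp (\<Psi> lam t))"
    using semistable_law_exists[OF lam] Levy_uniqueness by (metis ext)
  then have "real_distribution (semistable_law \<alpha> M lam) \<and> (\<forall>t. char (semistable_law \<alpha> M lam) t = exp (\<Psi> lam t))"
    unfolding semistable_law_def \<Psi>_def[symmetric] by (rule theI')
  then show "real_distribution (semistable_law \<alpha> M lam)" "char (semistable_law \<alpha> M lam) t = exp (\<Psi> lam t)" by auto
qed

section \<open>The densities and the integrals of powers of \<phi>\<close>

lemma \<kappa>_measurable [measurable]: "\<kappa> \<in> borel_measurable borel"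
  unfolding \<kappa>_def[abs_def] by simp

lemma exp_\<kappa>_le: "0 \<le> a \<Longrightarrow> exp (- (a * \<kappa> s)) \<le> exp (- (a * \<bar>s\<bar> powr b1)) + exp (- (a * \<bar>s\<bar> powr b2))"
  by (auto simp: \<kappa>_def min_def)

lemma integrable_exp_\<kappa>:
  assumes a: "0 < a" shows "integrable lborel (\<lambda>s. exp (- (a * \<kappa> s)))"
proof (rule Bochner_Integration.integrable_bound)
  show "integrable lborel (\<lambda>s. exp (- (a * \<bar>s\<bar> powr b1)) + exp (- (a * \<bar>s\<bar> powr b2)))"
    using b12 a by (intro Bochner_Integration.integrable_add integrable_exp_powr_scaled) auto
  show "AE s in lborel. norm (exp (- (a * \<kappa> s))) \<le> norm (exp (- (a * \<bar>s\<bar> powr b1)) + exp (- (a * \<bar>s\<bar> powr b2)))"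
    using exp_\<kappa>_le a by (intro AE_I2) (simp add: abs_of_nonneg add_nonneg_nonneg)
qed simp

lemma integral_exp_\<kappa>:
  "\<exists>K>0. \<forall>a>0. (LBINT s. exp (- (a * \<kappa> s))) \<le> K * (a powr (- (1 / b1)) + a powr (- (1 / b2)))"
proof -
  define K1 where "K1 = (LBINT s::real. exp (- (\<bar>s\<bar> powr b1)))"
  define K2 where "K2 = (LBINT s::real. exp (- (\<bar>s\<bar> powr b2)))"
  have "(LBINT s. exp (- (a * \<kappa> s))) \<le> max 1 (max K1 K2) * (a powr (- (1 / b1)) + a powr (- (1 / b2)))" if a: "0 < a" for a
  proof -
    have "(LBINT s. exp (- (a * \<kappa> s))) \<le> (LBINT s. exp (- (a * \<bar>s\<bar> powr b1)) + exp (- (a * \<bar>s\<bar> powr b2)))"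
      using b12 a exp_\<kappa>_le
      by (intro integral_mono integrable_exp_\<kappa> Bochner_Integration.integrable_add integrable_exp_powr_scaled) auto
    also have "\<dots> = a powr (- (1 / b1)) * K1 + a powr (- (1 / b2)) * K2"
      using b12 a integrable_exp_powr_scaled[of b1 a] integrable_exp_powr_scaled[of b2 a]
      by (simp add: K1_def K2_def)
    also have "\<dots> \<le> a powr (- (1 / b1)) * max 1 (max K1 K2) + a powr (- (1 / b2)) * max 1 (max K1 K2)"
      by (intro add_mono mult_left_mono) auto
    finally show ?thesis by (simp add: algebra_simps)
  qed
  then show ?thesis by (intro exI[of _ "max 1 (max K1 K2)"]) auto
qed

lemma exp_\<Psi>_measurable [measurable]: "0 < lam \<Longrightarrow> (\<lambda>t. exp (\<Psi> lam t)) \<in> borel_measurable borel"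
  using real_distribution.char_measurable[OF semistable_law(1)] by (simp add: semistable_law(2)[symmetric])

lemma integrable_exp_\<Psi>: assumes lam: "0 < lam" shows "integrable lborel (\<lambda>t. exp (\<Psi> lam t))"
proof -
  obtain C0 where C0: "0 < C0" "\<And>t. cmod (exp (\<Psi> lam t)) \<le> exp (- (C0 * \<kappa> t))"
    using norm_exp_\<Psi> lam by metis
  show ?thesis
    by (rule Bochner_Integration.integrable_bound[OF integrable_exp_\<kappa>[OF C0(1)]]) (use lam C0 in auto)
qed

abbreviation g :: "real \<Rightarrow> real \<Rightarrow> real" where "g \<equiv> semistable_density \<alpha> M"

text \<open>The characteristic function is integrable, so inversion supplies a nonnegative
  continuous density. By uniqueness it is the one selected by \<open>THE\<close>; from here on
  \<open>g\<close> is the inversion integral.\<close>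

lemma g_props:
  assumes lam: "0 < lam"
  shows g_eq: "g lam x = Re (CLBINT t. exp (\<Psi> lam t) * iexp (- (t * x))) / (2 * pi)"
    and g_nonneg: "0 \<le> g lam x"
proof -
  interpret Q: real_distribution "semistable_law \<alpha> M lam" by (rule semistable_law[OF lam])
  have char_eq: "char (semistable_law \<alpha> M lam) = (\<lambda>t. exp (\<Psi> lam t))"
    using semistable_law(2)[OF lam] by auto
  have int: "integrable lborel (char (semistable_law \<alpha> M lam))"
    unfolding char_eq by (rule integrable_exp_\<Psi>[OF lam])
  have cont: "continuous_on UNIV Q.inversion_density"
    by (intro continuous_at_imp_continuous_on ballI Q.isCont_inversion_density int)
  have "g lam = Q.inversion_density"
    unfolding semistable_density_def
  proof (rule the_equality)
    show "continuous_on UNIV Q.inversion_density \<and> (\<forall>x. 0 \<le> Q.inversion_density x) \<and>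
        semistable_law \<alpha> M lam = density lborel (\<lambda>x. ennreal (Q.inversion_density x))"
      using cont Q.inversion_density_nonneg[OF int] Q.eq_density_inversion[OF int] by blast
    fix f assume f: "continuous_on UNIV f \<and> (\<forall>x. 0 \<le> f x) \<and> semistable_law \<alpha> M lam = density lborel (\<lambda>x. ennreal (f x))"
    show "f = Q.inversion_density"
      using f cont Q.inversion_density_nonneg[OF int] Q.eq_density_inversion[OF int]
      by (intro continuous_density_unique) auto
  qed
  then show "g lam x = Re (CLBINT t. exp (\<Psi> lam t) * iexp (- (t * x))) / (2 * pi)" "0 \<le> g lam x"
    using Q.inversion_density_nonneg[OF int] by (simp_all add: Q.inversion_density_def char_eq)
qed

text \<open>\<open>exponent_convergence\<close> again, now for Levy measures with varying parameter.
  Their tails converge except where \<open>M\<close> jumps, and \<open>v powr (- \<alpha>)\<close>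
  is dominated by the sum of the powers with exponents \<open>b1\<close> and
  \<open>b2\<close>.\<close>

lemma \<Psi>_continuous:
  assumes lam: "0 < lam" and l: "l \<longlonglongrightarrow> lam" "\<And>i. 0 < l i"
  shows "(\<lambda>i. \<Psi> (l i) t) \<longlonglongrightarrow> \<Psi> lam t"
proof -
  obtain K where K: "0 < K" "\<And>lam v. 0 < lam \<Longrightarrow> 0 < v \<Longrightarrow> levy_tail lam v \<le> K * v powr (- \<alpha>)"
    using levy_tail_upper by metis
  show ?thesis
  proof (rule exponent_convergence[where G="\<lambda>i. levy_tail (l i)" and t=t])
    show "countable {v. 0 < v \<and> \<not> isCont M (lam powr (1 / \<alpha>) * v)}"
      by (rule countable_discont_scaled[OF scaling_exists[OF lam]])
    show "(\<lambda>i. levy_tail (l i) v) \<longlonglongrightarrow> levy_tail lam v"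
      if v: "0 < v" "v \<notin> {v. 0 < v \<and> \<not> isCont M (lam powr (1 / \<alpha>) * v)}" for v
    proof -
      have "(\<lambda>i. l i powr (1 / \<alpha>) * v) \<longlonglongrightarrow> lam powr (1 / \<alpha>) * v"
        using lam by (intro tendsto_intros l) auto
      then have "(\<lambda>i. M (l i powr (1 / \<alpha>) * v)) \<longlonglongrightarrow> M (lam powr (1 / \<alpha>) * v)"
        by (rule isCont_tendsto_compose[rotated]) (use v in auto)
      then show ?thesis unfolding levy_tail_def using v(1) by (auto intro!: tendsto_intros)
    qed
    show "\<bar>levy_tail (l i) v\<bar> \<le> K * (v powr (- b1) + v powr (- b2))" if v: "0 < v" for i v
    proof -
      have "v powr (- \<alpha>) \<le> v powr (- b1) + v powr (- b2)"
      proof (cases "v \<le> 1")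
        case True
        then have "v powr (- \<alpha>) \<le> v powr (- b2)" using v b12 by (intro powr_mono') auto
        then show ?thesis by (simp add: add_increasing)
      next
        case False
        then have "v powr (- \<alpha>) \<le> v powr (- b1)" using v b12 by (intro powr_mono) auto
        then show ?thesis by (simp add: add_increasing2)
      qed
      then have "K * v powr (- \<alpha>) \<le> K * (v powr (- b1) + v powr (- b2))" using K by (intro mult_left_mono) auto
      then show ?thesis using K(2)[OF l(2) v, of i] levy_tail_nonneg[OF l(2)] by (auto simp: abs_of_nonneg)
    qed
  qed (use \<Psi>_truncation lam l b12 in auto)
qed

text \<open>Joint continuity, from a dominating function that does not depend on \<lambda>. It
  serves both the passage to subsequences and the measurability of the limiting integrand, whose
  parameter varies with the argument.\<close>

lemma g_continuous:
  assumes lam: "0 < lam" and l: "l \<longlonglongrightarrow> lam" "\<And>i. 0 < l i" and x: "x \<longlonglongrightarrow> y"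
  shows "(\<lambda>i. g (l i) (x i)) \<longlonglongrightarrow> g lam y"
proof -
  obtain C0 where C0: "0 < C0" "\<And>lam t. 0 < lam \<Longrightarrow> cmod (exp (\<Psi> lam t)) \<le> exp (- (C0 * \<kappa> t))"
    using norm_exp_\<Psi> by metis
  have "(\<lambda>i. CLBINT t. exp (\<Psi> (l i) t) * iexp (- (t * x i))) \<longlonglongrightarrow> (CLBINT t. exp (\<Psi> lam t) * iexp (- (t * y)))"
  proof (rule integral_dominated_convergence[where w="\<lambda>t. exp (- (C0 * \<kappa> t))"])
    show "integrable lborel (\<lambda>t. exp (- (C0 * \<kappa> t)))" by (rule integrable_exp_\<kappa>[OF C0(1)])
    show "AE t in lborel. (\<lambda>i. exp (\<Psi> (l i) t) * iexp (- (t * x i))) \<longlonglongrightarrow> exp (\<Psi> lam t) * iexp (- (t * y))"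
      by (intro AE_I2 tendsto_intros \<Psi>_continuous lam l x)
    show "AE t in lborel. norm (exp (\<Psi> (l i) t) * iexp (- (t * x i))) \<le> exp (- (C0 * \<kappa> t))" for i
      using C0(2)[OF l(2)[of i]] by (intro AE_I2) (simp add: norm_mult del: norm_exp_eq_Re of_real_mult of_real_minus)
    show "(\<lambda>t. exp (\<Psi> lam t) * iexp (- (t * y))) \<in> borel_measurable lborel" using lam by simp
    show "(\<lambda>t. exp (\<Psi> (l i) t) * iexp (- (t * x i))) \<in> borel_measurable lborel" for i using l by simp
  qed
  then show ?thesis unfolding g_eq[OF lam] g_eq[OF l(2)] by (intro tendsto_intros) auto
qed

text \<open>With \<open>t = s / n\<close> the integrand is at most a constant times
  \<open>exp (- (C0 * (m / B n) * \<kappa> s))\<close>. The exponent is \<open>m - 1\<close> because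
  a difference of \<open>m\<close>-th powers leaves only \<open>m - 1\<close> factors.\<close>

lemma char_power_integral:
  "\<exists>K>0. \<exists>N\<ge>4. \<forall>n\<ge>N. 0 < B n \<and> (\<forall>m\<ge>1. n * (LBINT t:{-4..4}. cmod (\<phi> t) ^ (m - 1)) \<le>
      K * ((real m / B n) powr (- (1 / b1)) + (real m / B n) powr (- (1 / b2))))"
proof -
  obtain C0 C1 L0 where C0: "0 < C0" and L0: "1 \<le> L0" "\<And>L. L0 \<le> L \<Longrightarrow> 0 < B L"
    and bd: "\<And>L s. L0 \<le> L \<Longrightarrow> \<bar>s\<bar> \<le> 4 * L \<Longrightarrow> cmod (\<phi> (s / L)) \<le> exp (- (C0 * \<kappa> s / B L))"
      "\<And>L s. L0 \<le> L \<Longrightarrow> \<bar>s\<bar> \<le> 4 * L \<Longrightarrow> \<kappa> s / B L \<le> C1"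
    using norm_char_bound by metis
  obtain K where K: "0 < K" "\<And>a. 0 < a \<Longrightarrow> (LBINT s. exp (- (a * \<kappa> s))) \<le> K * (a powr (- (1 / b1)) + a powr (- (1 / b2)))"
    using integral_exp_\<kappa> by metis
  define K' where "K' = exp (C0 * C1) * K * max (C0 powr (- (1 / b1))) (C0 powr (- (1 / b2)))"
  have K': "0 < K'" using K C0 by (simp add: K'_def less_max_iff_disj)
  have "n * (LBINT t:{-4..4}. cmod (\<phi> t) ^ (m - 1)) \<le> K' * ((real m / B n) powr (- (1 / b1)) + (real m / B n) powr (- (1 / b2)))"
    if n: "L0 \<le> n" and m: "1 \<le> m" for n :: real and m :: nat
  proof -
    have n0: "0 < n" using n L0 by linarith
    have Bn: "0 < B n" using n L0 by auto
    define w where "w = real m / B n"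
    have w: "0 < w" using m Bn by (simp add: w_def)
    have "(LBINT t:{-4..4}. cmod (\<phi> t) ^ (m - 1)) = (1 / n) * (LBINT s. indicator {-4..4} (s / n) * cmod (\<phi> (s / n)) ^ (m - 1))"
      unfolding set_lebesgue_integral_def
      using lborel_integral_real_affine[of "1 / n" "\<lambda>t. indicator {-4..4} t *\<^sub>R cmod (\<phi> t) ^ (m - 1)" 0] n0 by simp
    then have "n * (LBINT t:{-4..4}. cmod (\<phi> t) ^ (m - 1)) = (LBINT s. indicator {-4..4} (s / n) * cmod (\<phi> (s / n)) ^ (m - 1))"
      using n0 by simp
    also have "\<dots> \<le> (LBINT s. exp (C0 * C1) * exp (- (C0 * w * \<kappa> s)))"
    proof (rule integral_mono')
      show "integrable lborel (\<lambda>s. exp (C0 * C1) * exp (- (C0 * w * \<kappa> s)))"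
        using C0 w by (intro integrable_mult_right integrable_exp_\<kappa>) auto
      fix s :: real
      show "indicator {-4..4} (s / n) * cmod (\<phi> (s / n)) ^ (m - 1) \<le> exp (C0 * C1) * exp (- (C0 * w * \<kappa> s))"
      proof (cases "s / n \<in> {-4..4}")
        case True
        then have s: "\<bar>s\<bar> \<le> 4 * n" using n0 by (auto simp: field_simps abs_le_iff)
        have "cmod (\<phi> (s / n)) ^ (m - 1) \<le> exp (- (C0 * \<kappa> s / B n)) ^ (m - 1)"
          using bd(1)[OF n s] by (intro power_mono) auto
        also have "\<dots> = exp (real (m - 1) * - (C0 * \<kappa> s / B n))" by (simp only: exp_of_nat_mult)
        \<comment> \<open>The missing factor costs \<open>exp (C0 * \<kappa> s / B n)\<close>, which
          is at most \<open>exp (C0 * C1)\<close>.\<close>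
        also have "real (m - 1) * - (C0 * \<kappa> s / B n) = C0 * (\<kappa> s / B n) + - (C0 * w * \<kappa> s)"
          using m by (simp add: of_nat_diff w_def algebra_simps diff_divide_distrib)
        also have "exp \<dots> = exp (C0 * (\<kappa> s / B n)) * exp (- (C0 * w * \<kappa> s))" by (rule exp_add)
        also have "\<dots> \<le> exp (C0 * C1) * exp (- (C0 * w * \<kappa> s))"
        proof -
          have "C0 * (\<kappa> s / B n) \<le> C0 * C1" using bd(2)[OF n s] C0 by (intro mult_left_mono) auto
          then show ?thesis by (intro mult_right_mono) (simp_all only: exp_le_cancel_iff exp_ge_zero)
        qed
        finally show ?thesis using True by simp
      qed simp
    qed simp
    also have "\<dots> = exp (C0 * C1) * (LBINT s. exp (- (C0 * w * \<kappa> s)))" by simp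
    also have "\<dots> \<le> exp (C0 * C1) * (K * ((C0 * w) powr (- (1 / b1)) + (C0 * w) powr (- (1 / b2))))"
      using K(2)[of "C0 * w"] C0 w by (intro mult_left_mono) auto
    also have "\<dots> = exp (C0 * C1) * K * (C0 powr (- (1 / b1)) * w powr (- (1 / b1)) + C0 powr (- (1 / b2)) * w powr (- (1 / b2)))"
      using C0 w by (simp add: powr_mult)
    also have "\<dots> \<le> exp (C0 * C1) * K * (max (C0 powr (- (1 / b1))) (C0 powr (- (1 / b2))) * w powr (- (1 / b1))
        + max (C0 powr (- (1 / b1))) (C0 powr (- (1 / b2))) * w powr (- (1 / b2)))"
      using K by (intro mult_left_mono add_mono mult_right_mono) auto
    also have "\<dots> = K' * (w powr (- (1 / b1)) + w powr (- (1 / b2)))" by (simp add: K'_def algebra_simps)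
    finally show ?thesis by (simp add: w_def)
  qed
  then show ?thesis using K' L0 by (intro exI[of _ K'] conjI exI[of _ "max 4 L0"]) auto
qed

text \<open>In the factorization of \<open>a ^ m - b ^ m\<close> each mixed product is at most the
  larger of the two pure powers, hence at most their sum. The right-hand side then involves only
  integrals of powers of a single function.\<close>

lemma norm_power_diff_le:
  fixes a b :: complex
  shows "cmod (a ^ m - b ^ m) \<le> real m * cmod (a - b) * (cmod a ^ (m - 1) + cmod b ^ (m - 1))"
proof (cases m)
  case (Suc q)
  have le: "cmod a ^ i * cmod b ^ (q - i) \<le> cmod a ^ q + cmod b ^ q" if "i \<le> q" for i
  proof -
    let ?M = "max (cmod a) (cmod b)"
    have "cmod a ^ i * cmod b ^ (q - i) \<le> ?M ^ i * ?M ^ (q - i)" by (intro mult_mono power_mono) (auto simp: le_max_iff_disj)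
    also have "\<dots> = ?M ^ q" using that by (simp add: power_add[symmetric])
    also have "\<dots> \<le> cmod a ^ q + cmod b ^ q" by (auto simp: max_def)
    finally show ?thesis .
  qed
  have "a ^ Suc q - b ^ Suc q = (a - b) * (\<Sum>i<Suc q. a ^ i * b ^ (q - i))"
    by (rule diff_power_eq_sum)
  then have "cmod (a ^ m - b ^ m) = cmod (a - b) * cmod (\<Sum>i<Suc q. a ^ i * b ^ (q - i))"
    by (simp add: Suc norm_mult)
  also have "\<dots> \<le> cmod (a - b) * (\<Sum>i<Suc q. cmod a ^ q + cmod b ^ q)"
    by (intro mult_left_mono sum_norm_le) (use le in \<open>auto simp: norm_mult norm_power\<close>)
  finally show ?thesis by (simp add: Suc mult_ac)
qed simp

end

section \<open>Bounds for the point probabilities\<close>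

text \<open>In the application \<open>f\<close> inherits jumps from \<open>position\<close>, so a
  change of variables for absolutely integrable functions is used. That theorem lives on the
  completed measure; Borel measurability of the transformed integrand is checked separately.\<close>

lemma integral_powr_substitution:
  fixes f :: "real \<Rightarrow> real" and a :: real
  assumes a: "0 < a" and f: "set_integrable lborel {0<..} f"
  shows "(LBINT x:{0<..}. a * x powr (- a - 1) * f (x powr (- a))) = (LBINT y:{0<..}. f y)"
proof -
  have fm: "(\<lambda>y. indicator {0<..} y *\<^sub>R f y) \<in> borel_measurable borel"
    using borel_measurable_integrable[OF f[unfolded set_integrable_def]] by simp
  have img: "(\<lambda>x. x powr (- a)) ` {0<..} = {0::real<..}"
  proof (rule set_eqI, rule iffI)
    fix y :: real assume "y \<in> (\<lambda>x. x powr (- a)) ` {0<..}"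
    then obtain x :: real where "0 < x" "y = x powr (- a)" by (elim imageE) simp
    then show "y \<in> {0<..}" by simp
  next
    fix y :: real assume y: "y \<in> {0<..}"
    have "(y powr (- (1 / a))) powr (- a) = y" using a y by (simp only: powr_powr) simp
    then show "y \<in> (\<lambda>x. x powr (- a)) ` {0<..}"
      using y by (intro image_eqI[of _ _ "y powr (- (1 / a))"]) simp_all
  qed
  have der: "((\<lambda>x. x powr (- a)) has_field_derivative (- a) * x powr (- a - 1)) (at x within {0<..})" if "x \<in> {0<..}" for x :: real
    by (rule has_field_derivative_at_within, rule has_real_derivative_powr) (use that in simp)
  have inj: "inj_on (\<lambda>x. x powr (- a)) {0::real<..}"
    
  proof (rule inj_onI)
    fix x y :: real assume "x \<in> {0<..}" "y \<in> {0<..}" and eq: "x powr (- a) = y powr (- a)"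
    then have "ln (x powr (- a)) = ln (y powr (- a))" by simp
    with \<open>x \<in> {0<..}\<close> \<open>y \<in> {0<..}\<close> a show "x = y" by (simp add: ln_powr)
  qed
  have f': "f absolutely_integrable_on {0<..}"
    using f unfolding set_integrable_def by (subst integrable_completion) (use fm in auto)
  have "(\<lambda>x. \<bar>(- a) * x powr (- a - 1)\<bar> * f (x powr (- a))) absolutely_integrable_on {0<..} \<and>
      integral {0<..} (\<lambda>x. \<bar>(- a) * x powr (- a - 1)\<bar> * f (x powr (- a))) = integral {0<..} f
    \<longleftrightarrow> f absolutely_integrable_on ((\<lambda>x. x powr (- a)) ` {0<..}) \<and> integral ((\<lambda>x. x powr (- a)) ` {0<..}) f = integral {0<..} f"
    by (rule has_absolute_integral_change_of_variables_1'[OF _ der inj]) auto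
  then have ai: "(\<lambda>x. \<bar>(- a) * x powr (- a - 1)\<bar> * f (x powr (- a))) absolutely_integrable_on {0<..}"
    and eq: "integral {0<..} (\<lambda>x. \<bar>(- a) * x powr (- a - 1)\<bar> * f (x powr (- a))) = integral {0<..} f"
    using f' by (auto simp: img)
  have abs: "\<bar>(- a) * x powr (- a - 1)\<bar> = a * x powr (- a - 1)" for x using a by (simp add: abs_mult)
  have "(\<lambda>x. indicator {0<..} x *\<^sub>R (a * x powr (- a - 1) * f (x powr (- a)))) \<in> borel_measurable borel"
  proof -
    have "(\<lambda>x. (indicator {0<..} x * (a * x powr (- a - 1))) * (indicator {0<..} (x powr (- a)) *\<^sub>R f (x powr (- a)))) \<in> borel_measurable borel"
      by (intro borel_measurable_times measurable_compose[OF _ fm]) auto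
    moreover have "(\<lambda>x. (indicator {0<..} x * (a * x powr (- a - 1))) * (indicator {0<..} (x powr (- a)) *\<^sub>R f (x powr (- a))))
      = (\<lambda>x. indicator {0<..} x *\<^sub>R (a * x powr (- a - 1) * f (x powr (- a))))"
      by (auto split: split_indicator)
    ultimately show ?thesis by simp
  qed
  then have "set_integrable lborel {0<..} (\<lambda>x. a * x powr (- a - 1) * f (x powr (- a)))"
    using ai unfolding set_integrable_def abs by (subst (asm) integrable_completion) auto
  from set_borel_integral_eq_integral(2)[OF this] set_borel_integral_eq_integral(2)[OF f] eq[unfolded abs]
  show ?thesis by (simp only:)
qed

context semistable_renewal
begin

text \<open>Both exponents lie strictly between 1 and 2: \<open>W\<close> is integrable at infinity,
  and \<open>y * W y\<close> is integrable at 0.\<close>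

definition W :: "real \<Rightarrow> real" where "W y = y powr (- (1 / b1)) + y powr (- (1 / b2))"

lemma W_nonneg: "0 \<le> W y" by (simp add: W_def)

lemma p_nonneg: "0 \<le> p m n" by (simp add: p_def)

lemma p_bounds:
  "\<exists>K>0. \<exists>N\<ge>4. \<forall>n\<ge>N. 0 < B (real n) \<and> (\<forall>m\<ge>1. real n * p m n \<le> K * W (real m / B (real n)) \<and>
     real n * p m n \<le> K * (real m / B (real n)) * W (real m / B (real n)))"
proof -
  obtain K N where K: "0 < K" "4 \<le> N" "\<And>n. N \<le> n \<Longrightarrow> 0 < B n"
    and I: "\<And>n m. N \<le> n \<Longrightarrow> 1 \<le> m \<Longrightarrow> n * (LBINT t:{-4..4}. cmod (\<phi> t) ^ (m - 1)) \<le> K * W (real m / B n)"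
    using char_power_integral unfolding W_def by metis
  obtain C L0 where C: "0 < C" "1 \<le> L0"
    and inc: "\<And>L t d. L0 \<le> L \<Longrightarrow> cmod (\<phi> (t + d) - \<phi> t) \<le> (2 + \<bar>d\<bar> * L) * (C / B L)"
    using char_increment_bound by metis
  define K' where "K' = max K (6 * C * K)"
  have K': "0 < K'" "K \<le> K'" "6 * C * K \<le> K'" using K by (auto simp: K'_def less_max_iff_disj)
  have cont: "continuous_on A (\<lambda>t. \<phi> (t + d))" for A d
    by (intro continuous_at_imp_continuous_on ballI continuous_at_compose[of _ "\<lambda>t. t + d" \<phi>, unfolded comp_def] \<mu>.isCont_char) simp
  have si: "set_integrable lborel {a..b} (\<lambda>t. cmod (\<phi> (t + d)) ^ q)" for a b d q
    unfolding set_integrable_def by (intro borel_integrable_compact continuous_intros cont) auto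
  have si0: "set_integrable lborel {a..b} (\<lambda>t. cmod (\<phi> t) ^ q)" for a b q using si[of a b 0 q] by simp
  have main: "real n * p m n \<le> K' * W (real m / B (real n)) \<and>
     real n * p m n \<le> K' * (real m / B (real n)) * W (real m / B (real n))"
    if n: "max N L0 \<le> real n" and m: "1 \<le> m" for n m
  proof -
    have nn: "N \<le> real n" "L0 \<le> real n" "4 \<le> real n" using n K by auto
    have Bn: "0 < B (real n)" using K nn by auto
    define J where "J = (LBINT t:{-4..4}. cmod (\<phi> t) ^ (m - 1))"
    have J: "real n * J \<le> K * W (real m / B (real n))" unfolding J_def using nn m by (intro I) auto
    have J0: "0 \<le> J" unfolding J_def set_lebesgue_integral_def by (intro integral_nonneg_AE AE_I2) (auto split: split_indicator)
    \<comment> \<open>For \<open>n \<ge> 4\<close> the translate by \<open>d\<close> reaches at most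
      5 pi / 4, which is below 4; so \<open>J\<close> dominates both windows.\<close>
    define d where "d = pi / real n"
    have d: "0 < d" "d \<le> 4 - pi"
    proof -
      show "0 < d" using nn by (simp add: d_def)
      have "d \<le> pi / 4" unfolding d_def using nn by (intro divide_left_mono) auto
      also have "\<dots> \<le> 4 - pi"
      proof -
        have "pi \<le> 3.2" by (rule order.trans[OF pi_approx(2)]) simp
        then show ?thesis by simp
      qed
      finally show "d \<le> 4 - pi" .
    qed
    have Jd: "(LBINT t:{-pi..pi}. cmod (\<phi> (t + e)) ^ (m - 1)) \<le> J" if e: "e = 0 \<or> e = d" for e
    proof -
      have "(LBINT t:{-pi..pi}. cmod (\<phi> (t + e)) ^ (m - 1)) = (LBINT t. indicator {-pi + e..pi + e} t *\<^sub>R cmod (\<phi> t) ^ (m - 1))"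
        unfolding set_lebesgue_integral_def
        by (subst (2) lborel_integral_real_affine[where c=1 and t=e])
          (auto intro!: Bochner_Integration.integral_cong simp: add.commute split: split_indicator)
      also have "\<dots> \<le> J" unfolding J_def set_lebesgue_integral_def
        using e d si0 pi_gt3 pi_less_4 unfolding set_integrable_def by (intro integral_mono) (auto split: split_indicator)
      finally show ?thesis .
    qed
    have ci: "set_integrable lborel {a..b} (\<lambda>t. \<phi> (t + e) ^ m * iexp (- (t * real n)))" for a b e
      unfolding set_integrable_def by (intro borel_integrable_compact continuous_intros cont) auto
    have "2 * pi * p m n = cmod (CLBINT t:{-pi..pi}. \<phi> (t + 0) ^ m * iexp (- (t * real n)))"
      unfolding Fourier_coefficient by (simp add: norm_mult p_nonneg)
    also have "\<dots> \<le> (LBINT t:{-pi..pi}. cmod (\<phi> t) ^ (m - 1))"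
    proof (rule order.trans[OF set_integral_norm_bound[OF ci] set_integral_mono])
      show "set_integrable lborel {-pi..pi} (\<lambda>t. cmod (\<phi> (t + 0) ^ m * iexp (- (t * real n))))"
        by (rule set_integrable_norm[OF ci])
      show "cmod (\<phi> (t + 0) ^ m * iexp (- (t * real n))) \<le> cmod (\<phi> t) ^ (m - 1)" for t
        using power_decreasing[of "m - 1" m "cmod (\<phi> t)"] \<mu>.cmod_char_le_1[of t] by (simp add: norm_mult norm_power)
    qed (rule si0)
    also have "\<dots> \<le> J" using Jd[of 0] by simp
    finally have p1: "2 * pi * p m n \<le> J" .
    have "p m n \<le> 2 * pi * p m n" using p_nonneg[of m n] pi_gt3 by (simp add: mult_le_cancel_right1)
    then have "p m n \<le> J" using p1 by simp
    then have "real n * p m n \<le> real n * J" by (intro mult_left_mono) auto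
    then have A: "real n * p m n \<le> K' * W (real m / B (real n))"
      using J mult_right_mono[OF K'(2) W_nonneg[of "real m / B (real n)"]] by linarith
    \<comment> \<open>The translated integral is thus the negative of the plain one, and their
      difference is twice the Fourier coefficient in modulus.\<close>
    have e: "iexp (d * real n) = -1" using nn by (simp add: d_def)
    have "4 * pi * p m n = cmod ((CLBINT t:{-pi..pi}. \<phi> (t + d) ^ m * iexp (- (t * real n))) - (CLBINT t:{-pi..pi}. \<phi> (t + 0) ^ m * iexp (- (t * real n))))"
    proof -
      have "(CLBINT t:{-pi..pi}. \<phi> (t + d) ^ m * iexp (- (t * real n))) - (CLBINT t:{-pi..pi}. \<phi> (t + 0) ^ m * iexp (- (t * real n)))
          = of_real (- (4 * pi * p m n))"
        unfolding Fourier_coefficient e by simp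
      then show ?thesis using p_nonneg[of m n] by (simp only: norm_of_real) simp
    qed
    also have "\<dots> = cmod (CLBINT t:{-pi..pi}. \<phi> (t + d) ^ m * iexp (- (t * real n)) - \<phi> (t + 0) ^ m * iexp (- (t * real n)))"
      by (subst set_integral_diff(2)[OF ci ci]) simp
    also have "\<dots> \<le> (LBINT t:{-pi..pi}. (real m * (6 * (C / B (real n)))) * (cmod (\<phi> (t + d)) ^ (m - 1) + cmod (\<phi> t) ^ (m - 1)))"
    proof (rule order.trans[OF set_integral_norm_bound[OF set_integral_diff(1)[OF ci ci]] set_integral_mono])
      show "set_integrable lborel {-pi..pi} (\<lambda>t. cmod (\<phi> (t + d) ^ m * iexp (- (t * real n)) - \<phi> (t + 0) ^ m * iexp (- (t * real n))))"
        by (rule set_integrable_norm[OF set_integral_diff(1)[OF ci ci]])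
      show "set_integrable lborel {-pi..pi} (\<lambda>t. (real m * (6 * (C / B (real n)))) * (cmod (\<phi> (t + d)) ^ (m - 1) + cmod (\<phi> t) ^ (m - 1)))"
        by (rule set_integrable_mult_right) (rule set_integral_add(1)[OF si si0])
      fix t :: real
      have "\<phi> (t + d) ^ m * iexp (- (t * real n)) - \<phi> (t + 0) ^ m * iexp (- (t * real n)) = (\<phi> (t + d) ^ m - \<phi> t ^ m) * iexp (- (t * real n))"
        by (simp add: algebra_simps)
      then have "cmod (\<phi> (t + d) ^ m * iexp (- (t * real n)) - \<phi> (t + 0) ^ m * iexp (- (t * real n))) = cmod (\<phi> (t + d) ^ m - \<phi> t ^ m)"
        by (simp add: norm_mult del: of_real_mult of_real_minus)
      also have "\<dots> \<le> real m * cmod (\<phi> (t + d) - \<phi> t) * (cmod (\<phi> (t + d)) ^ (m - 1) + cmod (\<phi> t) ^ (m - 1))"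
        by (rule norm_power_diff_le)
      also have "\<dots> \<le> real m * (6 * (C / B (real n))) * (cmod (\<phi> (t + d)) ^ (m - 1) + cmod (\<phi> t) ^ (m - 1))"
      proof (intro mult_right_mono mult_left_mono)
        have "cmod (\<phi> (t + d) - \<phi> t) \<le> (2 + \<bar>d\<bar> * real n) * (C / B (real n))" by (rule inc[OF nn(2)])
        also have "\<bar>d\<bar> * real n = pi" using nn by (simp add: d_def)
        also have "(2 + pi) * (C / B (real n)) \<le> 6 * (C / B (real n))"
          using C Bn pi_less_4 by (intro mult_right_mono) auto
        finally show "cmod (\<phi> (t + d) - \<phi> t) \<le> 6 * (C / B (real n))" .
      qed auto
      finally show "cmod (\<phi> (t + d) ^ m * iexp (- (t * real n)) - \<phi> (t + 0) ^ m * iexp (- (t * real n)))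
        \<le> (real m * (6 * (C / B (real n)))) * (cmod (\<phi> (t + d)) ^ (m - 1) + cmod (\<phi> t) ^ (m - 1))" .
    qed
    also have "\<dots> = (real m * (6 * (C / B (real n)))) * ((LBINT t:{-pi..pi}. cmod (\<phi> (t + d)) ^ (m - 1)) + (LBINT t:{-pi..pi}. cmod (\<phi> t) ^ (m - 1)))"
      by (subst set_integral_mult_right) (simp only: set_integral_add(2)[OF si si0])
    also have "\<dots> \<le> (real m * (6 * (C / B (real n)))) * (J + J)"
      using Jd[of d] Jd[of 0] C Bn by (intro mult_left_mono add_mono) auto
    finally have "4 * pi * p m n \<le> 12 * C * (real m / B (real n)) * J" by (simp add: mult_ac)
    moreover have "12 * p m n \<le> 4 * pi * p m n" using pi_gt3 p_nonneg[of m n] by (intro mult_right_mono) auto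
    ultimately have "p m n \<le> C * (real m / B (real n)) * J" by simp
    then have "real n * p m n \<le> C * (real m / B (real n)) * (real n * J)"
      using mult_left_mono[of "p m n" "C * (real m / B (real n)) * J" "real n"] by (simp add: mult_ac)
    also have "\<dots> \<le> C * (real m / B (real n)) * (K * W (real m / B (real n)))"
      using J C Bn by (intro mult_left_mono) auto
    also have "\<dots> = C * K * ((real m / B (real n)) * W (real m / B (real n)))" by simp
    also have "\<dots> \<le> K' * ((real m / B (real n)) * W (real m / B (real n)))"
    proof (rule mult_right_mono)
      have "0 < C * K" using C K by simp
      moreover have "6 * (C * K) \<le> K'" using K'(3) by (simp only: mult.assoc)
      ultimately show "C * K \<le> K'" by linarith
      show "0 \<le> (real m / B (real n)) * W (real m / B (real n))"
        by (intro mult_nonneg_nonneg divide_nonneg_nonneg W_nonneg) (use Bn in simp_all)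
    qed
    finally have "real n * p m n \<le> K' * (real m / B (real n)) * W (real m / B (real n))" by (simp only: mult.assoc)
    with A show ?thesis by blast
  qed
  have "\<forall>n\<ge>nat \<lceil>max N L0\<rceil>. 0 < B (real n) \<and> (\<forall>m\<ge>1. real n * p m n \<le> K' * W (real m / B (real n)) \<and>
     real n * p m n \<le> K' * (real m / B (real n)) * W (real m / B (real n)))"
  proof (intro allI impI conjI)
    fix n assume "nat \<lceil>max N L0\<rceil> \<le> n"
    then have n: "max N L0 \<le> real n" by linarith
    then show "0 < B (real n)" using K by auto
    fix m :: nat assume m: "1 \<le> m"
    show "real n * p m n \<le> K' * W (real m / B (real n))" "real n * p m n \<le> K' * (real m / B (real n)) * W (real m / B (real n))"
      using main[OF n m] by auto
  qed
  moreover have "4 \<le> nat \<lceil>max N L0\<rceil>" using K by linarith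
  ultimately show ?thesis using K' by blast
qed

section \<open>Integrable domination of the renewal integrand\<close>

definition Dens :: "nat \<Rightarrow> real \<Rightarrow> real" where
  "Dens n y = real n * p (nat \<lfloor>B (real n) * y\<rfloor>) n"

definition dom :: "real \<Rightarrow> real" where "dom y = min 1 y * W y"

text \<open>Passes from \<open>w = m / B n\<close> to the continuous variable \<open>y\<close>. For
  \<open>m \<ge> 1\<close> rounding down at most halves, so \<open>y / 2 \<le> w \<le> y\<close> and
  \<open>W w\<close> is comparable with \<open>W y\<close>.\<close>

lemma Dens_bound: "\<exists>K>0. \<forall>\<^sub>F n in sequentially. 0 < B (real n) \<and> (\<forall>y>0. Dens n y \<le> K * dom y)"
proof -
  obtain K N where K: "0 < K" "4 \<le> N" "\<And>n. N \<le> n \<Longrightarrow> 0 < B (real n)"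
    and b: "\<And>n m. N \<le> n \<Longrightarrow> 1 \<le> m \<Longrightarrow> real n * p m n \<le> K * W (real m / B (real n))"
    "\<And>n m. N \<le> n \<Longrightarrow> 1 \<le> m \<Longrightarrow> real n * p m n \<le> K * (real m / B (real n)) * W (real m / B (real n))"
    using p_bounds by metis
  \<comment> \<open>The 4 is \<open>2 powr 2\<close>, an upper bound for
    \<open>2 powr (1 / b)\<close> when \<open>b > 1/2\<close>.\<close>
  have W4: "W w \<le> 4 * W y" if w: "y / 2 \<le> w" and y: "0 < y" for w y
  proof -
    have "w powr (- (1 / b)) \<le> 4 * y powr (- (1 / b))" if b: "1 / 2 < b" for b
    proof -
      have "w powr (- (1 / b)) \<le> (y / 2) powr (- (1 / b))" using w y b by (intro powr_mono2') auto
      also have "\<dots> = 2 powr (1 / b) * y powr (- (1 / b))" using y by (simp add: powr_divide powr_minus field_simps)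
      also have "2 powr (1 / b) \<le> 2 powr 2" using b by (intro powr_mono) (auto simp: field_simps)
      finally show ?thesis using y by simp
    qed
    from this[of b1] this[of b2] show ?thesis using b12 by (simp add: W_def)
  qed
  have "Dens n y \<le> 4 * K * dom y" if n: "N \<le> n" and y: "0 < y" for n y
  proof (cases "nat \<lfloor>B (real n) * y\<rfloor> = 0")
    case True
    \<comment> \<open>The empty sum is 0 and \<open>n\<close> is positive, so small \<open>y\<close>
      contribute nothing; no bound with \<open>m = 0\<close> is required.\<close>
    have "p 0 n = 0" using n K by (simp add: p_def partial_sum_def)
    then show ?thesis using True y K W_nonneg[of y] by (simp add: Dens_def dom_def)
  next
    case False
    define m where "m = nat \<lfloor>B (real n) * y\<rfloor>"
    define w where "w = real m / B (real n)"
    have m: "1 \<le> m" "real m \<le> B (real n) * y" "B (real n) * y < real m + 1" using False unfolding m_def by linarith+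
    have Bn: "0 < B (real n)" using K n by auto
    have w: "w \<le> y" "y / 2 \<le> w" "0 \<le> w" using m Bn by (auto simp: w_def field_simps)
    have "Dens n y \<le> K * W w" "Dens n y \<le> K * w * W w" unfolding Dens_def m_def[symmetric] w_def using b[OF n m(1)] by auto
    moreover have "K * W w \<le> K * (4 * W y)" using W4[OF w(2) y] K by (intro mult_left_mono) auto
    moreover have "K * w * W w \<le> K * y * (4 * W y)"
      using W4[OF w(2) y] K w y W_nonneg by (intro mult_mono) auto
    ultimately have "Dens n y \<le> 4 * K * (1 * W y)" "Dens n y \<le> 4 * K * (y * W y)" by (auto simp: mult_ac)
    then show ?thesis by (auto simp: dom_def min_def)
  qed
  moreover have "0 < 4 * K" using K by simp
  ultimately show ?thesis using K(3) unfolding eventually_sequentially by (intro exI[of _ "4 * K"] conjI exI[of _ N]) auto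
qed

text \<open>At 0 the powers have exponents \<open>1 / b - 1 < 1\<close>, because
  \<open>b > 1/2\<close>; at infinity \<open>1 / b > 1\<close>, because
  \<open>b < 1\<close>.\<close>

lemma dom_integrable: "set_integrable lborel {0<..} dom"
proof -
  have 1: "set_integrable lborel {0<..1} (\<lambda>y. y powr (- (1 / b1 - 1)) + y powr (- (1 / b2 - 1)))"
    using b12 by (intro set_integral_add set_integrable_powr_0) (auto simp: field_simps)
  have 2: "set_integrable lborel {1..} W"
    unfolding W_def[abs_def] using b12 by (intro set_integral_add set_integrable_powr_inf) (auto simp: field_simps)
  have eq: "dom y = y powr (- (1 / b1 - 1)) + y powr (- (1 / b2 - 1))" if "y \<in> {0<..1}" for y
  proof -
    have "y * y powr (- (1 / b)) = y powr (- (1 / b - 1))" for b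
      using that powr_mult_base[of y "- (1 / b)"] by simp
    then show ?thesis using that by (simp add: dom_def W_def distrib_left)
  qed
  have "set_integrable lborel {0<..1} dom"
    using 1 by (subst set_integrable_cong[OF refl refl eq])
  moreover have "set_integrable lborel {1..} dom"
    using 2 by (subst set_integrable_cong[OF refl refl, of _ _ W]) (auto simp: dom_def)
  ultimately have "set_integrable lborel ({0<..1} \<union> {1..}) dom"
    by (rule set_integrable_Un) auto
  moreover have "{0<..1} \<union> {1..} = {0::real<..}" by auto
  ultimately show ?thesis by simp
qed

end

section \<open>The strong renewal theorem\<close>

context semistable_renewal
begin

section \<open>Pointwise convergence of the integrand\<close>

lemma A_B_ratio: "((\<lambda>x. A (B x) / x) \<longlongrightarrow> 1) at_top"
proof -
  have "((\<lambda>x. exp (ln (A (B x)) - ln x)) \<longlongrightarrow> exp 0) at_top" by (intro tendsto_exp ln_A_B)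
  moreover have "\<forall>\<^sub>F x in at_top. exp (ln (A (B x)) - ln x) = A (B x) / x"
    using eventually_gt_filterlim[OF filterlim_compose[OF A_at_top B_at_top], where c=0]
      eventually_gt_at_top[of 0]
    by eventually_elim (simp add: exp_diff)
  ultimately show ?thesis by (simp add: tendsto_cong)
qed

text \<open>\<open>B n / k j\<close> tends to \<open>lam / y\<close>, so
  \<open>A (B n) / A (k j)\<close> tends to its power \<open>1 / \<alpha>\<close>. Since
  \<open>A (B n)\<close> is asymptotic to \<open>n\<close>, dividing \<open>n\<close> by
  \<open>y powr (- (1 / \<alpha>))\<close> gives exactly the scale that belongs to
  \<lambda>.\<close>

lemma scaling_renewal:
  fixes n j :: "nat \<Rightarrow> nat"
  assumes y: "0 < y" and lam: "0 < lam" and n: "filterlim n at_top sequentially" and j: "filterlim j at_top sequentially"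
    and lim: "(\<lambda>i. B (real (n i)) * y / real (k (j i))) \<longlonglongrightarrow> lam"
  shows "scaling lam j (\<lambda>i. nat \<lfloor>B (real (n i)) * y\<rfloor>) (\<lambda>i. real (n i) / y powr (- (1 / \<alpha>)))"
  unfolding scaling_def
proof (intro conjI lam j)
  have n_top: "filterlim (\<lambda>i. real (n i)) at_top sequentially" by (rule filterlim_compose[OF filterlim_real_sequentially n])
  have kj: "filterlim (\<lambda>i. real (k (j i))) at_top sequentially" by (rule filterlim_compose[OF k_top j])
  have evk: "\<forall>\<^sub>F i in sequentially. 0 < real (k (j i))" using eventually_gt_filterlim[OF kj, where c=0] .
  have evB: "\<forall>\<^sub>F i in sequentially. 0 < B (real (n i))"
    using eventually_gt_filterlim[OF filterlim_compose[OF B_at_top n_top], where c=0] .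
  have "(\<lambda>i. B (real (n i)) * y / real (k (j i)) - 1 / real (k (j i))) \<longlonglongrightarrow> lam - 0"
    by (intro tendsto_diff lim tendsto_divide_0[OF tendsto_const filterlim_at_top_imp_at_infinity[OF kj]])
  then have lo: "(\<lambda>i. B (real (n i)) * y / real (k (j i)) - 1 / real (k (j i))) \<longlonglongrightarrow> lam" by simp
  show "(\<lambda>i. real (nat \<lfloor>B (real (n i)) * y\<rfloor>) / real (k (j i))) \<longlonglongrightarrow> lam"
  proof (rule tendsto_sandwich[OF _ _ lo lim])
    show "\<forall>\<^sub>F i in sequentially. B (real (n i)) * y / real (k (j i)) - 1 / real (k (j i)) \<le> real (nat \<lfloor>B (real (n i)) * y\<rfloor>) / real (k (j i))"
      using evk
    proof eventually_elim
      case (elim i)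
      have "B (real (n i)) * y - 1 \<le> real (nat \<lfloor>B (real (n i)) * y\<rfloor>)" by linarith
      then have "(B (real (n i)) * y - 1) / real (k (j i)) \<le> real (nat \<lfloor>B (real (n i)) * y\<rfloor>) / real (k (j i))"
        by (intro divide_right_mono) auto
      then show ?case by (simp add: diff_divide_distrib)
    qed
    show "\<forall>\<^sub>F i in sequentially. real (nat \<lfloor>B (real (n i)) * y\<rfloor>) / real (k (j i)) \<le> B (real (n i)) * y / real (k (j i))"
      using evk evB
    proof eventually_elim
      case (elim i)
      have "0 \<le> B (real (n i)) * y" using elim y by simp
      then have "real (nat \<lfloor>B (real (n i)) * y\<rfloor>) \<le> B (real (n i)) * y" by linarith
      then show ?case by (intro divide_right_mono) auto
    qed
  qed
  have "(\<lambda>i. 1 / y * (B (real (n i)) * y / real (k (j i)))) \<longlonglongrightarrow> 1 / y * lam"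
    by (intro tendsto_mult_left lim)
  then have "(\<lambda>i. B (real (n i)) / real (k (j i))) \<longlonglongrightarrow> lam / y" using y by simp
  from log_regular_ratio[OF A_regular kj this]
  have "(\<lambda>i. A (B (real (n i))) / A (real (k (j i)))) \<longlonglongrightarrow> (lam / y) powr (1 / \<alpha>)" using lam y by simp
  from tendsto_mult[OF tendsto_divide[OF this filterlim_compose[OF A_B_ratio n_top]] tendsto_const[of "y powr (1 / \<alpha>)"]]
  have "(\<lambda>i. A (B (real (n i))) / A (real (k (j i))) / (A (B (real (n i))) / real (n i)) * y powr (1 / \<alpha>))
      \<longlonglongrightarrow> (lam / y) powr (1 / \<alpha>) / 1 * y powr (1 / \<alpha>)" by simp
  moreover have "(lam / y) powr (1 / \<alpha>) / 1 * y powr (1 / \<alpha>) = lam powr (1 / \<alpha>)"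
    using lam y by (simp add: powr_mult[symmetric])
  moreover have "\<forall>\<^sub>F i in sequentially. A (B (real (n i))) / A (real (k (j i))) / (A (B (real (n i))) / real (n i)) * y powr (1 / \<alpha>)
      = real (n i) / y powr (- (1 / \<alpha>)) / A (real (k (j i)))"
    using eventually_gt_filterlim[OF filterlim_compose[OF A_at_top filterlim_compose[OF B_at_top n_top]], where c=0]
    by eventually_elim (simp add: powr_minus field_simps)
  ultimately show "(\<lambda>i. real (n i) / y powr (- (1 / \<alpha>)) / A (real (k (j i)))) \<longlonglongrightarrow> lam powr (1 / \<alpha>)"
    using Lim_transform_eventually by fastforce
qed

text \<open>The substitution \<open>t = s * x / n\<close> turns the frequency factor into
  \<open>iexp (- (s * x))\<close>, which no longer depends on \<open>n\<close>.\<close>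

lemma Dens_Fourier:
  assumes n: "0 < real n" and x: "0 < x"
  shows "real n * p m n = x / (2 * pi) * Re (CLBINT s. indicator {-pi..pi} (s / (real n / x)) *\<^sub>R (\<phi> (s / (real n / x)) ^ m * iexp (- (s * x))))"
proof -
  let ?L = "real n / x"
  have L: "0 < ?L" using n x by simp
  let ?f = "\<lambda>t. indicator {-pi..pi} t *\<^sub>R (\<phi> (t + 0) ^ m * iexp (- (t * real n)))"
  have "(CLBINT t. ?f t) = of_real (2 * pi * p m n)"
    using Fourier_coefficient[of 0 m n] by (simp add: set_lebesgue_integral_def)
  also have "(CLBINT t. ?f t) = \<bar>1 / ?L\<bar> *\<^sub>R (CLBINT s. ?f (0 + 1 / ?L * s))"
    by (rule lborel_integral_real_affine) (use n x in simp)
  also have "(\<lambda>s. ?f (0 + 1 / ?L * s)) = (\<lambda>s. indicator {-pi..pi} (s / ?L) *\<^sub>R (\<phi> (s / ?L) ^ m * iexp (- (s * x))))"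
  proof
    fix s
    have "1 / ?L * s * real n = s * x" "0 + 1 / ?L * s = s / ?L" using n x by simp_all
    then show "?f (0 + 1 / ?L * s) = indicator {-pi..pi} (s / ?L) *\<^sub>R (\<phi> (s / ?L) ^ m * iexp (- (s * x)))"
      by (simp only: add_0_right add_0_left mult.commute mult.assoc)
  qed
  finally have "Re (of_real (2 * pi * p m n)) = Re (\<bar>1 / ?L\<bar> *\<^sub>R (CLBINT s. indicator {-pi..pi} (s / ?L) *\<^sub>R (\<phi> (s / ?L) ^ m * iexp (- (s * x)))))"
    by (simp only:)
  then have "2 * pi * p m n = x / real n * Re (CLBINT s. indicator {-pi..pi} (s / ?L) *\<^sub>R (\<phi> (s / ?L) ^ m * iexp (- (s * x))))"
    using n x by simp
  moreover have "real n * q = x / (2 * pi) * I" if "2 * pi * q = x / real n * I" for q I :: real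
  proof -
    have "2 * pi * (real n * q) = real n * (2 * pi * q)" by simp
    also have "\<dots> = x * I" unfolding that using n by simp
    finally show ?thesis by (simp add: field_simps)
  qed
  ultimately show ?thesis by blast
qed

definition target :: "real \<Rightarrow> real \<Rightarrow> real" where
  "target lam y = y powr (- (1 / \<alpha>)) * g lam (y powr (- (1 / \<alpha>)))"

lemma target_nonneg: "0 < lam \<Longrightarrow> 0 \<le> target lam y"
  by (simp add: target_def g_nonneg)

lemma Dens_limit:
  fixes n j :: "nat \<Rightarrow> nat"
  assumes y: "0 < y" and lam: "0 < lam" and n: "filterlim n at_top sequentially" and j: "filterlim j at_top sequentially"
    and lim: "(\<lambda>i. B (real (n i)) * y / real (k (j i))) \<longlonglongrightarrow> lam"
  shows "(\<lambda>i. Dens (n i) y) \<longlonglongrightarrow> target lam y"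
proof -
  define x where "x = y powr (- (1 / \<alpha>))"
  have x: "0 < x" using y by (simp add: x_def)
  define m where "m i = nat \<lfloor>B (real (n i)) * y\<rfloor>" for i
  define L where "L i = real (n i) / x" for i
  have sc: "scaling lam j m L"
    using scaling_renewal[OF assms] by (simp add: m_def[abs_def] L_def[abs_def] x_def)
  obtain C0 L0 where C0: "0 < C0" and L0: "1 \<le> L0" "\<And>L. L0 \<le> L \<Longrightarrow> 0 < B L"
    and bd: "\<And>L s. L0 \<le> L \<Longrightarrow> \<bar>s\<bar> \<le> 4 * L \<Longrightarrow> cmod (\<phi> (s / L)) \<le> exp (- (C0 * \<kappa> s / B L))"
    using norm_char_bound by metis
  have "\<forall>\<^sub>F i in sequentially. L0 \<le> L i \<and> 1 / 2 < real (m i) / B (L i) \<and> 0 < n i"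
    using eventually_ge_filterlim[OF scaling_L_top[OF sc], where c=L0]
      order_tendstoD(1)[OF scaling_m_B[OF sc], of "1 / 2", simplified]
      eventually_ge_filterlim[OF n, where c=1]
    by eventually_elim auto
  then obtain N where N: "\<And>i. N \<le> i \<Longrightarrow> L0 \<le> L i \<and> 1 / 2 < real (m i) / B (L i) \<and> 0 < n i"
    unfolding eventually_sequentially by blast
  define f where "f i s = indicator {-pi..pi} (s / L i) *\<^sub>R (\<phi> (s / L i) ^ m i * iexp (- (s * x)))" for i s
  have fm: "f i \<in> borel_measurable lborel" for i unfolding f_def by measurable
  have "(\<lambda>i. CLBINT s. f (i + N) s) \<longlonglongrightarrow> (CLBINT s. exp (\<Psi> lam s) * iexp (- (s * x)))"
  \<comment> \<open>The factor 1/2 comes from \<open>m i / B (L i) > 1/2\<close>, valid from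
    \<open>N\<close> on.\<close>
  proof (rule integral_dominated_convergence[where w="\<lambda>s. exp (- (C0 / 2 * \<kappa> s))"])
    show "integrable lborel (\<lambda>s. exp (- (C0 / 2 * \<kappa> s)))" using C0 by (intro integrable_exp_\<kappa>) auto
    show "AE s in lborel. norm (f (i + N) s) \<le> exp (- (C0 / 2 * \<kappa> s))" for i
    proof (rule AE_I2)
      fix s :: real
      have Ni: "L0 \<le> L (i + N)" "1 / 2 < real (m (i + N)) / B (L (i + N))" using N[of "i + N"] by auto
      have Lp: "0 < L (i + N)" using Ni L0 by linarith
      show "norm (f (i + N) s) \<le> exp (- (C0 / 2 * \<kappa> s))"
      proof (cases "s / L (i + N) \<in> {-pi..pi}")
        case True
        then have "\<bar>s / L (i + N)\<bar> \<le> pi" by (intro abs_leI) auto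
        then have "\<bar>s / L (i + N)\<bar> \<le> 4" using pi_less_4 by linarith
        then have "\<bar>s\<bar> \<le> 4 * L (i + N)" using Lp by (simp add: abs_divide field_simps)
        from bd[OF Ni(1) this]
        have "cmod (\<phi> (s / L (i + N))) ^ m (i + N) \<le> exp (- (C0 * \<kappa> s / B (L (i + N)))) ^ m (i + N)"
          by (intro power_mono) auto
        also have "\<dots> = exp (real (m (i + N)) * - (C0 * \<kappa> s / B (L (i + N))))" by (simp only: exp_of_nat_mult)
        also have "\<dots> \<le> exp (- (C0 / 2 * \<kappa> s))"
        proof -
          have "1 / 2 * (C0 * \<kappa> s) \<le> real (m (i + N)) / B (L (i + N)) * (C0 * \<kappa> s)"
            using Ni(2) C0 \<kappa>_nonneg[of s] by (intro mult_right_mono) auto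
          then show ?thesis by (simp only: exp_le_cancel_iff) (simp add: mult_ac)
        qed
        finally show ?thesis using True by (simp add: f_def norm_mult norm_power del: of_real_mult of_real_minus)
      qed (simp add: f_def)
    qed
    show "AE s in lborel. (\<lambda>i. f (i + N) s) \<longlonglongrightarrow> exp (\<Psi> lam s) * iexp (- (s * x))"
    proof (rule AE_I2)
      fix s :: real
      have "(\<lambda>i. \<phi> (s / L i) ^ m i * iexp (- (s * x))) \<longlonglongrightarrow> exp (\<Psi> lam s) * iexp (- (s * x))"
        by (intro tendsto_intros scaling_char[OF sc])
      moreover have "\<forall>\<^sub>F i in sequentially. \<phi> (s / L i) ^ m i * iexp (- (s * x)) = f i s"
        using eventually_ge_filterlim[OF scaling_L_top[OF sc], where c="max 1 \<bar>s\<bar>"]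
      proof eventually_elim
        case (elim i)
        then have "\<bar>s / L i\<bar> \<le> 1" by (simp add: abs_divide)
        then have "s / L i \<le> 1" "- 1 \<le> s / L i" by linarith+
        then have "s / L i \<in> {-pi..pi}" using pi_gt3 by auto
        then show ?case by (simp add: f_def)
      qed
      ultimately have "(\<lambda>i. f i s) \<longlonglongrightarrow> exp (\<Psi> lam s) * iexp (- (s * x))" by (rule Lim_transform_eventually)
      then show "(\<lambda>i. f (i + N) s) \<longlonglongrightarrow> exp (\<Psi> lam s) * iexp (- (s * x))" by (rule LIMSEQ_ignore_initial_segment)
    qed
  qed (use fm lam in auto)
  then have "(\<lambda>i. x / (2 * pi) * Re (CLBINT s. f (i + N) s)) \<longlonglongrightarrow> x / (2 * pi) * Re (CLBINT s. exp (\<Psi> lam s) * iexp (- (s * x)))"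
    by (intro tendsto_intros)
  moreover have "x / (2 * pi) * Re (CLBINT s. f (i + N) s) = Dens (n (i + N)) y" for i
    using Dens_Fourier[of "n (i + N)" x "m (i + N)"] N[of "i + N"] x
    by (simp add: Dens_def m_def f_def L_def)
  moreover have "x / (2 * pi) * Re (CLBINT s. exp (\<Psi> lam s) * iexp (- (s * x))) = target lam y"
    by (simp add: target_def x_def g_eq[OF lam])
  ultimately have "(\<lambda>i. Dens (n (i + N)) y) \<longlonglongrightarrow> target lam y" by (simp only:)
  then show ?thesis by (rule LIMSEQ_offset)
qed

text \<open>Every pair of \<lambda> and \<open>y\<close> arises in \<open>Dens_limit\<close> for
  suitable \<open>n i\<close>, so the bound for \<open>Dens\<close> passes to \<open>target\<close>,
  uniformly in \<lambda>.\<close>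

lemma target_bound: "\<exists>K>0. \<forall>lam>0. \<forall>y>0. target lam y \<le> K * dom y"
proof -
  obtain K where K: "0 < K" and ev: "\<forall>\<^sub>F n in sequentially. 0 < B (real n) \<and> (\<forall>y>0. Dens n y \<le> K * dom y)"
    using Dens_bound by blast
  have "target lam y \<le> K * dom y" if lam: "0 < lam" and y: "0 < y" for lam y
  proof -
    define t where "t = (lam / y) powr (1 / \<alpha>)"
    have t: "0 < t" "t powr \<alpha> = lam / y" using lam y alpha_pos by (simp_all add: t_def powr_powr)
    \<comment> \<open>\<open>n i\<close> is about \<open>t * A (k i)\<close>, so
      \<open>B (n i)\<close> is about \<open>t powr \<alpha> * k i\<close>; the choice of
      \<open>t\<close> makes \<open>B (n i) * y / k i\<close> tend to \<lambda>.\<close>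
    define n where "n i = nat \<lceil>A (real (k i)) * t\<rceil>" for i
    have evA: "\<forall>\<^sub>F i in sequentially. 0 < A (real (k i))" using eventually_gt_filterlim[OF Ak_top, where c=0] .
    have lo: "\<forall>\<^sub>F i in sequentially. A (real (k i)) * t \<le> real (n i)"
      by (intro always_eventually allI) (simp add: n_def real_nat_ceiling_ge)
    have real_n: "filterlim (\<lambda>i. real (n i)) at_top sequentially"
      by (rule filterlim_at_top_mono[OF A_k_mult_top[OF t(1)] lo])
    then have n_top: "filterlim n at_top sequentially"
      by (simp add: filterlim_sequentially_iff_filterlim_real)
    have ratio: "(\<lambda>i. real (n i) / A (real (k i))) \<longlonglongrightarrow> t"
    proof (rule tendsto_sandwich[OF _ _ tendsto_const[of t]])
      show "\<forall>\<^sub>F i in sequentially. t \<le> real (n i) / A (real (k i))"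
        using lo evA by eventually_elim (simp add: field_simps)
      show "\<forall>\<^sub>F i in sequentially. real (n i) / A (real (k i)) \<le> t + 1 / A (real (k i))"
        using evA
      proof eventually_elim
        case (elim i)
        have "0 \<le> A (real (k i)) * t" using elim t by simp
        then have "real (n i) \<le> A (real (k i)) * t + 1" unfolding n_def by linarith
        then have "real (n i) / A (real (k i)) \<le> (A (real (k i)) * t + 1) / A (real (k i))" using elim by (intro divide_right_mono) auto
        then show ?case using elim by (simp add: add_divide_distrib)
      qed
      have "(\<lambda>i. t + 1 / A (real (k i))) \<longlonglongrightarrow> t + 0"
        by (intro tendsto_intros tendsto_divide_0[OF tendsto_const filterlim_at_top_imp_at_infinity[OF Ak_top]])
      then show "(\<lambda>i. t + 1 / A (real (k i))) \<longlonglongrightarrow> t" by simp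
    qed
    have "(\<lambda>i. B (real (n i)) / B (A (real (k i))) * (B (A (real (k i))) / real (k i)) * y) \<longlonglongrightarrow> t powr \<alpha> * 1 * y"
      by (intro tendsto_intros log_regular_ratio[OF B_regular Ak_top ratio t(1)] B_Ak)
    moreover have "t powr \<alpha> * 1 * y = lam" using t y by simp
    moreover have "\<forall>\<^sub>F i in sequentially. B (real (n i)) / B (A (real (k i))) * (B (A (real (k i))) / real (k i)) * y = B (real (n i)) * y / real (k (id i))"
      using eventually_gt_filterlim[OF filterlim_compose[OF B_at_top Ak_top], where c=0] by eventually_elim simp
    ultimately have "(\<lambda>i. B (real (n i)) * y / real (k (id i))) \<longlonglongrightarrow> lam"
      using Lim_transform_eventually by fastforce
    moreover have "filterlim id at_top sequentially" by (simp add: filterlim_ident id_def)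
    ultimately have "(\<lambda>i. Dens (n i) y) \<longlonglongrightarrow> target lam y"
      using Dens_limit[OF y lam n_top] by blast
    moreover have "\<forall>\<^sub>F i in sequentially. Dens (n i) y \<le> K * dom y"
      using eventually_compose_filterlim[OF ev n_top] by eventually_elim (use y in auto)
    ultimately show ?thesis by (intro tendsto_upperbound) auto
  qed
  then show ?thesis using K by blast
qed

section \<open>The position parameter\<close>

text \<open>For \<open>z > 0\<close> this is the index under the \<open>THE\<close> in
  \<open>position\<close>; for \<open>z \<le> 0\<close> it is 0. Being defined everywhere and
  monotone, it is convenient for measurability.\<close>

definition index :: "real \<Rightarrow> nat" where "index z = (LEAST j. z \<le> real (k j))"

lemma index_le: "z \<le> real (k (index z))"
  unfolding index_def
proof (rule LeastI_ex)
  have "\<forall>\<^sub>F j in sequentially. z \<le> real (k j)" using k_top by (simp add: filterlim_at_top)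
  then show "\<exists>j. z \<le> real (k j)" by (auto simp: eventually_sequentially)
qed

lemma index_least: "z \<le> real (k j) \<Longrightarrow> index z \<le> j"
  unfolding index_def by (rule Least_le)

lemma position_eq:
  assumes z: "0 < z"
  shows "position k z = z / real (k (index z))" "1 \<le> index z" "real (k (index z - 1)) < z"
proof -
  show 1: "1 \<le> index z" using index_le[of z] z k(1) by (cases "index z") auto
  show 2: "real (k (index z - 1)) < z" using index_least[of z "index z - 1"] 1 by (cases "z \<le> real (k (index z - 1))") auto
  have "(THE n. 1 \<le> n \<and> real (k (n - 1)) < z \<and> z \<le> real (k n)) = index z"
  proof (rule the_equality)
    show "1 \<le> index z \<and> real (k (index z - 1)) < z \<and> z \<le> real (k (index z))" using 1 2 index_le by auto
    fix n assume n: "1 \<le> n \<and> real (k (n - 1)) < z \<and> z \<le> real (k n)"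
    have "real (k (n - 1)) < real (k (index z))" using n index_le[of z] by linarith
    then have "n - 1 < index z" using strict_mono_less[OF k(2)] by simp
    moreover have "index z \<le> n" using n by (intro index_least) auto
    ultimately show "n = index z" using n by linarith
  qed
  then show "position k z = z / real (k (index z))" by (simp add: position_def)
qed

lemma position_pos: "0 < z \<Longrightarrow> 0 < position k z"
  using position_eq k_ge_1 by (simp add: divide_pos_pos less_le_trans[OF zero_less_one])

lemma position_le_1: "0 < z \<Longrightarrow> position k z \<le> 1"
  using position_eq index_le[of z] by (simp add: divide_le_eq_1)

lemma index_at_top: "filterlim index at_top at_top"
  unfolding filterlim_at_top
proof
  fix N
  show "\<forall>\<^sub>F z in at_top. N \<le> index z"
    using eventually_gt_at_top[of "real (k N)"]
  proof eventually_elim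
    case (elim z)
    then have "real (k N) < real (k (index z))" using index_le[of z] by linarith
    then show ?case using strict_mono_less[OF k(2)] by (simp add: less_imp_le)
  qed
qed

text \<open>Consecutive \<open>k\<close> eventually have ratio below \<open>2 * c\<close>. The
  positions therefore stay in a compact subset of the positive axis, and their limit points are
  admissible parameters.\<close>

lemma position_lower: "\<forall>\<^sub>F z in at_top. 1 / (2 * c) \<le> position k z"
proof -
  have "\<forall>\<^sub>F j in sequentially. real (k (j + 1)) / real (k j) < 2 * c \<and> 1 \<le> j"
    using order_tendstoD(2)[OF k(3), of "2 * c"] c eventually_ge_at_top[of 1] by (auto simp: eventually_conj_iff)
  then obtain N where N: "\<And>j. N \<le> j \<Longrightarrow> real (k (j + 1)) / real (k j) < 2 * c \<and> 1 \<le> j"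
    unfolding eventually_sequentially by blast
  show ?thesis
    using eventually_gt_at_top[of 0] eventually_ge_filterlim[OF index_at_top, where c="N + 1"]
  proof eventually_elim
    case (elim z)
    define j where "j = index z - 1"
    have j: "N \<le> j" "index z = j + 1" using elim by (auto simp: j_def)
    have kj: "0 < real (k j)" "0 < real (k (j + 1))" using N[OF j(1)] k_ge_1[of j] k_ge_1[of "j + 1"] by auto
    have "real (k j) < z" using position_eq(3)[OF elim(1)] by (simp add: j_def)
    moreover have "real (k (j + 1)) \<le> 2 * c * real (k j)" using N[OF j(1)] kj by (simp add: field_simps)
    ultimately have "real (k (j + 1)) \<le> 2 * c * z" using c by (smt (verit) mult_le_cancel_left_pos)
    then have "1 / (2 * c) \<le> z / real (k (j + 1))" using kj c by (simp add: field_simps)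
    then show ?case unfolding position_eq(1)[OF elim(1)] j(2) .
  qed
qed

lemma Dens_minus_target:
  assumes y: "0 < y"
  shows "(\<lambda>n. Dens n y - target (position k (B (real n) * y)) y) \<longlonglongrightarrow> 0"
proof (rule ccontr)
  let ?l = "\<lambda>n. position k (B (real n) * y)"
  assume "\<not> ?thesis"
  then obtain e where e: "0 < e" "\<not> (\<forall>\<^sub>F n in sequentially. \<bar>Dens n y - target (?l n) y\<bar> < e)"
    by (auto simp: tendsto_iff dist_real_def)
  have Bn: "filterlim (\<lambda>n. B (real n)) at_top sequentially"
    by (rule filterlim_compose[OF B_at_top filterlim_real_sequentially])
  have By: "filterlim (\<lambda>n. B (real n) * y) at_top sequentially"
    by (rule filterlim_at_top_mult_tendsto_pos[OF tendsto_const y Bn])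
  have "\<exists>\<^sub>F n in sequentially. e \<le> \<bar>Dens n y - target (?l n) y\<bar>" using e(2) by (simp add: frequently_def not_le)
  moreover have "\<forall>\<^sub>F n in sequentially. 0 < B (real n) * y \<and> 1 / (2 * c) \<le> ?l n"
    using eventually_gt_filterlim[OF By, where c=0]
      eventually_compose_filterlim[OF position_lower By]
    by eventually_elim auto
  then have "\<forall>\<^sub>F n in sequentially. e \<le> \<bar>Dens n y - target (?l n) y\<bar> \<longrightarrow>
      e \<le> \<bar>Dens n y - target (?l n) y\<bar> \<and> 0 < B (real n) * y \<and> 1 / (2 * c) \<le> ?l n"
    by eventually_elim blast
  ultimately have "\<exists>\<^sub>F n in sequentially. e \<le> \<bar>Dens n y - target (?l n) y\<bar> \<and> 0 < B (real n) * y \<and> 1 / (2 * c) \<le> ?l n"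
    by (rule frequently_rev_mp)
  then have "infinite {n. e \<le> \<bar>Dens n y - target (?l n) y\<bar> \<and> 0 < B (real n) * y \<and> 1 / (2 * c) \<le> ?l n}"
    by (simp add: frequently_cofinite[symmetric] cofinite_eq_sequentially)
  then obtain r :: "nat \<Rightarrow> nat" where r: "strict_mono r"
    and rr: "\<And>i. e \<le> \<bar>Dens (r i) y - target (?l (r i)) y\<bar> \<and> 0 < B (real (r i)) * y \<and> 1 / (2 * c) \<le> ?l (r i)"
    using infinite_enumerate by blast
  have "?l (r i) \<in> {1 / (2 * c)..1}" for i using rr[of i] position_le_1 by simp
  \<comment> \<open>Compactness supplies a limit of positions along a further subsequence; the lower
    endpoint keeps it positive.\<close>
  then obtain lam s where lam: "lam \<in> {1 / (2 * c)..1}" and s: "strict_mono (s :: nat \<Rightarrow> nat)"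
    and lim: "((\<lambda>i. ?l (r i)) \<circ> s) \<longlonglongrightarrow> lam"
    using compact_Icc[of "1 / (2 * c)" 1] unfolding compact_def by metis
  have lam0: "0 < lam" using lam c by (auto intro: less_le_trans[of 0 "1 / (2 * c)"])
  have rs: "filterlim (\<lambda>i. r (s i)) at_top sequentially"
    using filterlim_compose[OF filterlim_subseq[OF r] filterlim_subseq[OF s]] .
  have lim': "(\<lambda>i. ?l (r (s i))) \<longlonglongrightarrow> lam" using lim by (simp add: comp_def)
  have "(\<lambda>i. Dens (r (s i)) y) \<longlonglongrightarrow> target lam y"
  proof (rule Dens_limit[OF y lam0 rs])
    show "filterlim (\<lambda>i. index (B (real (r (s i))) * y)) at_top sequentially"
      by (rule filterlim_compose[OF index_at_top filterlim_compose[OF By rs]])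
    have "?l (r (s i)) = B (real (r (s i))) * y / real (k (index (B (real (r (s i))) * y)))" for i
      using rr[of "s i"] by (intro position_eq) auto
    then show "(\<lambda>i. B (real (r (s i))) * y / real (k (index (B (real (r (s i))) * y)))) \<longlonglongrightarrow> lam"
      using lim' by simp
  qed
  moreover have "(\<lambda>i. target (?l (r (s i))) y) \<longlonglongrightarrow> target lam y"
    unfolding target_def using rr position_pos
    by (intro tendsto_intros g_continuous lam0 lim') auto
  ultimately have "(\<lambda>i. \<bar>Dens (r (s i)) y - target (?l (r (s i))) y\<bar>) \<longlonglongrightarrow> \<bar>target lam y - target lam y\<bar>"
    by (intro tendsto_intros)
  then have "e \<le> \<bar>target lam y - target lam y\<bar>" by (rule tendsto_lowerbound) (use rr in auto)
  then show False using e by simp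
qed

lemma position_measurable: "(\<lambda>z. if 0 < z then position k z else 1) \<in> borel_measurable borel"
proof -
  have "mono (\<lambda>z. if 0 < z then real (k (index z)) else 0)"
  proof (rule monoI)
    fix z w :: real assume "z \<le> w"
    moreover have "index z \<le> index w" using \<open>z \<le> w\<close> index_le[of w] by (intro index_least) linarith
    ultimately show "(if 0 < z then real (k (index z)) else 0) \<le> (if 0 < w then real (k (index w)) else 0)"
      using strict_mono_less_eq[OF k(2)] by auto
  qed
  then have [measurable]: "(\<lambda>z. if 0 < z then real (k (index z)) else 0) \<in> borel_measurable borel" by (rule borel_measurable_mono)
  have "(\<lambda>z. if 0 < z then position k z else 1) = (\<lambda>z. if 0 < z then z / (if 0 < z then real (k (index z)) else 0) else 1)"
    using position_eq(1) by auto
  then show ?thesis by simp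
qed

text \<open>\<open>y\<close> enters both as argument and through the parameter, so \<open>g\<close>
  is treated as a continuous function of the pair and composed with a Borel map into the
  plane.\<close>

lemma target_measurable:
  assumes b: "0 < b"
  shows "(\<lambda>y. indicator {0<..} y *\<^sub>R target (position k (b * y)) y) \<in> borel_measurable borel"
proof -
  let ?G = "\<lambda>z::real \<times> real. g (fst z) (snd z)"
  let ?A = "({0<..} :: real set) \<times> (UNIV :: real set)"
  have "continuous_on ?A ?G"
    unfolding continuous_on_sequentially comp_def
  proof (intro allI ballI impI)
    fix z :: "nat \<Rightarrow> real \<times> real" and a assume "a \<in> ?A" and z: "(\<forall>n. z n \<in> ?A) \<and> z \<longlonglongrightarrow> a"
    then show "(\<lambda>n. g (fst (z n)) (snd (z n))) \<longlonglongrightarrow> g (fst a) (snd a)"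
      by (intro g_continuous tendsto_fst tendsto_snd) (auto simp: mem_Times_iff)
  qed
  moreover have "open ?A" by (intro open_Times) auto
  ultimately have G: "(\<lambda>z. indicator ?A z *\<^sub>R ?G z) \<in> borel_measurable borel"
    by (intro borel_measurable_continuous_on_indicator) auto
  define q where "q y = (if 0 < b * y then position k (b * y) else 1)" for y
  have [measurable]: "q \<in> borel_measurable borel"
    unfolding q_def by (rule measurable_compose[OF _ position_measurable]) simp
  have "(\<lambda>y. (q y, y powr (- (1 / \<alpha>)))) \<in> borel_measurable borel" by simp
  from measurable_compose[OF this G]
  have "(\<lambda>y. indicator {0<..} y * y powr (- (1 / \<alpha>)) * (indicator ?A (q y, y powr (- (1 / \<alpha>))) *\<^sub>R g (q y) (y powr (- (1 / \<alpha>))))) \<in> borel_measurable borel"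
    by (intro borel_measurable_times) auto
  moreover have "(\<lambda>y. indicator {0<..} y * y powr (- (1 / \<alpha>)) * (indicator ?A (q y, y powr (- (1 / \<alpha>))) *\<^sub>R g (q y) (y powr (- (1 / \<alpha>)))))
    = (\<lambda>y. indicator {0<..} y *\<^sub>R target (position k (b * y)) y)"
    using position_pos b by (auto simp: q_def target_def split: split_indicator)
  ultimately show ?thesis by (simp only:)
qed

lemma Dens_measurable [measurable]: "Dens n \<in> borel_measurable borel"
proof -
  have "(\<lambda>y. p (nat \<lfloor>B (real n) * y\<rfloor>) n) \<in> borel_measurable borel"
    by (rule measurable_compose_countable[where g="\<lambda>y. nat \<lfloor>B (real n) * y\<rfloor>" and f="\<lambda>m y. p m n"]) auto
  then show ?thesis unfolding Dens_def[abs_def] by simp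
qed

section \<open>Integration and conclusion\<close>

text \<open>\<open>Dens n\<close> is a step function, equal to \<open>n * p m n\<close> on an
  interval of length \<open>1 / B n\<close>. Integration term by term is done in
  \<open>ennreal\<close>, where it holds before any summability is known.\<close>

lemma Dens_integral:
  assumes Bn: "0 < B (real n)" and int: "set_integrable lborel {0<..} (Dens n)"
  shows "(LBINT y:{0<..}. Dens n y) = real n / B (real n) * renewal_mass P X n"
proof -
  let ?b = "B (real n)"
  let ?q = "\<lambda>m. real n * p m n"
  have q0: "0 \<le> ?q m" for m using p_nonneg by simp
  have pt: "ennreal (indicator {0<..} y *\<^sub>R Dens n y) = (\<Sum>m. ennreal (?q m) * indicator ({real m / ?b..<(real m + 1) / ?b} \<inter> {0<..}) y)" for y
  proof (cases "0 < y")
    case True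
    define m0 where "m0 = nat \<lfloor>?b * y\<rfloor>"
    have iff: "y \<in> {real m / ?b..<(real m + 1) / ?b} \<longleftrightarrow> m = m0" for m
    proof -
      have "y \<in> {real m / ?b..<(real m + 1) / ?b} \<longleftrightarrow> real m \<le> ?b * y \<and> ?b * y < real m + 1"
        using Bn by (simp add: field_simps)
      also have "\<dots> \<longleftrightarrow> \<lfloor>?b * y\<rfloor> = int m" by (simp add: floor_eq_iff)
      also have "\<dots> \<longleftrightarrow> m = m0" using True Bn by (auto simp: m0_def)
      finally show ?thesis .
    qed
    have "(\<lambda>m. ennreal (?q m) * indicator ({real m / ?b..<(real m + 1) / ?b} \<inter> {0<..}) y) = (\<lambda>m. if m = m0 then ennreal (?q m0) else 0)"
      using True iff by (auto simp: indicator_def)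
    then have "(\<Sum>m. ennreal (?q m) * indicator ({real m / ?b..<(real m + 1) / ?b} \<inter> {0<..}) y) = ennreal (?q m0)"
      using sums_unique[OF sums_single[of m0 "\<lambda>_. ennreal (?q m0)"]] by simp
    then show ?thesis using True by (simp add: Dens_def m0_def)
  qed simp
  \<comment> \<open>Intersecting with \<open>{0<..}\<close> matters only for \<open>m = 0\<close>,
    where it removes the single point 0.\<close>
  have em: "emeasure lborel ({real m / ?b..<(real m + 1) / ?b} \<inter> {0<..}) = ennreal (1 / ?b)" for m
  proof -
    have "emeasure lborel ({real m / ?b..<(real m + 1) / ?b} \<inter> {0<..}) = emeasure lborel {real m / ?b<..<(real m + 1) / ?b}"
    proof (rule emeasure_eq_AE)
      show "AE x in lborel. (x \<in> {real m / ?b..<(real m + 1) / ?b} \<inter> {0<..}) = (x \<in> {real m / ?b<..<(real m + 1) / ?b})"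
        using AE_lborel_singleton[of "real m / ?b"]
      proof eventually_elim
        case (elim x)
        have "0 \<le> real m / ?b" using Bn by simp
        then show ?case using elim by auto
      qed
    qed auto
    also have "\<dots> = ennreal (1 / ?b)" using Bn by (simp add: divide_right_mono diff_divide_distrib[symmetric])
    finally show ?thesis .
  qed
  have "ennreal (LBINT y:{0<..}. Dens n y) = (\<integral>\<^sup>+y. ennreal (indicator {0<..} y *\<^sub>R Dens n y) \<partial>lborel)"
    unfolding set_lebesgue_integral_def using int
    by (intro nn_integral_eq_integral[symmetric]) (auto simp: set_integrable_def Dens_def p_nonneg)
  also have "\<dots> = (\<Sum>m. \<integral>\<^sup>+y. ennreal (?q m) * indicator ({real m / ?b..<(real m + 1) / ?b} \<inter> {0<..}) y \<partial>lborel)"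
    unfolding pt by (rule nn_integral_suminf) simp
  also have "\<dots> = (\<Sum>m. ennreal (?q m / ?b))"
  proof (intro suminf_cong)
    fix m
    show "(\<integral>\<^sup>+y. ennreal (?q m) * indicator ({real m / ?b..<(real m + 1) / ?b} \<inter> {0<..}) y \<partial>lborel) = ennreal (?q m / ?b)"
      using q0[of m] Bn by (subst nn_integral_cmult_indicator) (auto simp: em ennreal_mult[symmetric] simp del: times_divide_eq_left)
  qed
  finally have eq: "ennreal (LBINT y:{0<..}. Dens n y) = (\<Sum>m. ennreal (?q m / ?b))" .
  have qb: "0 \<le> ?q m / ?b" for m using q0[of m] Bn by simp
  \<comment> \<open>The real series in \<open>renewal_mass\<close> has its intended value only if it
    converges; this comes from the finite integral.\<close>
  have sm: "summable (\<lambda>m. ?q m / ?b)"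
    by (rule summable_suminf_not_top[OF qb]) (simp flip: eq)
  then have "ennreal (LBINT y:{0<..}. Dens n y) = ennreal (\<Sum>m. ?q m / ?b)"
    using eq suminf_ennreal2[OF qb sm] by simp
  moreover have "0 \<le> (LBINT y:{0<..}. Dens n y)"
    unfolding set_lebesgue_integral_def by (intro integral_nonneg_AE AE_I2) (auto simp: Dens_def p_nonneg split: split_indicator)
  moreover have "0 \<le> (\<Sum>m. ?q m / ?b)" using sm qb by (intro suminf_nonneg)
  ultimately have 1: "(LBINT y:{0<..}. Dens n y) = (\<Sum>m. ?q m / ?b)" by simp
  show ?thesis
  proof (cases "n = 0")
    case False
    have "summable (\<lambda>m. ?b / real n * (?q m / ?b))" using sm by (rule summable_mult)
    then have "summable (\<lambda>m. p m n)" using False Bn by simp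
    then have "(\<Sum>m. real n / ?b * p m n) = real n / ?b * (\<Sum>m. p m n)" by (rule suminf_mult)
    then show ?thesis unfolding 1 by (simp add: renewal_mass_def p_def)
  qed (simp add: set_lebesgue_integral_def Dens_def)
qed

theorem strong_renewal:
  "(\<lambda>n. \<bar>real n powr (1 - \<alpha>) * ell \<alpha> l1 (real n) * renewal_mass P X n
     - \<alpha> * (LBINT x:{0<..}. semistable_density \<alpha> M
           (position k (inverse_norming \<alpha> l1 (real n) * x powr (- \<alpha>))) x * x powr (- \<alpha>))\<bar>) \<longlonglongrightarrow> 0"
proof -
  obtain K where K: "0 < K" and evD: "\<forall>\<^sub>F n in sequentially. 0 < B (real n) \<and> (\<forall>y>0. Dens n y \<le> K * dom y)"
    using Dens_bound by blast
  obtain K' where K': "0 < K'" and tb: "\<And>lam y. 0 < lam \<Longrightarrow> 0 < y \<Longrightarrow> target lam y \<le> K' * dom y"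
    using target_bound by metis
  obtain N where N: "\<And>n. N \<le> n \<Longrightarrow> 0 < B (real n)" "\<And>n y. N \<le> n \<Longrightarrow> 0 < y \<Longrightarrow> Dens n y \<le> K * dom y"
    using evD unfolding eventually_sequentially by blast
  define T where "T n y = target (position k (B (real n) * y)) y" for n y
  have D0: "0 \<le> Dens n y" for n y by (simp add: Dens_def p_nonneg)
  have T0: "0 \<le> T n y" "T n y \<le> K' * dom y" if n: "N \<le> n" and y: "0 < y" for n y
  proof -
    have pp: "0 < position k (B (real n) * y)" by (rule position_pos[OF mult_pos_pos[OF N(1)[OF n] y]])
    show "0 \<le> T n y" unfolding T_def by (rule target_nonneg[OF pp])
    show "T n y \<le> K' * dom y" unfolding T_def by (rule tb[OF pp y])
  qed
  have Di: "set_integrable lborel {0<..} (Dens n)" if n: "N \<le> n" for n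
    unfolding set_integrable_def
    by (rule Bochner_Integration.integrable_bound[OF integrable_mult_right[OF dom_integrable[unfolded set_integrable_def], of K]])
      (use N(2)[OF n] D0 in \<open>auto split: split_indicator simp: abs_of_nonneg intro: order.trans[OF _ abs_ge_self]\<close>)
  have Tm: "(\<lambda>y. indicator {0<..} y *\<^sub>R T n y) \<in> borel_measurable lborel" if "N \<le> n" for n
    using target_measurable[OF N(1)[OF that]] by (simp add: T_def)
  have Ti: "set_integrable lborel {0<..} (T n)" if n: "N \<le> n" for n
    unfolding set_integrable_def
    by (rule Bochner_Integration.integrable_bound[OF integrable_mult_right[OF dom_integrable[unfolded set_integrable_def], of K'] Tm[OF n]])
      (use T0[OF n] in \<open>auto split: split_indicator simp: abs_of_nonneg intro: order.trans[OF _ abs_ge_self]\<close>)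
  have "(\<lambda>n. LBINT y. indicator {0<..} y *\<^sub>R Dens (n + N) y - indicator {0<..} y *\<^sub>R T (n + N) y) \<longlonglongrightarrow> (LBINT y::real. 0)"
  proof (rule integral_dominated_convergence)
    show "integrable lborel (\<lambda>y. (K + K') * (indicator {0<..} y *\<^sub>R dom y))"
      by (rule integrable_mult_right[OF dom_integrable[unfolded set_integrable_def]])
    show "AE y in lborel. (\<lambda>n. indicator {0<..} y *\<^sub>R Dens (n + N) y - indicator {0<..} y *\<^sub>R T (n + N) y) \<longlonglongrightarrow> 0"
    proof (rule AE_I2)
      fix y :: real
      show "(\<lambda>n. indicator {0<..} y *\<^sub>R Dens (n + N) y - indicator {0<..} y *\<^sub>R T (n + N) y) \<longlonglongrightarrow> 0"
        using LIMSEQ_ignore_initial_segment[OF Dens_minus_target, of y N]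
        by (cases "0 < y") (auto simp: T_def)
    qed
    show "AE y in lborel. norm (indicator {0<..} y *\<^sub>R Dens (n + N) y - indicator {0<..} y *\<^sub>R T (n + N) y) \<le> (K + K') * (indicator {0<..} y *\<^sub>R dom y)" for n
    proof (rule AE_I2)
      fix y :: real
      show "norm (indicator {0<..} y *\<^sub>R Dens (n + N) y - indicator {0<..} y *\<^sub>R T (n + N) y) \<le> (K + K') * (indicator {0<..} y *\<^sub>R dom y)"
      proof (cases "0 < y")
        case True
        have "\<bar>Dens (n + N) y - T (n + N) y\<bar> \<le> K * dom y + K' * dom y"
          using N(2)[of "n + N" y] T0[of "n + N" y] D0[of "n + N" y] True by (auto simp: abs_le_iff)
        then show ?thesis using True by (simp add: distrib_right)
      qed simp
    qed
    show "(\<lambda>y. indicator {0<..} y *\<^sub>R Dens (n + N) y - indicator {0<..} y *\<^sub>R T (n + N) y) \<in> borel_measurable lborel" for n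
      using Tm[of "n + N"] by (intro borel_measurable_diff) simp_all
  qed simp
  then have lim: "(\<lambda>n. \<bar>LBINT y. indicator {0<..} y *\<^sub>R Dens (n + N) y - indicator {0<..} y *\<^sub>R T (n + N) y\<bar>) \<longlonglongrightarrow> 0"
    by (simp add: tendsto_rabs_zero_iff)
  have main: "(LBINT y. indicator {0<..} y *\<^sub>R Dens n y - indicator {0<..} y *\<^sub>R T n y)
    = real n powr (1 - \<alpha>) * ell \<alpha> l1 (real n) * renewal_mass P X n
      - \<alpha> * (LBINT x:{0<..}. g (position k (B (real n) * x powr (- \<alpha>))) x * x powr (- \<alpha>))" if n: "N \<le> n" "1 \<le> n" for n
  proof -
    have "(LBINT y. indicator {0<..} y *\<^sub>R Dens n y - indicator {0<..} y *\<^sub>R T n y) = (LBINT y:{0<..}. Dens n y) - (LBINT y:{0<..}. T n y)"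
      unfolding set_lebesgue_integral_def using Di[OF n(1)] Ti[OF n(1)] unfolding set_integrable_def
      by (rule Bochner_Integration.integral_diff)
    moreover have "(LBINT y:{0<..}. Dens n y) = real n powr (1 - \<alpha>) * ell \<alpha> l1 (real n) * renewal_mass P X n"
    proof -
      have "real n / B (real n) = real n powr (1 - \<alpha>) * ell \<alpha> l1 (real n)"
        using n by (simp add: inverse_norming_def powr_diff)
      then show ?thesis using Dens_integral[OF N(1)[OF n(1)] Di[OF n(1)]] by simp
    qed
    moreover have "(LBINT y:{0<..}. T n y) = \<alpha> * (LBINT x:{0<..}. g (position k (B (real n) * x powr (- \<alpha>))) x * x powr (- \<alpha>))"
    proof -
      have "(LBINT y:{0<..}. T n y) = (LBINT x:{0<..}. \<alpha> * x powr (- \<alpha> - 1) * T n (x powr (- \<alpha>)))"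
        by (rule integral_powr_substitution[OF alpha_pos Ti[OF n(1)], symmetric])
      also have "\<dots> = (LBINT x:{0<..}. \<alpha> * (g (position k (B (real n) * x powr (- \<alpha>))) x * x powr (- \<alpha>)))"
      proof (rule set_lebesgue_integral_cong)
        show "\<forall>x. x \<in> {0<..} \<longrightarrow> \<alpha> * x powr (- \<alpha> - 1) * T n (x powr (- \<alpha>)) = \<alpha> * (g (position k (B (real n) * x powr (- \<alpha>))) x * x powr (- \<alpha>))"
        proof (intro allI impI)
          fix x :: real assume "x \<in> {0<..}"
          then have x: "0 < x" by simp
          have "(x powr (- \<alpha>)) powr (- (1 / \<alpha>)) = x" using x alpha_pos by (simp add: powr_powr)
          moreover have "x powr (- \<alpha> - 1) * x = x powr (- \<alpha>)" using x by (simp add: powr_diff)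
          ultimately show "\<alpha> * x powr (- \<alpha> - 1) * T n (x powr (- \<alpha>)) = \<alpha> * (g (position k (B (real n) * x powr (- \<alpha>))) x * x powr (- \<alpha>))"
            by (simp add: T_def target_def mult_ac)
        qed
      qed simp
      also have "\<dots> = \<alpha> * (LBINT x:{0<..}. g (position k (B (real n) * x powr (- \<alpha>))) x * x powr (- \<alpha>))"
        by (rule set_integral_mult_right)
      finally show ?thesis .
    qed
    ultimately show ?thesis by simp
  qed
  show ?thesis
  proof (rule LIMSEQ_offset)
    show "(\<lambda>n. \<bar>real (n + N) powr (1 - \<alpha>) * ell \<alpha> l1 (real (n + N)) * renewal_mass P X (n + N)
     - \<alpha> * (LBINT x:{0<..}. semistable_density \<alpha> M
           (position k (inverse_norming \<alpha> l1 (real (n + N)) * x powr (- \<alpha>))) x * x powr (- \<alpha>))\<bar>) \<longlonglongrightarrow> 0"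
    proof (rule Lim_transform_eventually[OF lim])
      show "\<forall>\<^sub>F n in sequentially. \<bar>LBINT y. indicator {0<..} y *\<^sub>R Dens (n + N) y - indicator {0<..} y *\<^sub>R T (n + N) y\<bar>
        = \<bar>real (n + N) powr (1 - \<alpha>) * ell \<alpha> l1 (real (n + N)) * renewal_mass P X (n + N)
     - \<alpha> * (LBINT x:{0<..}. semistable_density \<alpha> M
           (position k (inverse_norming \<alpha> l1 (real (n + N)) * x powr (- \<alpha>))) x * x powr (- \<alpha>))\<bar>"
        using eventually_ge_at_top[of 1]
      proof eventually_elim
        case (elim n)
        show ?case using elim by (subst main) simp_all
      qed
    qed
  qed
qed

end

theorem theorem4:
  fixes P :: "'a measure" and X :: "nat \<Rightarrow> 'a \<Rightarrow> nat" and F :: "real \<Rightarrow> real"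
    and \<alpha> c :: real and k :: "nat \<Rightarrow> nat" and l1 M\<^sub>R h\<^sub>R :: "real \<Rightarrow> real"
  assumes alpha: "1 / 2 < \<alpha>" "\<alpha> < 1"
    and c: "1 < c"
    and k: "k 0 = 0" "strict_mono k" "(\<lambda>n. real (k (n + 1)) / real (k n)) \<longlonglongrightarrow> c"
    and l1: "\<And>x. 1 \<le> x \<Longrightarrow> 0 < l1 x" "slowly_varying l1"
    and M_pos: "\<And>x. 0 < x \<Longrightarrow> 0 < M\<^sub>R x"
    and M_bounded: "\<exists>K. \<forall>x>0. M\<^sub>R x \<le> K"
    and M_bounded_away: "\<exists>m>0. \<forall>x>0. m \<le> M\<^sub>R x"
    and M_right_cont: "\<And>x. 0 < x \<Longrightarrow> continuous (at_right x) M\<^sub>R"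
    and M_not_const: "\<exists>x>0. \<exists>y>0. M\<^sub>R x \<noteq> M\<^sub>R y"
    and M_periodic: "\<And>x. 0 < x \<Longrightarrow> M\<^sub>R (c powr (1 / \<alpha>) * x) = M\<^sub>R x"
    and M_mono: "antimono_on {0<..} (\<lambda>x. M\<^sub>R x * x powr (- \<alpha>))"
    and prob: "prob_space P"
    and indep: "prob_space.indep_vars P (\<lambda>_. count_space UNIV) X UNIV"
    and ident: "\<And>i. distr P (count_space UNIV) (X i) = distr P (count_space UNIV) (X 0)"
    and span: "has_span P (\<lambda>\<omega>. real (X 0 \<omega>)) 1"
    and F: "F = cdf (distr P borel (\<lambda>\<omega>. real (X 0 \<omega>)))"
    and tail: "\<forall>\<^sub>F x in at_top. 1 - F x = ell \<alpha> l1 x / x powr \<alpha> * (M\<^sub>R (delta \<alpha> l1 k x) + h\<^sub>R x)"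
    and h_right_cont: "\<And>x. 0 < x \<Longrightarrow> continuous (at_right x) h\<^sub>R"
    and h_lim: "\<And>x. 0 < x \<Longrightarrow> isCont M\<^sub>R x \<Longrightarrow>
                  (\<lambda>n. h\<^sub>R (norming \<alpha> l1 (real (k n)) * x)) \<longlonglongrightarrow> 0"
  shows "(\<lambda>n. \<bar>real n powr (1 - \<alpha>) * ell \<alpha> l1 (real n) * renewal_mass P X n
             - \<alpha> * (LBINT x:{0<..}.
                 semistable_density \<alpha> M\<^sub>R
                   (position k (inverse_norming \<alpha> l1 (real n) * x powr (- \<alpha>))) x
                 * x powr (- \<alpha>))\<bar>) \<longlonglongrightarrow> 0"
proof -
  interpret P: prob_space P by (rule prob)
  have X: "X i \<in> measurable P (count_space UNIV)" for i
    using indep unfolding P.indep_vars_def by auto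
  have "(\<lambda>\<omega>. real (X 0 \<omega>)) \<in> borel_measurable P"
    by (rule measurable_compose[OF X]) simp
  then interpret D: real_distribution "distr P borel (\<lambda>\<omega>. real (X 0 \<omega>))"
    by (rule P.real_distribution_distr)
  interpret semistable_renewal F \<alpha> c k l1 M\<^sub>R h\<^sub>R P X
  proof
    show "mono F" unfolding F by (intro monoI D.cdf_nondecreasing)
    show "0 \<le> F x" for x unfolding F by (rule D.cdf_nonneg)
    show "(F \<longlongrightarrow> 1) at_top" unfolding F by (rule D.cdf_lim_at_top_prob)
  qed (fact assms)+
  show ?thesis by (rule strong_renewal)
qed

end
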